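(* Let $n\ge 1$, $a<b$, and let $\gamma=(\gamma_1,\dots,\gamma_{n+1}):[a,b]\to\mathbb{R}^{n+1}$ be in $C([a,b])\cap C^{n+1}((a,b))$ with totally positive torsion. Let $U_n,L_n$ be the maps and $B^{\sup},B^{\inf}$ the functions defined in the context, and $\overline{\gamma}=(\gamma_1,\dots,\gamma_n)$. Then the following hold. (1) If $n=2\ell$, $\ell\ge 1$, then $$\overline{U}_{2\ell}(\partial(\Delta_c^{\ell}\times\Delta_*^{\ell}))=\overline{L}_{2\ell}(\partial(\Delta_c^{\ell}\times\Delta_*^{\ell}))=\partial\,\mathrm{conv}(\overline{\gamma}([a,b])),$$ and both $\overline{U}_{2\ell}$ and $\overline{L}_{2\ell}$ restrict to diffeomorphisms from $\mathrm{int}(\Delta_c^{\ell}\times\Delta_*^{\ell})$ onto $\mathrm{int}(\mathrm{conv}(\overline{\gamma}([a,b])))$. (2) If $n=2\ell-1$, $\ell\ge1$, then $$\overline{U}_{2\ell-1}(\partial(\Delta_c^{\ell}\times\Delta_*^{\ell-1}))=\overline{L}_{2\ell-1}(\partial(\Delta_c^{\ell-1}\times\Delta_*^{\ell}))=\partial\,\mathrm{conv}(\overline{\gamma}([a,b])),$$ $\overline{U}_{2\ell-1}$ restricts to a diffeomorphism from $\mathrm{int}(\Delta_c^{\ell}\times\Delta_*^{\ell-1})$ onto $\mathrm{int}(\mathrm{conv}(\overline{\gamma}([a,b])))$, and $\overline{L}_{2\ell-1}$ restricts to a diffeomorphism from $\mathrm{int}(\Delta_c^{\ell-1}\times\Delta_*^{\ell})$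 onto $\mathrm{int}(\mathrm{conv}(\overline{\gamma}([a,b])))$. (3) For all $n\ge1$, $B^{\sup}$ and $B^{\inf}$ are well defined, and both belong to $C(\mathrm{conv}(\overline{\gamma}([a,b])))\cap C^1(\mathrm{int}(\mathrm{conv}(\overline{\gamma}([a,b]))))$. (4) For all $n\ge 1$, $B^{\sup}$ is the minimal concave function on $\mathrm{conv}(\overline{\gamma}([a,b]))$ with $B^{\sup}(\overline{\gamma}(t))=\gamma_{n+1}(t)$ for all $t\in[a,b]$ (when $n=1$ this equality is replaced by $B^{\sup}(\overline{\gamma}(t))\ge\gamma_2(t)$ for all $t\in[a,b]$); and $B^{\inf}$ is the maximal convex function on $\mathrm{conv}(\overline{\gamma}([a,b]))$ with $B^{\inf}(\overline{\gamma}(t))=\gamma_{n+1}(t)$ for all $t\in[a,b]$. (5) For $y\in\mathrm{conv}(\overline{\gamma}([a,b]))$, $B^{\inf}(y)=B^{\sup}(y)$ if and only if $y\in\partial\,\mathrm{conv}(\overline{\gamma}([a,b]))$. (6) $$\partial\,\mathrm{conv}(\gamma([a,b]))=\{(x,B^{\sup}(x)):x\in\mathrm{conv}(\overline{\gamma}([a,b]))\}\cup\{(x,B^{\inf}(x)):x\in\mathrm{conv}(\overline{\gamma}([a,b]))\}.$$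
   Context: Totally positive torsion: a curve $\gamma\in C([a,b],\mathbb{R}^{n+1})\cap C^{n+1}((a,b),\mathbb{R}^{n+1})$ has totally positive torsion if for every $t\in(a,b)$ all leading principal minors of the $(n+1)\times(n+1)$ matrix with columns $(\gamma'(t),\gamma''(t),\dots,\gamma^{(n+1)}(t))$ are positive. Notation: $\mathrm{conv}$ is convex hull, $\partial$ and $\mathrm{int}$ are topological boundary and interior (in $\mathbb{R}^n$ for the parameter domains and for $\mathrm{conv}(\overline{\gamma}([a,b]))$, in $\mathbb{R}^{n+1}$ for $\mathrm{conv}(\gamma([a,b]))$). For $v=(v_1,\dots,v_d)\in\mathbb{R}^d$, $\overline{v}=(v_1,\dots,v_{d-1})$ and $v^z=v_d$; for a map $F$ with values in $\mathbb{R}^d$, $\overline{F}$ and $F^z$ are defined pointwise. Diffeomorphism means a $C^1$ bijection with $C^1$ inverse. Set $$\Delta_c^k=\{(r_1,\dots,r_k)\in\mathbb{R}^k: r_j\ge0,\ r_1+\dots+r_k\le1\},\qquad \Delta_*^k=\{(y_1,\dots,y_k)\in\mathbb{R}^k: a\le y_1\le\dots\le y_k\le b\}.$$ ($\Delta_c^0$ and $\Delta_*^0$ are single points, and factors of this form are dropped; empty sums are $0$.) If $n=2\ell$, for $(\lambda_1,\dots,\lambda_\ell,x_1,\dots,x_\ell)\in\Delta_c^\ell\times\Delta_*^\ell$: $$U_n=\sum_{j=1}^\ell\lambda_j\gamma(x_j)+\Big(1-\sum_{j=1}^\ell\lambda_j\Big)\gamma(b),\qquad L_n=\Big(1-\sum_{j=1}^\ell\lambda_j\Big)\gamma(a)+\sum_{j=1}^\ell\lambda_j\gamma(x_j).$$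 If $n=2\ell-1$: for $(\beta_1,\dots,\beta_\ell,x_2,\dots,x_\ell)\in\Delta_c^\ell\times\Delta_*^{\ell-1}$, $$U_n=\Big(1-\sum_{j=1}^\ell\beta_j\Big)\gamma(a)+\sum_{j=2}^\ell\beta_j\gamma(x_j)+\beta_1\gamma(b),$$ and for $(\beta_2,\dots,\beta_\ell,x_1,\dots,x_\ell)\in\Delta_c^{\ell-1}\times\Delta_*^\ell$, $$L_n=\Big(1-\sum_{j=2}^\ell\beta_j\Big)\gamma(x_1)+\sum_{j=2}^\ell\beta_j\gamma(x_j).$$ In particular for $n=1$: $U_1(\beta_1)=(1-\beta_1)\gamma(a)+\beta_1\gamma(b)$ on $[0,1]$ and $L_1(x_1)=\gamma(x_1)$ on $[a,b]$. The functions $B^{\sup}$ (on the image of $\overline{U}_n$) and $B^{\inf}$ (on the image of $\overline{L}_n$) are defined by $B^{\sup}(\overline{U}_n(s))=U_n^z(s)$ and $B^{\inf}(\overline{L}_n(s))=L_n^z(s)$ for all $s$ in the respective domains. "Well defined" means: $\overline{U}_n(s_1)=\overline{U}_n(s_2)$ implies $U_n^z(s_1)=U_n^z(s_2)$, and likewise for $L_n$. "Minimal concave function with a given property" means: it is concave, has the property, and is pointwise $\le$ every concave function on the same domain having the property; "maximal convex" is understood analogously (convex, has the property, pointwise $\ge$ every convex function having it). *)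

theory Defs
  imports "HOL-Analysis.Analysis" "Jordan_Normal_Form.Determinant"
begin

text \<open>
  Conventions.  \<open>\<real>\<^sup>n\<close> is \<open>real ^ 'n\<close> with \<open>'n :: {finite, linorder}\<close> and \<open>n = CARD('n)\<close>; the linear
  order on the index type says which coordinate is the first, the second, and so on.
  \<open>\<real>\<^sup>n\<^sup>+\<^sup>1\<close> is \<open>(real ^ 'n) \<times> real\<close>, so that \<open>fst\<close> drops the last coordinate and \<open>snd\<close> is the last
  coordinate.  Coordinates are numbered from 1.
\<close>

definition coord :: "real ^ 'n::{finite,linorder} \<Rightarrow> nat \<Rightarrow> real" where
  "coord v i = vec_nth v (sorted_list_of_set (UNIV :: 'n set) ! (i - 1))"

definition coord_ext :: "(real ^ 'n::{finite,linorder}) \<times> real \<Rightarrow> nat \<Rightarrow> real" where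
  "coord_ext v i = (if i \<le> CARD('n) then coord (fst v) i else snd v)"

definition nth_vderiv :: "nat \<Rightarrow> (real \<Rightarrow> 'a::real_normed_vector) \<Rightarrow> real \<Rightarrow> 'a" where
  "nth_vderiv k f = ((\<lambda>g t. vector_derivative g (at t)) ^^ k) f"

text \<open>The following two notions are meant for open \<open>S\<close> only.\<close>

definition Ck_curve_on :: "nat \<Rightarrow> (real \<Rightarrow> 'a::real_normed_vector) \<Rightarrow> real set \<Rightarrow> bool" where
  "Ck_curve_on k f S \<longleftrightarrow>
     (\<forall>j<k. \<forall>t\<in>S. nth_vderiv j f differentiable (at t)) \<and>
     (\<forall>j\<le>k. continuous_on S (nth_vderiv j f))"

definition C1_on :: "('a::euclidean_space \<Rightarrow> 'b::real_normed_vector) \<Rightarrow> 'a set \<Rightarrow> bool" where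
  "C1_on f S \<longleftrightarrow>
     (\<exists>f' :: 'a \<Rightarrow> ('a \<Rightarrow>\<^sub>L 'b).
        (\<forall>x\<in>S. (f has_derivative blinfun_apply (f' x)) (at x)) \<and> continuous_on S f')"

definition C1_diffeo :: "('a::euclidean_space \<Rightarrow> 'b::euclidean_space) \<Rightarrow> 'a set \<Rightarrow> 'b set \<Rightarrow> bool" where
  "C1_diffeo f S T \<longleftrightarrow> bij_betw f S T \<and> C1_on f S \<and> C1_on (inv_into S f) T"

definition torsion_matrix ::
    "(real \<Rightarrow> (real ^ 'n::{finite,linorder}) \<times> real) \<Rightarrow> real \<Rightarrow> real mat" where
  "torsion_matrix \<gamma> t =
     mat (CARD('n) + 1) (CARD('n) + 1) (\<lambda>(i, j). coord_ext (nth_vderiv (j + 1) \<gamma> t) (i + 1))"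

definition leading_principal_minor :: "real mat \<Rightarrow> nat \<Rightarrow> real" where
  "leading_principal_minor A k = Determinant.det (mat k k (\<lambda>ij. A $$ ij))"

definition totally_positive_torsion ::
    "real \<Rightarrow> real \<Rightarrow> (real \<Rightarrow> (real ^ 'n::{finite,linorder}) \<times> real) \<Rightarrow> bool" where
  "totally_positive_torsion a b \<gamma> \<longleftrightarrow>
     (\<forall>t\<in>{a<..<b}. \<forall>k\<in>{1..CARD('n) + 1}. leading_principal_minor (torsion_matrix \<gamma> t) k > 0)"

text \<open>
  Only the entries \<open>1, \<dots>, k\<close> of the sequences below matter.  \<open>Delta_prod p q a b\<close> is
  \<open>\<Delta>\<^sub>c\<^sup>p \<times> \<Delta>\<^sub>*\<^sup>q\<close> as a subset of \<open>\<real>\<^sup>n\<close>, to be used with \<open>p + q = n\<close>: coordinates \<open>1, \<dots>, p\<close> are the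
  weights and coordinates \<open>p + 1, \<dots>, p + q\<close> the nodes.
\<close>

definition Delta_c :: "nat \<Rightarrow> (nat \<Rightarrow> real) set" where
  "Delta_c k = {r. (\<forall>j\<in>{1..k}. 0 \<le> r j) \<and> (\<Sum>j=1..k. r j) \<le> 1}"

definition Delta_star :: "nat \<Rightarrow> real \<Rightarrow> real \<Rightarrow> (nat \<Rightarrow> real) set" where
  "Delta_star k a b =
     {y. (\<forall>j\<in>{1..k}. a \<le> y j \<and> y j \<le> b) \<and> (\<forall>j\<in>{1..<k}. y j \<le> y (j + 1))}"

definition Delta_prod :: "nat \<Rightarrow> nat \<Rightarrow> real \<Rightarrow> real \<Rightarrow> (real ^ 'n::{finite,linorder}) set" where
  "Delta_prod p q a b = {s. coord s \<in> Delta_c p \<and> (\<lambda>j. coord s (p + j)) \<in> Delta_star q a b}"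

text \<open>
  In the odd cases the parameter vectors are \<open>(\<beta>\<^sub>1, \<dots>, \<beta>\<^sub>l, x\<^sub>2, \<dots>, x\<^sub>l)\<close> for \<open>U_odd\<close> and
  \<open>(\<beta>\<^sub>2, \<dots>, \<beta>\<^sub>l, x\<^sub>1, \<dots>, x\<^sub>l)\<close> for \<open>L_odd\<close>, which explains the index shifts.
\<close>

definition U_even :: "nat \<Rightarrow> real \<Rightarrow> real \<Rightarrow> (real \<Rightarrow> (real ^ 'n::{finite,linorder}) \<times> real)
    \<Rightarrow> real ^ 'n::{finite,linorder} \<Rightarrow> (real ^ 'n::{finite,linorder}) \<times> real" where
  "U_even l a b \<gamma> s =
     (let lam = (\<lambda>j. coord s j); x = (\<lambda>j. coord s (l + j))
      in (\<Sum>j=1..l. lam j *\<^sub>R \<gamma> (x j)) + (1 - (\<Sum>j=1..l. lam j)) *\<^sub>R \<gamma> b)"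

definition L_even :: "nat \<Rightarrow> real \<Rightarrow> real \<Rightarrow> (real \<Rightarrow> (real ^ 'n::{finite,linorder}) \<times> real)
    \<Rightarrow> real ^ 'n::{finite,linorder} \<Rightarrow> (real ^ 'n::{finite,linorder}) \<times> real" where
  "L_even l a b \<gamma> s =
     (let lam = (\<lambda>j. coord s j); x = (\<lambda>j. coord s (l + j))
      in (1 - (\<Sum>j=1..l. lam j)) *\<^sub>R \<gamma> a + (\<Sum>j=1..l. lam j *\<^sub>R \<gamma> (x j)))"

definition U_odd :: "nat \<Rightarrow> real \<Rightarrow> real \<Rightarrow> (real \<Rightarrow> (real ^ 'n::{finite,linorder}) \<times> real)
    \<Rightarrow> real ^ 'n::{finite,linorder} \<Rightarrow> (real ^ 'n::{finite,linorder}) \<times> real" where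
  "U_odd l a b \<gamma> s =
     (let \<beta> = (\<lambda>j. coord s j); x = (\<lambda>j. coord s (l + (j - 1)))
      in (1 - (\<Sum>j=1..l. \<beta> j)) *\<^sub>R \<gamma> a + (\<Sum>j=2..l. \<beta> j *\<^sub>R \<gamma> (x j)) + \<beta> 1 *\<^sub>R \<gamma> b)"

definition L_odd :: "nat \<Rightarrow> real \<Rightarrow> real \<Rightarrow> (real \<Rightarrow> (real ^ 'n::{finite,linorder}) \<times> real)
    \<Rightarrow> real ^ 'n::{finite,linorder} \<Rightarrow> (real ^ 'n::{finite,linorder}) \<times> real" where
  "L_odd l a b \<gamma> s =
     (let \<beta> = (\<lambda>j. coord s (j - 1)); x = (\<lambda>j. coord s ((l - 1) + j))
      in (1 - (\<Sum>j=2..l. \<beta> j)) *\<^sub>R \<gamma> (x 1) + (\<Sum>j=2..l. \<beta> j *\<^sub>R \<gamma> (x j)))"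

definition U_map :: "real \<Rightarrow> real \<Rightarrow> (real \<Rightarrow> (real ^ 'n::{finite,linorder}) \<times> real)
    \<Rightarrow> real ^ 'n::{finite,linorder} \<Rightarrow> (real ^ 'n::{finite,linorder}) \<times> real" where
  "U_map a b \<gamma> =
     (if even CARD('n) then U_even (CARD('n) div 2) a b \<gamma>
      else U_odd ((CARD('n) + 1) div 2) a b \<gamma>)"

definition L_map :: "real \<Rightarrow> real \<Rightarrow> (real \<Rightarrow> (real ^ 'n::{finite,linorder}) \<times> real)
    \<Rightarrow> real ^ 'n::{finite,linorder} \<Rightarrow> (real ^ 'n::{finite,linorder}) \<times> real" where
  "L_map a b \<gamma> =
     (if even CARD('n) then L_even (CARD('n) div 2) a b \<gamma>
      else L_odd ((CARD('n) + 1) div 2) a b \<gamma>)"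

definition U_dom :: "real \<Rightarrow> real \<Rightarrow> (real ^ 'n::{finite,linorder}) set" where
  "U_dom a b =
     (if even CARD('n) then Delta_prod (CARD('n) div 2) (CARD('n) div 2) a b
      else Delta_prod ((CARD('n) + 1) div 2) ((CARD('n) + 1) div 2 - 1) a b)"

definition L_dom :: "real \<Rightarrow> real \<Rightarrow> (real ^ 'n::{finite,linorder}) set" where
  "L_dom a b =
     (if even CARD('n) then Delta_prod (CARD('n) div 2) (CARD('n) div 2) a b
      else Delta_prod ((CARD('n) + 1) div 2 - 1) ((CARD('n) + 1) div 2) a b)"

text \<open>
  \<open>graph_fun F D\<close> is the function on \<open>(fst \<circ> F) ` D\<close> whose graph is \<open>F ` D\<close>, that is,
  \<open>graph_fun F D (fst (F s)) = snd (F s)\<close> for \<open>s \<in> D\<close>.  It is meaningful only if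
  \<open>well_defined_graph F D\<close> holds.
\<close>

definition well_defined_graph :: "('p \<Rightarrow> 'a \<times> real) \<Rightarrow> 'p set \<Rightarrow> bool" where
  "well_defined_graph F D \<longleftrightarrow>
     (\<forall>s1\<in>D. \<forall>s2\<in>D. fst (F s1) = fst (F s2) \<longrightarrow> snd (F s1) = snd (F s2))"

definition graph_fun :: "('p \<Rightarrow> 'a \<times> real) \<Rightarrow> 'p set \<Rightarrow> 'a \<Rightarrow> real" where
  "graph_fun F D y = (THE z. \<exists>s\<in>D. fst (F s) = y \<and> snd (F s) = z)"

definition B_sup :: "real \<Rightarrow> real \<Rightarrow> (real \<Rightarrow> (real ^ 'n::{finite,linorder}) \<times> real)
    \<Rightarrow> real ^ 'n::{finite,linorder} \<Rightarrow> real" where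
  "B_sup a b \<gamma> = graph_fun (U_map a b \<gamma>) (U_dom a b)"

definition B_inf :: "real \<Rightarrow> real \<Rightarrow> (real \<Rightarrow> (real ^ 'n::{finite,linorder}) \<times> real)
    \<Rightarrow> real ^ 'n::{finite,linorder} \<Rightarrow> real" where
  "B_inf a b \<gamma> = graph_fun (L_map a b \<gamma>) (L_dom a b)"

definition minimal_concave ::
    "'a::real_vector set \<Rightarrow> (('a \<Rightarrow> real) \<Rightarrow> bool) \<Rightarrow> ('a \<Rightarrow> real) \<Rightarrow> bool" where
  "minimal_concave S P f \<longleftrightarrow>
     concave_on S f \<and> P f \<and> (\<forall>g. concave_on S g \<and> P g \<longrightarrow> (\<forall>y\<in>S. f y \<le> g y))"

definition maximal_convex ::
    "'a::real_vector set \<Rightarrow> (('a \<Rightarrow> real) \<Rightarrow> bool) \<Rightarrow> ('a \<Rightarrow> real) \<Rightarrow> bool" where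
  "maximal_convex S P f \<longleftrightarrow>
     convex_on S f \<and> P f \<and> (\<forall>g. convex_on S g \<and> P g \<longrightarrow> (\<forall>y\<in>S. g y \<le> f y))"

end

theory Submission
  imports Defs
begin

text \<open>
  Call a combination \<open>c\<^sub>0 + c\<^sub>1 \<gamma>\<^sub>1 + \<dots> + c\<^sub>m \<gamma>\<^sub>m\<close> with \<open>m \<le> n + 1\<close> a generalised polynomial of order \<open>m\<close>. The leading
  principal minors of the torsion matrix are the Wronskians of \<open>\<gamma>\<^sub>1', \<dots>, \<gamma>\<^sub>k'\<close>, and their positivity implies
  that a nontrivial generalised polynomial of order \<open>m\<close> has at most \<open>m\<close> zeros on \<open>[a, b]\<close>, counted with
  multiplicity in the interior (\<open>chebyshev_zero_count\<close>, \<open>gpoly_zero_count\<close>). The geometry rests on this count and two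
  consequences. Any \<open>n + 1\<close> points of the projected curve are affinely independent
  (\<open>nodes_independent\<close>). And given interior points counted twice and end points counted once, with total
  count \<open>m\<close>, there is a generalised polynomial of order exactly \<open>m\<close> that is nonnegative on \<open>[a, b]\<close> and
  vanishes precisely there; its leading coefficient is negative if and only if \<open>b\<close> is among the zeros
  (\<open>nonneg_gpoly\<close>).

  A generalised polynomial is an affine functional restricted to the curve, so the nonnegative ones are
  the supporting hyperplanes of the convex hull \<open>C\<close> of the curve, and of its projection \<open>K\<close> when the order
  is at most \<open>n\<close>. The maps \<open>U\<close> and \<open>L\<close> combine points of the curve whose count is \<open>n + 1\<close>, with \<open>b\<close> among them
  for \<open>U\<close> and not for \<open>L\<close>. On the boundary of the parameter domain the count drops to at most \<open>n\<close>: the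
  supporting hyperplane is vertical, the image lies on the frontier of \<open>K\<close>, and \<open>C\<close> has only one point
  above it (\<open>boundary_unique\<close>). In the interior of the parameter domain the supporting hyperplane is not
  vertical and lies above \<open>C\<close> for \<open>U\<close>, below for \<open>L\<close> (\<open>interior_extremal\<close>). Hence \<open>B_sup\<close> and \<open>B_inf\<close> are the upper and the
  lower boundary function of \<open>C\<close>, which gives concavity, convexity, extremality, the set where they
  agree, and the frontier of \<open>C\<close>.

  The projected maps are injective on the open domain by independence of the nodes (\<open>inj_on_rep\<close>), their
  derivatives are injective by the zero count with double zeros (\<open>Drep_injective\<close>), and they are onto the
  interior of \<open>K\<close> because that set is connected while the image is open and relatively closed in it
  (\<open>image_open_dom\<close>).
\<close>

section \<open>Zeros of combinations with positive Wronskians\<close>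

lemma mean_value:
  fixes f f' :: "real \<Rightarrow> real"
  assumes "s < t" "continuous_on {s..t} f"
    and "\<And>r. s < r \<Longrightarrow> r < t \<Longrightarrow> (f has_real_derivative f' r) (at r)"
  shows "\<exists>r. s < r \<and> r < t \<and> f t - f s = (t - s) * f' r"
proof -
  obtain r where "s < r" "r < t" "f t - f s = (*) (f' r) (t - s)"
    using mvt[OF assms(1,2), of "\<lambda>r. (*) (f' r)"] assms(3)
    by (metis has_field_derivative_def)
  then show ?thesis by (auto simp: mult.commute)
qed

text \<open>
  Consecutive zeros of \<open>f\<close> are separated by zeros of \<open>f'\<close>. That these lie strictly between the extreme
  zeros lets the induction add the largest zero last without meeting an old zero of \<open>f'\<close>.
\<close>

lemma rolle_zeros:
  fixes f f' :: "real \<Rightarrow> real"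
  assumes "finite Z" "Z \<noteq> {}" "Z \<subseteq> {lo..hi}"
    and cont: "continuous_on {lo..hi} f"
    and der: "\<And>t. lo < t \<Longrightarrow> t < hi \<Longrightarrow> (f has_real_derivative f' t) (at t)"
    and "\<And>z. z \<in> Z \<Longrightarrow> f z = 0"
  shows "\<exists>Y. finite Y \<and> Suc (card Y) = card Z \<and> Y \<inter> Z = {} \<and>
           (\<forall>y\<in>Y. Min Z < y \<and> y < Max Z \<and> f' y = 0)"
  using assms(1-3,6)
proof (induction Z rule: finite_linorder_max_induct)
  case empty
  then show ?case by simp
next
  case (insert m Z)
  show ?case
  proof (cases "Z = {}")
    case True
    then show ?thesis by (intro exI[of _ "{}"]) auto
  next
    case False
    then obtain Y where Y: "finite Y" "Suc (card Y) = card Z" "Y \<inter> Z = {}"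
      "\<And>y. y \<in> Y \<Longrightarrow> Min Z < y \<and> y < Max Z \<and> f' y = 0"
      using insert by (metis insert_iff insert_subset)
    have M: "Max Z \<in> Z" using False insert by simp
    have Mm: "Max Z < m" using M insert by blast
    have bnd: "lo \<le> Max Z" "m \<le> hi" using M insert.prems by auto
    obtain y where y: "Max Z < y" "y < m" "f m - f (Max Z) = (m - Max Z) * f' y"
      using mean_value[OF Mm, of f f'] continuous_on_subset[OF cont, of "{Max Z..m}"] bnd der
      by fastforce
    have y0: "f' y = 0" using y M Mm insert.prems by auto
    have Mi: "Max (insert m Z) = m" using insert False by (simp add: max.absorb1 Mm less_imp_le)
    have mi: "Min (insert m Z) = Min Z"
    proof -
      have "Min Z \<le> Max Z" using False insert by simp
      then show ?thesis using False insert Mm by (simp add: min.absorb2)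
    qed
    have zM: "z \<le> Max Z" if "z \<in> Z" for z using that insert by simp
    have mZ: "Min Z \<le> Max Z" using False insert by simp
    show ?thesis unfolding Mi mi
    proof (intro exI[of _ "insert y Y"] conjI ballI)
      have "y \<notin> Y" using Y(4) y by force
      moreover have "m \<notin> Z" using insert by blast
      ultimately show "Suc (card (insert y Y)) = card (insert m Z)"
        using Y insert by simp
      show "insert y Y \<inter> insert m Z = {}"
        using y Y zM Mm by force
    qed (use Y y y0 Mm mZ in \<open>fastforce+\<close>)
  qed
qed

text \<open>
  \<open>quot_deriv u i j\<close> is the \<open>j\<close>-th derivative of the quotient \<open>u i 0 / u 0 0\<close> when \<open>u i j\<close> is the \<open>j\<close>-th
  derivative of \<open>u i 0\<close>. The recursion solves the Leibniz rule for the product of this quotient with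
  \<open>u 0 0\<close>, so that no higher quotient rule is needed.
\<close>

fun quot_deriv :: "(nat \<Rightarrow> nat \<Rightarrow> real \<Rightarrow> real) \<Rightarrow> nat \<Rightarrow> nat \<Rightarrow> real \<Rightarrow> real" where
  "quot_deriv u i j t =
     (u i j t - (\<Sum>p<j. of_nat (j choose p) * quot_deriv u i p t * u 0 (j - p) t)) / u 0 0 t"

declare quot_deriv.simps [simp del]

lemma leibniz_quot_deriv:
  assumes "u 0 0 t \<noteq> 0"
  shows "u i j t = (\<Sum>p\<le>j. of_nat (j choose p) * quot_deriv u i p t * u 0 (j - p) t)"
  using assms quot_deriv.simps[of u i j t]
  by (simp add: lessThan_Suc_atMost[symmetric] field_simps)

lemma quot_deriv_first:
  assumes "u 0 0 t \<noteq> 0"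
  shows "quot_deriv u 0 j t = (if j = 0 then 1 else 0)"
proof (induction j rule: less_induct)
  case (less j)
  show ?case
  proof (cases "j = 0")
    case False
    have "(\<Sum>p<j. of_nat (j choose p) * quot_deriv u 0 p t * u 0 (j - p) t)
        = (\<Sum>p<j. if p = 0 then u 0 j t else 0)"
      using less by (intro sum.cong) auto
    then show ?thesis using False by (simp add: quot_deriv.simps[of u 0 j] )
  qed (use assms in \<open>simp add: quot_deriv.simps[of u 0 0]\<close>)
qed

text \<open>
  Differentiating the recursion gives back the recursion at the next order: the two sums that the
  product rule produces combine by Pascal's rule.
\<close>

lemma has_derivative_quot_deriv:
  assumes der: "\<And>j. Suc j < k \<Longrightarrow> (u i j has_real_derivative u i (Suc j) t) (at t)"
    and der0: "\<And>j. Suc j < k \<Longrightarrow> (u 0 j has_real_derivative u 0 (Suc j) t) (at t)"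
    and nz: "u 0 0 t \<noteq> 0"
  shows "Suc j < k \<Longrightarrow> (quot_deriv u i j has_real_derivative quot_deriv u i (Suc j) t) (at t)"
proof (induction j rule: less_induct)
  case (less j)
  let ?v = "\<lambda>p. quot_deriv u i p t" and ?w = "\<lambda>p. u 0 p t"
  let ?N = "\<lambda>s. u i j s - (\<Sum>p<j. of_nat (j choose p) * quot_deriv u i p s * u 0 (j - p) s)"
  let ?N' = "u i (Suc j) t - (\<Sum>p<j. of_nat (j choose p) * (?v (Suc p) * ?w (j - p) + ?v p * ?w (Suc j - p)))"
  have N: "(?N has_real_derivative ?N') (at t)"
  proof (intro DERIV_diff DERIV_sum)
    show "(u i j has_real_derivative u i (Suc j) t) (at t)" using der less.prems by simp
  next
    fix p assume p: "p \<in> {..<j}"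
    have 1: "(quot_deriv u i p has_real_derivative ?v (Suc p)) (at t)" using less p by simp
    have 2: "(u 0 (j - p) has_real_derivative ?w (Suc j - p)) (at t)"
      using der0[of "j - p"] less.prems p by (simp add: Suc_diff_le)
    show "((\<lambda>s. of_nat (j choose p) * quot_deriv u i p s * u 0 (j - p) s) has_real_derivative
        of_nat (j choose p) * (?v (Suc p) * ?w (j - p) + ?v p * ?w (Suc j - p))) (at t)"
      by (rule derivative_eq_intros 1 2 refl)+ (simp add: algebra_simps)
  qed
  have q: "quot_deriv u i j = (\<lambda>s. ?N s / u 0 0 s)"
    by (rule ext) (rule quot_deriv.simps)
  have "((\<lambda>s. ?N s / u 0 0 s) has_real_derivative (?N' * ?w 0 - ?N t * ?w 1) / (?w 0 * ?w 0)) (at t)"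
    using less.prems nz der0[of 0] by (intro DERIV_divide N) auto
  moreover have "(?N' * ?w 0 - ?N t * ?w 1) / (?w 0 * ?w 0) = ?v (Suc j)"
  proof -
    have Nv: "?N t = ?v j * ?w 0" using nz by (simp add: quot_deriv.simps[of u i j])
    have pascal: "(\<Sum>p<Suc j. of_nat (Suc j choose p) * ?v p * ?w (Suc j - p)) =
        (\<Sum>p<j. of_nat (j choose p) * (?v (Suc p) * ?w (j - p) + ?v p * ?w (Suc j - p))) + ?v j * ?w 1"
    proof -
      have "(\<Sum>p<Suc j. of_nat (Suc j choose p) * ?v p * ?w (Suc j - p)) =
         ?v 0 * ?w (Suc j) + (\<Sum>p<j. of_nat (Suc j choose Suc p) * ?v (Suc p) * ?w (j - p))"
        by (simp add: sum.lessThan_Suc_shift del: sum.lessThan_Suc)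
      also have "\<dots> = ?v 0 * ?w (Suc j) + (\<Sum>p<j. of_nat (j choose Suc p) * ?v (Suc p) * ?w (j - p))
           + (\<Sum>p<j. of_nat (j choose p) * ?v (Suc p) * ?w (j - p))"
        by (simp add: algebra_simps sum.distrib)
      also have "?v 0 * ?w (Suc j) + (\<Sum>p<j. of_nat (j choose Suc p) * ?v (Suc p) * ?w (j - p))
          = (\<Sum>p<Suc j. of_nat (j choose p) * ?v p * ?w (Suc j - p))"
        by (simp add: sum.lessThan_Suc_shift del: sum.lessThan_Suc)
      also have "\<dots> = (\<Sum>p<j. of_nat (j choose p) * ?v p * ?w (Suc j - p)) + ?v j * ?w 1"
        by simp
      finally show ?thesis by (simp add: algebra_simps sum.distrib)
    qed
    show ?thesis
      unfolding Nv quot_deriv.simps[of u i "Suc j"] pascal using nz by (simp add: field_simps)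
  qed
  ultimately show ?case unfolding q by simp
qed

text \<open>
  By the Leibniz rule the Wronskian matrix of the \<open>u i\<close> is that of the quotients \<open>u i / u 0\<close> times an upper
  triangular matrix with \<open>u 0\<close> on its diagonal. The quotient number \<open>0\<close> is the constant \<open>1\<close>, so its row
  is \<open>(1, 0, \<dots>, 0)\<close> and only the Wronskian of the derivatives of the other quotients remains.
\<close>

lemma wronskian_quot:
  assumes nz: "u 0 0 t \<noteq> 0"
  shows "Determinant.det (mat (Suc r) (Suc r) (\<lambda>(i, j). u i j t)) =
     u 0 0 t ^ Suc r * Determinant.det (mat r r (\<lambda>(i, j). quot_deriv u (Suc i) (Suc j) t))"
proof -
  let ?V = "mat (Suc r) (Suc r) (\<lambda>(i, j). quot_deriv u i j t)"
  let ?T = "mat (Suc r) (Suc r) (\<lambda>(p, j). if p \<le> j then of_nat (j choose p) * u 0 (j - p) t else 0)"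
  have U: "mat (Suc r) (Suc r) (\<lambda>(i, j). u i j t) = ?V * ?T"
  proof (rule eq_matI)
    fix i j assume "i < dim_row (?V * ?T)" "j < dim_col (?V * ?T)"
    then have ij: "i < Suc r" "j < Suc r" by auto
    have "(?V * ?T) $$ (i, j) = (\<Sum>p<Suc r. quot_deriv u i p t * (if p \<le> j then of_nat (j choose p) * u 0 (j - p) t else 0))"
      using ij by (simp add: scalar_prod_def atLeast0LessThan)
    also have "\<dots> = (\<Sum>p\<le>j. quot_deriv u i p t * (if p \<le> j then of_nat (j choose p) * u 0 (j - p) t else 0))"
      using ij by (intro sum.mono_neutral_right) auto
    also have "\<dots> = u i j t"
      unfolding leibniz_quot_deriv[of u t i j, OF nz] by (intro sum.cong) auto
    finally show "mat (Suc r) (Suc r) (\<lambda>(i, j). u i j t) $$ (i, j) = (?V * ?T) $$ (i, j)"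
      using ij by simp
  qed auto
  have T: "Determinant.det ?T = u 0 0 t ^ Suc r"
  proof -
    have "Determinant.det ?T = prod_list (diag_mat ?T)"
      by (rule det_upper_triangular) (auto simp: upper_triangular_def)
    also have "\<dots> = (\<Prod>p = 0..<Suc r. u 0 0 t)"
      unfolding prod_list_diag_prod by (intro prod.cong) auto
    finally show ?thesis by simp
  qed
  have V: "Determinant.det ?V = Determinant.det (mat r r (\<lambda>(i, j). quot_deriv u (Suc i) (Suc j) t))"
  proof -
    have "?V = four_block_mat (mat 1 1 (\<lambda>_. 1)) (0\<^sub>m 1 r) (mat r 1 (\<lambda>(i, j). quot_deriv u (Suc i) 0 t))
        (mat r r (\<lambda>(i, j). quot_deriv u (Suc i) (Suc j) t))"
      by (rule eq_matI) (auto simp: quot_deriv_first[of u t, OF nz])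
    then show ?thesis
      using det_four_block_mat_upper_right_zero[of "mat 1 1 (\<lambda>_. 1)" 1 "0\<^sub>m 1 r" r
          "mat r 1 (\<lambda>(i, j). quot_deriv u (Suc i) 0 t)"
          "mat r r (\<lambda>(i, j). quot_deriv u (Suc i) (Suc j) t)"]
      by (simp add: det_single)
  qed
  show ?thesis unfolding U
    by (subst det_mult[of _ "Suc r"]) (auto simp: T V)
qed

text \<open>
  Positive Wronskians of all orders up to \<open>k\<close> leave a nontrivial combination of \<open>k\<close> functions at most \<open>k - 1\<close>
  zeros, counted with multiplicity. Dividing by the first function and differentiating removes one
  function, preserves the hypothesis by \<open>wronskian_quot\<close>, and by Rolle's theorem costs at most one zero.
  If the bound is attained, the sign to the right of all zeros is that of the last coefficient: this
  passes from the derivative to the function by the mean value theorem. The multiplicity \<open>m z\<close> says that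
  at least the first \<open>m z\<close> derivatives vanish, and the hypothesis on \<open>k\<close> assumes that there are already
  \<open>k - 1\<close> zeros.
\<close>

theorem chebyshev_zero_count:
  fixes u :: "nat \<Rightarrow> nat \<Rightarrow> real \<Rightarrow> real"
  assumes "0 < k"
    and "\<And>i j t. i < k \<Longrightarrow> Suc j < k \<Longrightarrow> t \<in> {lo<..<hi} \<Longrightarrow>
           (u i j has_real_derivative u i (Suc j) t) (at t)"
    and "\<And>r t. r \<le> k \<Longrightarrow> t \<in> {lo<..<hi} \<Longrightarrow> 0 < Determinant.det (mat r r (\<lambda>(i, j). u i j t))"
    and "finite Z" "Z \<subseteq> {lo<..<hi}" "\<And>z. z \<in> Z \<Longrightarrow> 0 < m z"
    and "\<And>z j. z \<in> Z \<Longrightarrow> j < m z \<Longrightarrow> (\<Sum>i<k. c i * u i j z) = 0"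
    and "k \<le> Suc (sum m Z)" "\<exists>i<k. c i \<noteq> 0"
  shows "Suc (sum m Z) = k \<and>
    (\<forall>t\<in>{lo<..<hi}. (\<forall>z\<in>Z. z < t) \<longrightarrow> 0 < c (k - 1) * (\<Sum>i<k. c i * u i 0 t))"
  using assms
proof (induction k arbitrary: u c m Z)
  case 0
  then show ?case by simp
next
  case (Suc k)
  note der = Suc.prems(2) and wr = Suc.prems(3) and Z = Suc.prems(4-6) and van = Suc.prems(7)
  have pos: "0 < u 0 0 t" if "t \<in> {lo<..<hi}" for t
    using wr[of 1 t] that by (simp add: det_single)
  have zero_first: "Z = {}" "c 0 \<noteq> 0" if "\<forall>i<k. c (Suc i) = 0"
  proof -
    show c0: "c 0 \<noteq> 0" using that Suc.prems(9) by (metis less_Suc_eq_0_disj)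
    have "(\<Sum>i<Suc k. c i * u i 0 z) = c 0 * u 0 0 z" for z
      using that by (simp add: sum.lessThan_Suc_shift del: sum.lessThan_Suc)
    then show "Z = {}" using van[of _ 0] Z pos c0 by fastforce
  qed
  show ?case
  proof (cases "k = 0")
    case True
    then have "Z = {}" "c 0 \<noteq> 0" using zero_first by auto
    moreover have "0 < c 0 * (c 0 * u 0 0 t)" if "t \<in> {lo<..<hi}" for t
      using pos[OF that] \<open>c 0 \<noteq> 0\<close> by (auto simp: mult.assoc[symmetric] zero_less_mult_iff)
    ultimately show ?thesis using True by simp
  next
    case False
    then have ne: "Z \<noteq> {}" using Suc.prems(8) by auto
    then obtain i0 where i0: "i0 < k" "c (Suc i0) \<noteq> 0" using zero_first(1) by auto
    define v where "v = quot_deriv u"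
    define g where "g = (\<lambda>j t. \<Sum>i<Suc k. c i * v i j t)"
    have nz: "u 0 0 t \<noteq> 0" if "t \<in> {lo<..<hi}" for t using pos[OF that] by simp
    have dv: "(v i j has_real_derivative v i (Suc j) t) (at t)"
      if "i < Suc k" "Suc j < Suc k" "t \<in> {lo<..<hi}" for i j t
      unfolding v_def using has_derivative_quot_deriv[of "Suc k" u i t j] der that nz by auto
    have dg: "(g 0 has_real_derivative g 1 t) (at t)" if "t \<in> {lo<..<hi}" for t
      unfolding g_def using that dv[of _ 0 t] False
      by (intro DERIV_sum DERIV_cmult) auto
    have contg: "continuous_on {s..t} (g 0)" if "{s..t} \<subseteq> {lo<..<hi}" for s t
      using dg that by (intro continuous_at_imp_continuous_on) (metis DERIV_isCont subset_iff)
    have g': "g (Suc j) t = (\<Sum>i<k. c (Suc i) * v (Suc i) (Suc j) t)" if "t \<in> {lo<..<hi}" for j t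
      unfolding g_def sum.lessThan_Suc_shift using quot_deriv_first[of u t] nz[OF that]
      by (simp add: v_def)
    have fg: "(\<Sum>i<Suc k. c i * u i 0 t) = u 0 0 t * g 0 t" if "t \<in> {lo<..<hi}" for t
    proof -
      have "u i 0 t = u 0 0 t * v i 0 t" for i
        using nz[OF that] quot_deriv.simps[of u i 0 t] by (simp add: v_def)
      then show ?thesis unfolding g_def sum_distrib_left
        by (intro sum.cong refl) (metis mult.left_commute)
    qed
    have vang: "g j z = 0" if "z \<in> Z" "j < m z" for z j
      using that(2)
    proof (induction j rule: less_induct)
      case (less j)
      have "g j z * u 0 0 z = (\<Sum>i<Suc k. c i * u i j z) -
          (\<Sum>p<j. of_nat (j choose p) * g p z * u 0 (j - p) z)"
      proof -
        have "g j z * u 0 0 z = (\<Sum>i<Suc k. c i * (u i j z -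
          (\<Sum>p<j. of_nat (j choose p) * v i p z * u 0 (j - p) z)))"
          unfolding g_def sum_distrib_right
          using Z(2) that(1) nz[of z] quot_deriv.simps[of u _ j z]
          by (intro sum.cong refl) (auto simp: v_def)
        also have "\<dots> = (\<Sum>i<Suc k. c i * u i j z) - (\<Sum>i<Suc k. \<Sum>p<j. c i * (of_nat (j choose p) * v i p z * u 0 (j - p) z))"
          by (simp only: right_diff_distrib sum_subtractf sum_distrib_left)
        also have "(\<Sum>i<Suc k. \<Sum>p<j. c i * (of_nat (j choose p) * v i p z * u 0 (j - p) z)) =
           (\<Sum>p<j. \<Sum>i<Suc k. c i * (of_nat (j choose p) * v i p z * u 0 (j - p) z))"
          by (rule sum.swap)
        also have "\<dots> = (\<Sum>p<j. of_nat (j choose p) * g p z * u 0 (j - p) z)"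
          unfolding g_def by (simp only: sum_distrib_left sum_distrib_right mult_ac)
        finally show ?thesis .
      qed
      also have "\<dots> = 0" using less van[OF that(1) less.prems] by simp
      finally show ?case using nz[of z] Z(2) that(1) by auto
    qed
    have MZ: "Max Z \<in> Z" "Min Z \<in> Z" using ne Z(1) by auto
    have sub: "{Min Z..Max Z} \<subseteq> {lo<..<hi}" using MZ Z(2) by fastforce
    have "\<exists>Y. finite Y \<and> Suc (card Y) = card Z \<and> Y \<inter> Z = {} \<and>
        (\<forall>y\<in>Y. Min Z < y \<and> y < Max Z \<and> g 1 y = 0)"
      using Z ne contg[OF sub] dg sub vang[of _ 0]
      by (intro rolle_zeros[of Z "Min Z" "Max Z" "g 0" "g 1"]) (auto simp: subset_iff)
    then obtain Y where Y: "finite Y" "Suc (card Y) = card Z" "Y \<inter> Z = {}"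
      "\<And>y. y \<in> Y \<Longrightarrow> Min Z < y \<and> y < Max Z \<and> g 1 y = 0"
      by blast
    \<comment> \<open>The derivative keeps each zero to one order less and gains one zero between neighbours.\<close>
    define W where "W = Y \<union> {z \<in> Z. 2 \<le> m z}"
    define mw where "mw = (\<lambda>z. if z \<in> Z then m z - 1 else 1)"
    have WM: "w \<le> Max Z" if "w \<in> W" for w
      using that Y(4)[of w] Z(1) unfolding W_def by (auto intro: less_imp_le)
    have Wsub: "W \<subseteq> {lo<..<hi}"
    proof
      fix w assume w: "w \<in> W"
      show "w \<in> {lo<..<hi}"
      proof (cases "w \<in> Z")
        case False
        then have "w \<in> {Min Z..Max Z}" using w Y(4)[of w] by (simp add: W_def)
        then show ?thesis using sub by blast
      qed (use Z(2) in blast)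
    qed
    have finW: "finite W" using Y(1) Z(1) unfolding W_def by simp
    have "sum mw W = sum mw Y + sum mw {z \<in> Z. 2 \<le> m z}"
      unfolding W_def using Y Z by (intro sum.union_disjoint) auto
    also have "sum mw Y = card Y"
      using Y(3) by (subst card_eq_sum, intro sum.cong) (auto simp: mw_def)
    also have "sum mw {z \<in> Z. 2 \<le> m z} = (\<Sum>z\<in>Z. m z - 1)"
      using Z(1) by (intro sum.mono_neutral_cong_left) (auto simp: mw_def)
    finally have "sum mw W + 1 = card Z + (\<Sum>z\<in>Z. m z - 1)" using Y(2) by simp
    also have "\<dots> = (\<Sum>z\<in>Z. 1 + (m z - 1))" unfolding sum.distrib by simp
    also have "\<dots> = sum m Z" using Z(3) by (intro sum.cong) (auto simp: Suc_leI)
    finally have sumW: "Suc (sum mw W) = sum m Z" by simp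
    have IH: "Suc (sum mw W) = k \<and> (\<forall>t\<in>{lo<..<hi}. (\<forall>z\<in>W. z < t) \<longrightarrow>
       0 < c (Suc (k - 1)) * (\<Sum>i<k. c (Suc i) * v (Suc i) (Suc 0) t))"
    proof (rule Suc.IH[of "\<lambda>i j. v (Suc i) (Suc j)" W mw "\<lambda>i. c (Suc i)"])
      show "0 < k" using False by simp
      show "(v (Suc i) (Suc j) has_real_derivative v (Suc i) (Suc (Suc j)) t) (at t)"
        if "i < k" "Suc j < k" "t \<in> {lo<..<hi}" for i j t using dv that by simp
      show "0 < Determinant.det (mat r r (\<lambda>(i, j). v (Suc i) (Suc j) t))"
        if "r \<le> k" "t \<in> {lo<..<hi}" for r t
      proof -
        have "0 < u 0 0 t ^ Suc r" using pos[OF that(2)] by simp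
        then show ?thesis
          using wr[of "Suc r" t] wronskian_quot[of u t r] that nz[OF that(2)]
          by (metis Suc_le_mono v_def zero_less_mult_pos)
      qed
      show "0 < mw z" if "z \<in> W" for z using that Y(3) by (auto simp: W_def mw_def)
      show "(\<Sum>i<k. c (Suc i) * v (Suc i) (Suc j) z) = 0" if "z \<in> W" "j < mw z" for z j
        using g'[of z j] that vang[of z "Suc j"] Y(4)[of z] Wsub
        by (auto simp: W_def mw_def split: if_splits)
    qed (use finW Wsub Suc.prems(8) sumW i0 in auto)
    have sign: "0 < c k * (\<Sum>i<Suc k. c i * u i 0 t)"
      if t: "t \<in> {lo<..<hi}" "\<forall>z\<in>Z. z < t" for t
    proof -
      have lt: "Max Z < t" using t MZ by auto
      have st: "{Max Z..t} \<subseteq> {lo<..<hi}" using MZ Z(2) t by fastforce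
      obtain r where r: "Max Z < r" "r < t" "g 0 t - g 0 (Max Z) = (t - Max Z) * g 1 r"
        using mean_value[OF lt contg[OF st], of "g 1"] dg st by (auto simp: subset_iff)
      have "r \<in> {lo<..<hi}" using r by (intro subsetD[OF st]) simp
      moreover have "\<forall>z\<in>W. z < r" using WM r by fastforce
      ultimately have "0 < c k * g 1 r" using IH False g'[of r 0] by simp
      moreover have "g 0 t = (t - Max Z) * g 1 r" using r vang[of "Max Z" 0] MZ Z(3) by simp
      ultimately have "0 < c k * g 0 t" using lt
        by (metis diff_gt_0_iff_gt mult.left_commute zero_less_mult_iff)
      then show ?thesis unfolding fg[OF t(1)] using pos[OF t(1)]
        by (metis mult.left_commute mult_pos_pos)
    qed
    show ?thesis using IH sumW sign by (simp del: sum.lessThan_Suc)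
  qed
qed

section \<open>Generalised polynomials along the curve\<close>

text \<open>
  Zero rows turn the system into a square one, whose determinant is then zero.
\<close>

lemma homogeneous_system_solution:
  fixes M :: "'x \<Rightarrow> nat \<Rightarrow> real"
  assumes "finite S" "card S \<le> m"
  shows "\<exists>c. (\<exists>i\<le>m. c i \<noteq> 0) \<and> (\<forall>x\<in>S. (\<Sum>i\<le>m. c i * M x i) = 0)"
proof -
  obtain xs where xs: "distinct xs" "set xs = S" using finite_distinct_list[OF assms(1)] by blast
  then have len: "length xs \<le> m" using assms(2) distinct_card by fastforce
  let ?A = "mat (Suc m) (Suc m) (\<lambda>(r, i). if r < length xs then M (xs ! r) i else 0)"
  have "transpose_mat ?A *\<^sub>v unit_vec (Suc m) m = 0\<^sub>v (Suc m)"
    using len by (intro eq_vecI) (auto simp: scalar_prod_def intro!: sum.neutral)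
  moreover have "unit_vec (Suc m) m \<noteq> (0\<^sub>v (Suc m) :: real Matrix.vec)" by simp
  ultimately have "Determinant.det (transpose_mat ?A) = 0"
    using det_0_iff_vec_prod_zero[of "transpose_mat ?A" "Suc m"] unit_vec_carrier[of "Suc m" m]
    by (metis (no_types, lifting) mat_carrier transpose_carrier_mat)
  then have "Determinant.det ?A = 0" by (subst (asm) det_transpose[of _ "Suc m"]) auto
  then obtain v where v: "v \<in> carrier_vec (Suc m)" "v \<noteq> 0\<^sub>v (Suc m)" "?A *\<^sub>v v = 0\<^sub>v (Suc m)"
    by (subst (asm) det_0_iff_vec_prod_zero[of _ "Suc m"]) auto
  show ?thesis
  proof (intro exI[of _ "vec_index v"] conjI ballI)
    show "\<exists>i\<le>m. vec_index v i \<noteq> 0"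
    proof (rule ccontr)
      assume "\<not> ?thesis"
      then have "v = 0\<^sub>v (Suc m)" using v(1) by (intro eq_vecI) auto
      then show False using v(2) by simp
    qed
  next
    fix x assume "x \<in> S"
    then obtain r where r: "r < length xs" "xs ! r = x" using xs by (metis in_set_conv_nth)
    have "0 = vec_index (?A *\<^sub>v v) r" using r len v(3) by simp
    also have "\<dots> = (\<Sum>i<Suc m. M x i * vec_index v i)"
      using r len v(1) by (simp add: scalar_prod_def atLeast0LessThan del: sum.lessThan_Suc)
    also have "\<dots> = (\<Sum>i\<le>m. vec_index v i * M x i)"
      unfolding lessThan_Suc_atMost by (simp add: mult.commute)
    finally show "(\<Sum>i\<le>m. vec_index v i * M x i) = 0" by simp
  qed
qed

lemma second_derivative_local_min:
  fixes f f' :: "real \<Rightarrow> real"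
  assumes "lo < x" "x < hi"
    and der: "\<And>s. lo < s \<Longrightarrow> s < hi \<Longrightarrow> (f has_real_derivative f' s) (at s)"
    and der2: "(f' has_real_derivative D) (at x)" "0 < D"
    and "f x = 0" "f' x = 0"
  shows "\<forall>\<^sub>F s in at x. 0 < f s"
proof -
  obtain d1 where d1: "0 < d1" "\<And>h. 0 < h \<Longrightarrow> h < d1 \<Longrightarrow> f' x < f' (x + h)"
    using DERIV_pos_inc_right[OF der2] by blast
  obtain d2 where d2: "0 < d2" "\<And>h. 0 < h \<Longrightarrow> h < d2 \<Longrightarrow> f' (x - h) < f' x"
    using DERIV_pos_inc_left[OF der2] by blast
  define d where "d = Min {d1, d2, x - lo, hi - x}"
  have d: "0 < d" "d \<le> d1" "d \<le> d2" "d \<le> x - lo" "d \<le> hi - x"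
    using d1 d2 assms(1,2) by (auto simp: d_def)
  have "0 < f s" if s: "s \<noteq> x" "dist s x < d" for s
  proof (cases "x < s")
    case True
    have cont: "continuous_on {x..s} f"
      using s True d assms(1) by (intro continuous_at_imp_continuous_on ballI DERIV_isCont[OF der]) (auto simp: dist_real_def)
    obtain r where r: "x < r" "r < s" "f s - f x = (s - x) * f' r"
      using mean_value[OF True cont, of f'] der s d assms(1) by (auto simp: dist_real_def)
    have "0 < f' r" using d1(2)[of "r - x"] r s d True assms(7) by (simp add: dist_real_def)
    then show ?thesis using r True assms(6) by simp
  next
    case False
    then have lt: "s < x" using s by simp
    have cont: "continuous_on {s..x} f"
      using s lt d assms(2) by (intro continuous_at_imp_continuous_on ballI DERIV_isCont[OF der]) (auto simp: dist_real_def)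
    obtain r where r: "s < r" "r < x" "f x - f s = (x - s) * f' r"
      using mean_value[OF lt cont, of f'] der s d assms(2) by (auto simp: dist_real_def)
    have "f' r < 0" using d2(2)[of "x - r"] r s d lt assms(7) by (simp add: dist_real_def)
    then have "f s > 0" using r lt assms(6) by (smt (verit) mult_pos_neg)
    then show ?thesis .
  qed
  then show ?thesis unfolding eventually_at using d(1) by blast
qed

lemma bounded_linear_coord: "bounded_linear (\<lambda>v. coord v i)"
  unfolding coord_def by (rule bounded_linear_vec_nth)

lemma bounded_linear_coord_ext: "bounded_linear (\<lambda>v. coord_ext v i)"
  unfolding coord_ext_def
  by (cases "i \<le> CARD('a::{finite,linorder})")
    (auto intro: bounded_linear_compose[OF bounded_linear_coord bounded_linear_fst] bounded_linear_snd)

definition affine_form :: "nat \<Rightarrow> (nat \<Rightarrow> real) \<Rightarrow> (real ^ 'n::{finite,linorder}) \<times> real \<Rightarrow> real" where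
  "affine_form m c Y = c 0 + (\<Sum>i=1..m. c i * coord_ext Y i)"

text \<open>
  For total weight \<open>1\<close> this is the affinity of \<open>affine_form\<close>; total weight \<open>0\<close> occurs for differences of
  two convex combinations and for derivatives.
\<close>

lemma affine_form_sum:
  "(\<Sum>t\<in>T. w t * affine_form m c (y t)) = c 0 * sum w T + (\<Sum>i=1..m. c i * coord_ext (\<Sum>t\<in>T. w t *\<^sub>R y t) i)"
proof -
  have lin: "coord_ext (\<Sum>t\<in>T. w t *\<^sub>R y t) i = (\<Sum>t\<in>T. w t * coord_ext (y t) i)" for i
  proof -
    interpret bounded_linear "\<lambda>v. coord_ext v i" by (rule bounded_linear_coord_ext)
    show ?thesis by (simp add: sum scale)
  qed
  have "(\<Sum>t\<in>T. w t * affine_form m c (y t)) =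
      (\<Sum>t\<in>T. w t * c 0) + (\<Sum>t\<in>T. \<Sum>i=1..m. c i * (w t * coord_ext (y t) i))"
    by (simp add: affine_form_def distrib_left sum.distrib sum_distrib_left mult.left_commute)
  also have "(\<Sum>t\<in>T. \<Sum>i=1..m. c i * (w t * coord_ext (y t) i)) =
      (\<Sum>i=1..m. \<Sum>t\<in>T. c i * (w t * coord_ext (y t) i))" by (rule sum.swap)
  finally show ?thesis
    unfolding lin by (simp add: sum_distrib_left mult.commute)
qed

lemma affine_form_convex_sum:
  assumes "sum w T = 1"
  shows "affine_form m c (\<Sum>t\<in>T. w t *\<^sub>R y t) = (\<Sum>t\<in>T. w t * affine_form m c (y t))"
  using affine_form_sum[of w m c y T] assms by (simp add: affine_form_def)

lemma coord_ext_fst: "i \<le> CARD('n) \<Longrightarrow> coord_ext (Y :: (real ^ 'n::{finite,linorder}) \<times> real) i = coord (fst Y) i"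
  by (simp add: coord_ext_def)

locale tp_curve =
  fixes a b :: real and \<gamma> :: "real \<Rightarrow> (real ^ 'n::{finite,linorder}) \<times> real"
  assumes a_less_b: "a < b"
    and continuous_curve: "continuous_on {a..b} \<gamma>"
    and smooth: "Ck_curve_on (CARD('n) + 1) \<gamma> {a<..<b}"
    and torsion: "totally_positive_torsion a b \<gamma>"
begin

text \<open>
  The basis functions are \<open>1, \<gamma>\<^sub>1, \<dots>, \<gamma>\<^sub>n\<^sub>+\<^sub>1\<close>, with number \<open>0\<close> for the constant; a generalised polynomial of order
  \<open>m\<close> is a combination of the first \<open>m + 1\<close> of them. The argument \<open>j\<close> is the order of the derivative.
\<close>

definition basis_deriv :: "nat \<Rightarrow> nat \<Rightarrow> real \<Rightarrow> real" where
  "basis_deriv i j t = (if i = 0 then (if j = 0 then 1 else 0) else coord_ext (nth_vderiv j \<gamma> t) i)"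

definition gpoly :: "nat \<Rightarrow> (nat \<Rightarrow> real) \<Rightarrow> nat \<Rightarrow> real \<Rightarrow> real" where
  "gpoly m c j t = (\<Sum>i\<le>m. c i * basis_deriv i j t)"

lemma curve_deriv:
  assumes "t \<in> {a<..<b}" "j < CARD('n) + 1"
  shows "(nth_vderiv j \<gamma> has_vector_derivative nth_vderiv (Suc j) \<gamma> t) (at t)"
  using smooth assms unfolding Ck_curve_on_def
  by (simp add: nth_vderiv_def vector_derivative_works[symmetric])

lemma basis_deriv_deriv:
  assumes "t \<in> {a<..<b}" "j < CARD('n) + 1"
  shows "(basis_deriv i j has_real_derivative basis_deriv i (Suc j) t) (at t)"
proof (cases "i = 0")
  case True
  then show ?thesis by (simp add: basis_deriv_def[abs_def])
next
  case False
  have "((\<lambda>s. coord_ext (nth_vderiv j \<gamma> s) i) has_vector_derivative coord_ext (nth_vderiv (Suc j) \<gamma> t) i) (at t)"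
    by (rule bounded_linear.has_vector_derivative[OF bounded_linear_coord_ext curve_deriv[OF assms]])
  then show ?thesis using False
    by (simp add: basis_deriv_def[abs_def] has_real_derivative_iff_has_vector_derivative)
qed

lemma gpoly_deriv:
  assumes "t \<in> {a<..<b}" "j < CARD('n) + 1"
  shows "(gpoly m c j has_real_derivative gpoly m c (Suc j) t) (at t)"
  unfolding gpoly_def[abs_def] using assms by (intro DERIV_sum DERIV_cmult basis_deriv_deriv)

lemma gpoly_continuous: "continuous_on {a..b} (gpoly m c 0)"
proof -
  have "continuous_on {a..b} (basis_deriv i 0)" for i
    using bounded_linear.continuous_on[OF bounded_linear_coord_ext continuous_curve, of i]
    by (cases "i = 0") (simp_all add: basis_deriv_def[abs_def] nth_vderiv_def)
  then show ?thesis unfolding gpoly_def[abs_def] by (intro continuous_intros)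
qed

lemma wronskian_pos:
  assumes "t \<in> {a<..<b}" "r \<le> CARD('n) + 1"
  shows "0 < Determinant.det (mat r r (\<lambda>(i, j). basis_deriv (Suc i) (Suc j) t))"
proof (cases "r = 0")
  case False
  have "mat r r (\<lambda>ij. torsion_matrix \<gamma> t $$ ij) = mat r r (\<lambda>(i, j). basis_deriv (Suc i) (Suc j) t)"
    using assms by (intro eq_matI) (auto simp: torsion_matrix_def basis_deriv_def)
  then show ?thesis
    using torsion assms False
    by (auto simp: totally_positive_torsion_def leading_principal_minor_def dest!: bspec[of _ _ t] bspec[of _ _ r])
qed simp

text \<open>
  One more application of Rolle's theorem leads from the derivatives of the \<open>\<gamma>\<^sub>i\<close> on the open interval to
  the system with the constant on the closed interval. Only continuity is available at \<open>a\<close> and \<open>b\<close>,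
  hence zeros there count once. The two sign statements, to the right of all zeros and near a zero at
  \<open>b\<close>, are what later tells upper from lower supporting hyperplanes.
\<close>

theorem gpoly_zero_count:
  assumes m: "m \<le> CARD('n) + 1"
    and Z: "finite Z" "Z \<subseteq> {a..b}" "\<And>z. z \<in> Z \<Longrightarrow> 0 < k z"
    and ends: "\<And>z. z \<in> Z \<Longrightarrow> z \<notin> {a<..<b} \<Longrightarrow> k z = 1"
    and van: "\<And>z j. z \<in> Z \<Longrightarrow> j < k z \<Longrightarrow> gpoly m c j z = 0"
    and "m \<le> sum k Z" "\<exists>i\<le>m. c i \<noteq> 0"
  shows "sum k Z = m"
    and "t \<in> {a..b} \<Longrightarrow> \<forall>z\<in>Z. z < t \<Longrightarrow> 0 < c m * gpoly m c 0 t"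
    and "b \<in> Z \<Longrightarrow> \<exists>t\<in>{a<..<b}. c m * gpoly m c 0 t < 0"
proof -
  have zero_first: "Z = {}" "c 0 \<noteq> 0" if "\<forall>i<m. c (Suc i) = 0"
  proof -
    show c0: "c 0 \<noteq> 0" using that assms(8) by (metis Suc_le_eq not0_implies_Suc)
    have "gpoly m c 0 z = c 0" for z
      unfolding gpoly_def lessThan_Suc_atMost[symmetric] sum.lessThan_Suc_shift
      using that by (simp add: basis_deriv_def)
    then show "Z = {}" using van[of _ 0] Z c0 by fastforce
  qed
  have "sum k Z = m \<and> (\<forall>t\<in>{a..b}. (\<forall>z\<in>Z. z < t) \<longrightarrow> 0 < c m * gpoly m c 0 t) \<and>
     (b \<in> Z \<longrightarrow> (\<exists>t\<in>{a<..<b}. c m * gpoly m c 0 t < 0))"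
  proof (cases "m = 0")
    case True
    then have "Z = {}" "c 0 \<noteq> 0" using zero_first by auto
    then show ?thesis using True by (auto simp: gpoly_def basis_deriv_def zero_less_mult_iff)
  next
    case False
    then have ne: "Z \<noteq> {}" using assms(7) by auto
    then obtain i0 where i0: "i0 < m" "c (Suc i0) \<noteq> 0" using zero_first(1) by auto
    have g': "gpoly m c (Suc j) t = (\<Sum>i<m. c (Suc i) * basis_deriv (Suc i) (Suc j) t)" for j t
      unfolding gpoly_def lessThan_Suc_atMost[symmetric] sum.lessThan_Suc_shift
      by (simp add: basis_deriv_def)
    have MZ: "Max Z \<in> Z" "Min Z \<in> Z" using ne Z(1) by auto
    have "\<exists>Y. finite Y \<and> Suc (card Y) = card Z \<and> Y \<inter> Z = {} \<and>
        (\<forall>y\<in>Y. Min Z < y \<and> y < Max Z \<and> gpoly m c 1 y = 0)"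
      using Z ne gpoly_continuous gpoly_deriv[of _ 0] van[of _ 0]
      by (intro rolle_zeros[of Z a b "gpoly m c 0"]) auto
    then obtain Y where Y: "finite Y" "Suc (card Y) = card Z" "Y \<inter> Z = {}"
      "\<And>y. y \<in> Y \<Longrightarrow> Min Z < y \<and> y < Max Z \<and> gpoly m c 1 y = 0"
      by blast
    define W where "W = Y \<union> {z \<in> Z. 2 \<le> k z}"
    define kw where "kw = (\<lambda>z. if z \<in> Z then k z - 1 else 1)"
    have WM: "w \<le> Max Z" if "w \<in> W" for w
      using that Y(4)[of w] Z(1) unfolding W_def by (auto intro: less_imp_le)
    have Wsub: "W \<subseteq> {a<..<b}"
    proof
      fix w assume w: "w \<in> W"
      show "w \<in> {a<..<b}"
      proof (cases "w \<in> Z")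
        case True
        then show ?thesis using w ends[of w] Y(3) by (auto simp: W_def)
      next
        case False
        then have "Min Z < w \<and> w < Max Z" using w Y(4)[of w] by (simp add: W_def)
        moreover have "Min Z \<in> {a..b}" "Max Z \<in> {a..b}" using MZ Z(2) by auto
        ultimately show ?thesis by auto
      qed
    qed
    have finW: "finite W" using Y(1) Z(1) unfolding W_def by simp
    have "sum kw W = sum kw Y + sum kw {z \<in> Z. 2 \<le> k z}"
      unfolding W_def using Y Z by (intro sum.union_disjoint) auto
    also have "sum kw Y = card Y"
      using Y(3) by (subst card_eq_sum, intro sum.cong) (auto simp: kw_def)
    also have "sum kw {z \<in> Z. 2 \<le> k z} = (\<Sum>z\<in>Z. k z - 1)"
      using Z(1) by (intro sum.mono_neutral_cong_left) (auto simp: kw_def)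
    finally have "sum kw W + 1 = card Z + (\<Sum>z\<in>Z. k z - 1)" using Y(2) by simp
    also have "\<dots> = (\<Sum>z\<in>Z. 1 + (k z - 1))" unfolding sum.distrib by simp
    also have "\<dots> = sum k Z" using Z(3) by (intro sum.cong) (auto simp: Suc_leI)
    finally have sumW: "Suc (sum kw W) = sum k Z" by simp
    have count: "Suc (sum kw W) = m \<and> (\<forall>t\<in>{a<..<b}. (\<forall>z\<in>W. z < t) \<longrightarrow>
       0 < c (Suc (m - 1)) * (\<Sum>i<m. c (Suc i) * basis_deriv (Suc i) (Suc 0) t))"
    proof (rule chebyshev_zero_count[of m a b "\<lambda>i j. basis_deriv (Suc i) (Suc j)" W kw "\<lambda>i. c (Suc i)"])
      show "(basis_deriv (Suc i) (Suc j) has_real_derivative basis_deriv (Suc i) (Suc (Suc j)) t) (at t)"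
        if "i < m" "Suc j < m" "t \<in> {a<..<b}" for i j t
        using basis_deriv_deriv[of t "Suc j"] that m by simp
      show "0 < Determinant.det (mat r r (\<lambda>(i, j). basis_deriv (Suc i) (Suc j) t))"
        if "r \<le> m" "t \<in> {a<..<b}" for r t
        using wronskian_pos[of t r] that m by simp
      show "0 < kw z" if "z \<in> W" for z using that Y(3) by (auto simp: W_def kw_def)
      show "(\<Sum>i<m. c (Suc i) * basis_deriv (Suc i) (Suc j) z) = 0" if "z \<in> W" "j < kw z" for z j
        unfolding g'[symmetric] using that van[of z "Suc j"] Y(4)[of z]
        by (auto simp: W_def kw_def split: if_splits)
    qed (use False finW Wsub assms(7) sumW i0 in auto)
    have sign': "0 < c m * gpoly m c 1 r" if "r \<in> {a<..<b}" "\<forall>w\<in>W. w < r" for r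
      using count that False g'[of 0 r] by simp
    have mv: "\<exists>r. s < r \<and> r < t \<and> r \<in> {a<..<b} \<and> gpoly m c 0 t - gpoly m c 0 s = (t - s) * gpoly m c 1 r"
      if st: "s < t" "s \<in> {a..b}" "t \<in> {a..b}" for s t
    proof -
      have "\<exists>r. s < r \<and> r < t \<and> gpoly m c 0 t - gpoly m c 0 s = (t - s) * gpoly m c 1 r"
        using st gpoly_deriv[of _ 0 m c]
        by (intro mean_value continuous_on_subset[OF gpoly_continuous]) auto
      then show ?thesis using st by fastforce
    qed
    have sign: "0 < c m * gpoly m c 0 t" if t: "t \<in> {a..b}" "\<forall>z\<in>Z. z < t" for t
    proof -
      obtain r where r: "Max Z < r" "r < t" "r \<in> {a<..<b}"
          "gpoly m c 0 t - gpoly m c 0 (Max Z) = (t - Max Z) * gpoly m c 1 r"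
        using mv[of "Max Z" t] t MZ Z(2) by blast
      have "\<forall>w\<in>W. w < r" using WM r by fastforce
      then have "0 < c m * gpoly m c 1 r" using sign' r by simp
      moreover have "gpoly m c 0 t = (t - Max Z) * gpoly m c 1 r" using r van[of "Max Z" 0] MZ Z(3) by simp
      moreover have "0 < t - Max Z" using r by simp
      ultimately show ?thesis by (metis mult.left_commute mult_pos_pos)
    qed
    have "\<exists>t\<in>{a<..<b}. c m * gpoly m c 0 t < 0" if bZ: "b \<in> Z"
    proof -
      define s where "s = Max (insert a W)"
      have "s \<in> insert a W" unfolding s_def using finW by (intro Max_in) auto
      then have s: "a \<le> s" "s < b" using Wsub a_less_b by auto
      have sW: "w \<le> s" if "w \<in> W" for w using that finW by (simp add: s_def)
      define t where "t = (s + b) / 2"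
      have t: "s < t" "t < b" using s by (auto simp: t_def field_simps)
      obtain r where r: "t < r" "r < b" "r \<in> {a<..<b}"
          "gpoly m c 0 b - gpoly m c 0 t = (b - t) * gpoly m c 1 r"
        using mv[of t b] t s by auto
      have "0 < c m * gpoly m c 1 r" using sign'[of r] r t sW by fastforce
      moreover have "gpoly m c 0 t = - ((b - t) * gpoly m c 1 r)" using r van[of b 0] bZ Z(3) by simp
      ultimately have "c m * gpoly m c 0 t < 0"
        using t by (simp add: mult.left_commute zero_less_mult_iff mult_less_0_iff)
      then show ?thesis using t s by (intro bexI[of _ t]) auto
    qed
    then show ?thesis using count sumW sign by simp
  qed
  then show "sum k Z = m" "t \<in> {a..b} \<Longrightarrow> \<forall>z\<in>Z. z < t \<Longrightarrow> 0 < c m * gpoly m c 0 t"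
    "b \<in> Z \<Longrightarrow> \<exists>t\<in>{a<..<b}. c m * gpoly m c 0 t < 0" by blast+
qed

lemma gpoly_interpolation:
  assumes "finite S" "card S \<le> m"
  shows "\<exists>c. (\<exists>i\<le>m. c i \<noteq> 0) \<and> (\<forall>(z, j)\<in>S. gpoly m c j z = 0)"
  using homogeneous_system_solution[OF assms, of "\<lambda>(z, j) i. basis_deriv i j z"]
  unfolding gpoly_def by (simp add: case_prod_beta)

lemma gpoly_eq_affine_form: "gpoly m c 0 t = affine_form m c (\<gamma> t)"
proof -
  have "(\<Sum>i\<le>m. c i * basis_deriv i 0 t) = c 0 * basis_deriv 0 0 t + (\<Sum>i=1..m. c i * basis_deriv i 0 t)"
    by (simp add: atMost_atLeast0 sum.atLeast_Suc_atMost)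
  then show ?thesis by (simp add: gpoly_def affine_form_def basis_deriv_def nth_vderiv_def)
qed

text \<open>
  Interpolation with one node fewer: there is a generalised polynomial of order \<open>card T - 1\<close> that
  vanishes on \<open>T\<close> except at \<open>t0\<close>, where the zero count forbids another zero. Evaluating the
  dependency on it isolates \<open>w t0\<close>.
\<close>

theorem nodes_independent:
  assumes T: "finite T" "T \<subseteq> {a..b}" "card T \<le> CARD('n) + 1"
    and w: "sum w T = 0" "(\<Sum>t\<in>T. w t *\<^sub>R fst (\<gamma> t)) = 0" and t0: "t0 \<in> T"
  shows "w t0 = 0"
proof -
  define m where "m = card T - 1"
  have card: "card T = Suc m" using T(1) t0 card_gt_0_iff[of T] unfolding m_def by fastforce
  have "card ((T - {t0}) \<times> {0::nat}) = m" using T t0 card by simp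
  then obtain c where c: "\<exists>i\<le>m. c i \<noteq> 0" "\<And>z. z \<in> T - {t0} \<Longrightarrow> gpoly m c 0 z = 0"
    using gpoly_interpolation[of "(T - {t0}) \<times> {0::nat}" m] T(1) by auto
  have "gpoly m c 0 t0 \<noteq> 0"
  proof
    assume "gpoly m c 0 t0 = 0"
    then have "gpoly m c j z = 0" if "z \<in> T" "j < 1" for z j using c(2)[of z] that by auto
    then have "(\<Sum>z\<in>T. 1) = m"
      using gpoly_zero_count(1)[of m T "\<lambda>_. 1" c] T c(1) card by simp
    then show False using card by simp
  qed
  moreover have "(\<Sum>t\<in>T. w t * affine_form m c (\<gamma> t)) = 0"
  proof -
    have "fst (\<Sum>t\<in>T. w t *\<^sub>R \<gamma> t) = 0" using w(2) by (simp add: fst_sum)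
    moreover have "m \<le> CARD('n)" using card T(3) by simp
    ultimately have "coord_ext (\<Sum>t\<in>T. w t *\<^sub>R \<gamma> t) i = 0" if "i \<in> {1..m}" for i
      using that by (simp add: coord_ext_fst coord_def)
    then show ?thesis unfolding affine_form_sum w(1) by simp
  qed
  moreover have "(\<Sum>t\<in>T. w t * affine_form m c (\<gamma> t)) = w t0 * affine_form m c (\<gamma> t0)"
  proof -
    have "affine_form m c (\<gamma> t) = 0" if "t \<in> T - {t0}" for t using c(2)[OF that] by (simp add: gpoly_eq_affine_form)
    then show ?thesis using T(1) t0 by (subst sum.remove[of _ t0]) (auto intro!: sum.neutral)
  qed
  ultimately show ?thesis by (simp add: gpoly_eq_affine_form)
qed

text \<open>
  Prescribing double zeros on \<open>X\<close> and simple ones on \<open>E\<close> gives \<open>m\<close> conditions on \<open>m + 1\<close> coefficients.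
  The zero count excludes any further zero and any vanishing of the second derivative on \<open>X\<close>, so no sign
  change occurs in the open interval. If \<open>b\<close> is not a zero, the polynomial has the sign of its leading
  coefficient there; if \<open>b\<close> is a zero, it has the opposite sign just before.
\<close>

theorem nonneg_gpoly:
  assumes X: "finite X" "X \<subseteq> {a<..<b}" and E: "E \<subseteq> {a, b}"
    and m: "2 * card X + card E = m" "1 \<le> m" "m \<le> CARD('n) + 1"
  shows "\<exists>c. c m \<noteq> 0 \<and> (0 < c m \<longleftrightarrow> b \<notin> E) \<and>
    (\<forall>t\<in>{a..b}. 0 \<le> gpoly m c 0 t \<and> (gpoly m c 0 t = 0 \<longleftrightarrow> t \<in> X \<union> E))"
proof -
  have finE: "finite E" using E finite_subset by blast
  define S where "S = X \<times> {0, 1::nat} \<union> E \<times> {0}"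
  have "card S \<le> card (X \<times> {0, 1::nat}) + card (E \<times> {0::nat})"
    unfolding S_def by (rule card_Un_le)
  then have "card S \<le> m" using m by (simp add: card_cartesian_product)
  moreover have "finite S" using X finE by (simp add: S_def)
  ultimately obtain c where c: "\<exists>i\<le>m. c i \<noteq> 0" and "\<forall>(z, j)\<in>S. gpoly m c j z = 0"
    using gpoly_interpolation[of S m] by blast
  then have S: "gpoly m c j z = 0" if "(z, j) \<in> S" for z j using that by blast
  define Z where "Z = X \<union> E"
  define k where "k = (\<lambda>z. if z \<in> X then 2 else 1 :: nat)"
  have XE: "X \<inter> E = {}" using X(2) E by fastforce
  have Z: "finite Z" "Z \<subseteq> {a..b}" using X E finE a_less_b by (auto simp: Z_def)
  have sumk: "sum k Z = m"
  proof -
    have "sum k Z = sum k X + sum k E" unfolding Z_def using X(1) finE XE by (rule sum.union_disjoint)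
    also have "sum k X = 2 * card X" by (simp add: k_def)
    also have "sum k E = (\<Sum>z\<in>E. 1)" using XE by (intro sum.cong) (auto simp: k_def)
    finally show ?thesis using m by simp
  qed
  have k: "\<And>z. z \<in> Z \<Longrightarrow> 0 < k z" "\<And>z. z \<in> Z \<Longrightarrow> z \<notin> {a<..<b} \<Longrightarrow> k z = 1"
    using X by (auto simp: k_def)
  have van: "gpoly m c j z = 0" if "z \<in> Z" "j < k z" for z j
    using that S[of z j] by (auto simp: S_def Z_def k_def less_2_cases_iff split: if_splits)
  have right: "0 < c m * gpoly m c 0 t" if "t \<in> {a..b}" "\<forall>z\<in>Z. z < t" for t
    using gpoly_zero_count(2)[of m Z k c t] m(3) Z k van c sumk that by auto
  have near_b: "\<exists>t\<in>{a<..<b}. c m * gpoly m c 0 t < 0" if "b \<in> Z"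
    using gpoly_zero_count(3)[of m Z k c] m(3) Z k van c sumk that by auto
  have zeros: "t \<in> Z" if "t \<in> {a..b}" "gpoly m c 0 t = 0" for t
  proof (rule ccontr)
    assume t: "t \<notin> Z"
    define k' where "k' = k(t := 1)"
    have "sum k' (insert t Z) = 1 + sum k' Z" using t Z by (simp add: k'_def)
    also have "sum k' Z = sum k Z" using t by (intro sum.cong) (auto simp: k'_def)
    finally have s: "sum k' (insert t Z) = Suc m" using sumk by simp
    have "sum k' (insert t Z) = m"
      by (rule gpoly_zero_count(1)[OF m(3), of _ _ c])
        (use Z k van t that c s in \<open>auto simp: k'_def split: if_splits\<close>)
    then show False using s by simp
  qed
  have second: "gpoly m c 2 x \<noteq> 0" if x: "x \<in> X" for x
  proof
    assume 0: "gpoly m c 2 x = 0"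
    define k' where "k' = k(x := 3)"
    have xZ: "x \<in> Z" using x by (simp add: Z_def)
    have "sum k' Z = k' x + sum k' (Z - {x})" using Z xZ by (simp add: sum.remove)
    also have "sum k' (Z - {x}) = sum k (Z - {x})" by (intro sum.cong) (auto simp: k'_def)
    finally have s: "sum k' Z = Suc m"
      using sumk Z xZ sum.remove[of Z x k] x by (simp add: k'_def k_def)
    have van': "gpoly m c j z = 0" if "z \<in> Z" "j < k' z" for z j
    proof (cases "z = x \<and> j = 2")
      case False
      then have "j < k z" using that x by (auto simp: k'_def k_def split: if_splits)
      then show ?thesis using van that by simp
    qed (use 0 in simp)
    have "sum k' Z = m"
      by (rule gpoly_zero_count(1)[OF m(3) Z _ _ van' _ c])
        (use k X x s in \<open>auto simp: k'_def split: if_splits\<close>)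
    then show False using s by simp
  qed
  \<comment> \<open>Every interior point lies in one of the disjoint open sets \<open>A 1\<close>, \<open>A (- 1)\<close>; connectedness leaves one.\<close>
  define A where "A = (\<lambda>\<sigma>::real. {t\<in>{a<..<b}. \<forall>\<^sub>F s in at t. 0 < \<sigma> * gpoly m c 0 s})"
  have cont_at: "isCont (gpoly m c 0) t" if "t \<in> {a<..<b}" for t
    using gpoly_deriv[OF that, of 0 m c, THEN DERIV_isCont] by simp
  have A_pos: "t \<in> A \<sigma>" if "t \<in> {a<..<b}" "0 < \<sigma> * gpoly m c 0 t" for t \<sigma>
  proof -
    have "((\<lambda>s. \<sigma> * gpoly m c 0 s) \<longlongrightarrow> \<sigma> * gpoly m c 0 t) (at t)"
      using cont_at[OF that(1)] by (intro tendsto_intros) (simp add: isCont_def)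
    then show ?thesis using that order_tendstoD(1)[of _ "\<sigma> * gpoly m c 0 t" "at t" 0] by (simp add: A_def)
  qed
  have A_zero: "t \<in> A \<sigma>" if "t \<in> X" "0 < \<sigma> * gpoly m c 2 t" for t \<sigma>
  proof -
    have t: "t \<in> {a<..<b}" using that X by auto
    have "\<forall>\<^sub>F s in at t. 0 < \<sigma> * gpoly m c 0 s"
    proof (rule second_derivative_local_min[of a t b _ "\<lambda>s. \<sigma> * gpoly m c 1 s" "\<sigma> * gpoly m c 2 t"])
      show "((\<lambda>s. \<sigma> * gpoly m c 0 s) has_real_derivative \<sigma> * gpoly m c 1 s) (at s)"
        if "a < s" "s < b" for s
        using that gpoly_deriv[of s 0 m c] by (intro DERIV_cmult) auto
      show "((\<lambda>s. \<sigma> * gpoly m c 1 s) has_real_derivative \<sigma> * gpoly m c 2 t) (at t)"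
        using t gpoly_deriv[of t 1 m c] by (intro DERIV_cmult) (auto simp: numeral_2_eq_2)
      show "\<sigma> * gpoly m c 0 t = 0" "\<sigma> * gpoly m c 1 t = 0"
        using van[of t 0] van[of t 1] that by (auto simp: Z_def k_def)
    qed (use t that in auto)
    then show ?thesis using t by (simp add: A_def)
  qed
  have cover: "{a<..<b} \<subseteq> A 1 \<union> A (- 1)"
  proof
    fix t assume t: "t \<in> {a<..<b}"
    show "t \<in> A 1 \<union> A (- 1)"
    proof (cases "gpoly m c 0 t = 0")
      case True
      then have "t \<in> X" using zeros[of t] t E by (auto simp: Z_def)
      then show ?thesis using A_zero[of t 1] A_zero[of t "- 1"] second[of t] by fastforce
    qed (use A_pos[OF t, of 1] A_pos[OF t, of "- 1"] in fastforce)
  qed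
  have "open (A \<sigma>)" for \<sigma>
    unfolding open_subopen[of "A \<sigma>"]
  proof
    fix t assume t: "t \<in> A \<sigma>"
    then obtain U where U: "open U" "t \<in> U" "\<And>s. s \<in> U \<Longrightarrow> s \<noteq> t \<Longrightarrow> 0 < \<sigma> * gpoly m c 0 s"
      by (auto simp: A_def eventually_at_topological)
    have "U \<inter> {a<..<b} \<subseteq> A \<sigma>"
    proof
      fix s assume s: "s \<in> U \<inter> {a<..<b}"
      show "s \<in> A \<sigma>" using A_pos[of s \<sigma>] U(3)[of s] s t by (cases "s = t") auto
    qed
    then show "\<exists>T. open T \<and> t \<in> T \<and> T \<subseteq> A \<sigma>"
      using U t by (intro exI[of _ "U \<inter> {a<..<b}"]) (auto simp: A_def)
  qed
  moreover have disj: "A 1 \<inter> A (- 1) = {}"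
  proof (rule equals0I)
    fix t assume "t \<in> A 1 \<inter> A (- 1)"
    then have "\<forall>\<^sub>F s in at t. 0 < 1 * gpoly m c 0 s" "\<forall>\<^sub>F s in at t. 0 < - 1 * gpoly m c 0 s"
      unfolding A_def by auto
    then have "\<forall>\<^sub>F s in at t. False" by eventually_elim simp
    then show False by simp
  qed
  ultimately have one: "A 1 \<inter> {a<..<b} = {} \<or> A (- 1) \<inter> {a<..<b} = {}"
    using connectedD[OF connected_Ioo[of a b], of "A 1" "A (- 1)"] cover by auto
  then obtain \<sigma> :: real where \<sigma>: "\<sigma> = 1 \<or> \<sigma> = - 1" "A (- \<sigma>) = {}"
  proof (cases "A 1 \<inter> {a<..<b} = {}")
    case True
    then have "A (- (- 1)) = {}" by (auto simp: A_def)
    then show ?thesis using that[of "- 1"] by blast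
  next
    case False
    then have "A (- 1) = {}" using one by (auto simp: A_def)
    then show ?thesis using that[of 1] by blast
  qed
  have inner: "0 \<le> \<sigma> * gpoly m c 0 t" if "t \<in> {a<..<b}" for t
    using A_pos[OF that, of "- \<sigma>"] \<sigma>(2) by (rule_tac ccontr) auto
  have nonneg: "0 \<le> \<sigma> * gpoly m c 0 t" if "t \<in> {a..b}" for t
    by (rule continuous_ge_on_closure[of "{a<..<b}"])
      (use that a_less_b inner in \<open>auto intro!: continuous_intros gpoly_continuous\<close>)
  have flip: "gpoly m (\<lambda>i. \<sigma> * c i) 0 t = \<sigma> * gpoly m c 0 t" for t
    by (simp add: gpoly_def sum_distrib_left mult.assoc)
  have zero_iff: "gpoly m c 0 t = 0 \<longleftrightarrow> t \<in> X \<union> E" if "t \<in> {a..b}" for t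
    using zeros[OF that] van[of t 0] k(1)[of t] by (auto simp: Z_def)
  have sign: "\<sigma> * c m \<noteq> 0 \<and> (0 < \<sigma> * c m \<longleftrightarrow> b \<notin> E)"
  proof (cases "b \<in> E")
    case True
    then obtain t where t: "t \<in> {a<..<b}" "c m * gpoly m c 0 t < 0"
      using near_b by (auto simp: Z_def)
    have "(\<sigma> * c m) * (\<sigma> * gpoly m c 0 t) < 0" using t \<sigma>(1) by auto
    then have "\<sigma> * c m < 0" using inner[OF t(1)] by (metis mult_less_0_iff not_less)
    then show ?thesis using True by linarith
  next
    case False
    then have "\<forall>z\<in>Z. z < b" using X E a_less_b by (auto simp: Z_def)
    then have "0 < c m * gpoly m c 0 b" using right[of b] a_less_b by simp
    then have "0 < (\<sigma> * c m) * (\<sigma> * gpoly m c 0 b)" using \<sigma>(1) by auto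
    then have "0 < \<sigma> * c m" using nonneg[of b] a_less_b
      by (metis atLeastAtMost_iff less_eq_real_def not_less order_refl zero_less_mult_iff)
    then show ?thesis using False by linarith
  qed
  show ?thesis
    by (intro exI[of _ "\<lambda>i. \<sigma> * c i"]) (use sign nonneg zero_iff \<sigma>(1) flip in auto)
qed

end

section \<open>Continuously differentiable maps\<close>

lemma C1_onI:
  fixes f :: "'a::euclidean_space \<Rightarrow> 'b::real_normed_vector"
  assumes "\<And>x. x \<in> S \<Longrightarrow> (f has_derivative D x) (at x)"
    and "\<And>v. continuous_on S (\<lambda>x. D x v)"
  shows "C1_on f S"
  unfolding C1_on_def
proof (intro exI[of _ "\<lambda>x. Blinfun (D x)"] conjI ballI)
  have B: "blinfun_apply (Blinfun (D x)) = D x" if "x \<in> S" for x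
    using assms(1)[OF that] by (intro bounded_linear_Blinfun_apply has_derivative_bounded_linear)
  show "(f has_derivative blinfun_apply (Blinfun (D x))) (at x)" if "x \<in> S" for x
    using assms(1) that by (simp add: B)
  show "continuous_on S (\<lambda>x. Blinfun (D x))"
  proof (rule continuous_on_blinfun_componentwise)
    fix i :: 'a
    show "continuous_on S (\<lambda>x. blinfun_apply (Blinfun (D x)) i)"
      by (rule continuous_on_eq[OF assms(2)[of i]]) (simp add: B)
  qed
qed

lemma C1_on_compose:
  fixes f :: "'a::euclidean_space \<Rightarrow> 'b::euclidean_space" and g :: "'b \<Rightarrow> 'c::real_normed_vector"
  assumes "C1_on f S" "C1_on g T" "f ` S \<subseteq> T"
  shows "C1_on (\<lambda>x. g (f x)) S"
proof -
  obtain f' where f': "\<And>x. x \<in> S \<Longrightarrow> (f has_derivative blinfun_apply (f' x)) (at x)"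
    "continuous_on S f'" using assms(1) unfolding C1_on_def by blast
  obtain g' where g': "\<And>x. x \<in> T \<Longrightarrow> (g has_derivative blinfun_apply (g' x)) (at x)"
    "continuous_on T g'" using assms(2) unfolding C1_on_def by blast
  have cf: "continuous_on S f"
    using f'(1) by (intro continuous_at_imp_continuous_on ballI has_derivative_continuous) auto
  show ?thesis
  proof (rule C1_onI[where D = "\<lambda>x v. blinfun_apply (g' (f x)) (blinfun_apply (f' x) v)"])
    show "((\<lambda>x. g (f x)) has_derivative (\<lambda>v. blinfun_apply (g' (f x)) (blinfun_apply (f' x) v))) (at x)"
      if "x \<in> S" for x
      using has_derivative_compose[OF f'(1)[OF that] g'(1)] that assms(3) by blast
    show "continuous_on S (\<lambda>x. blinfun_apply (g' (f x)) (blinfun_apply (f' x) v))" for v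
      using continuous_on_compose2[OF g'(2) cf assms(3)] f'(2)
      by (intro continuous_intros bounded_bilinear.continuous_on[OF bounded_bilinear_blinfun_apply])
  qed
qed

lemma C1_on_cong_open:
  fixes f g :: "'a::euclidean_space \<Rightarrow> 'b::real_normed_vector"
  assumes "C1_on f S" "open S" "\<And>x. x \<in> S \<Longrightarrow> f x = g x"
  shows "C1_on g S"
proof -
  obtain f' where f': "\<And>x. x \<in> S \<Longrightarrow> (f has_derivative blinfun_apply (f' x)) (at x)"
    "continuous_on S f'" using assms(1) unfolding C1_on_def by blast
  have "(g has_derivative blinfun_apply (f' x)) (at x)" if "x \<in> S" for x
    using has_derivative_transform_within_open[OF f'(1)[OF that] assms(2) that assms(3)] by blast
  then show ?thesis using f'(2) unfolding C1_on_def by blast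
qed

lemma C1_on_imp_continuous_on: "C1_on f S \<Longrightarrow> continuous_on S f"
  unfolding C1_on_def
  by (auto intro!: continuous_at_imp_continuous_on intro: has_derivative_continuous)

lemma C1_on_bounded_linear:
  fixes h :: "'b::euclidean_space \<Rightarrow> 'c::real_normed_vector"
  assumes "bounded_linear h"
  shows "C1_on h S"
  using assms by (intro C1_onI[where D = "\<lambda>_. h"] bounded_linear_imp_has_derivative) auto

text \<open>
  Invariance of domain makes the image open and the inverse continuous, which is all that the pointwise
  inverse function rule asks for. The inverse derivatives depend continuously on the point because near
  a given point the derivatives are uniformly bounded below.
\<close>

lemma C1_on_inverse:
  fixes f :: "'a::euclidean_space \<Rightarrow> 'a"
  assumes "open S" "inj_on f S"
    and der: "\<And>x. x \<in> S \<Longrightarrow> (f has_derivative D x) (at x)"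
    and contD: "\<And>v. continuous_on S (\<lambda>x. D x v)"
    and inj: "\<And>x v. x \<in> S \<Longrightarrow> D x v = 0 \<Longrightarrow> v = 0"
  shows "open (f ` S)" "C1_on (inv_into S f) (f ` S)"
proof -
  have C1: "C1_on f S" using der contD by (rule C1_onI)
  have cf: "continuous_on S f" using C1 by (rule C1_on_imp_continuous_on)
  show op: "open (f ` S)" using cf assms(1,2) by (rule invariance_of_domain)
  let ?g = "inv_into S f"
  have cg: "continuous_on (f ` S) ?g"
    using assms(1,2) cf by (intro continuous_on_inverse_open) auto
  have gS: "?g y \<in> S" "f (?g y) = y" if "y \<in> f ` S" for y
    using that by (auto intro: inv_into_into f_inv_into_f)
  obtain f' where f': "\<And>x. x \<in> S \<Longrightarrow> (f has_derivative blinfun_apply (f' x)) (at x)"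
    "continuous_on S f'" using C1 unfolding C1_on_def by blast
  have f'D: "blinfun_apply (f' x) = D x" if "x \<in> S" for x
    using f'(1)[OF that] der[OF that] by (rule has_derivative_unique)
  have lin: "linear (D x)" "inj (D x)" if x: "x \<in> S" for x
  proof -
    show l: "linear (D x)" using der[OF x] by (rule has_derivative_linear)
    show "inj (D x)" using inj[OF x] by (simp add: linear_injective_0[OF l])
  qed
  obtain h where h: "\<And>x. x \<in> S \<Longrightarrow> linear (h x) \<and> (\<forall>v. h x (D x v) = v) \<and> (\<forall>v. D x (h x v) = v)"
    using linear_injective_isomorphism[OF lin] by metis
  show "C1_on ?g (f ` S)"
  proof (rule C1_onI[where D = "\<lambda>y. h (?g y)"])
    fix y assume y: "y \<in> f ` S"
    show "(?g has_derivative h (?g y)) (at y)"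
    proof (rule has_derivative_inverse_basic[where f = f and T = "f ` S"])
      show "(f has_derivative D (?g y)) (at (?g y))" using der gS(1)[OF y] .
      show "bounded_linear (h (?g y))" using h gS(1)[OF y] by (simp add: linear_conv_bounded_linear)
      show "h (?g y) \<circ> D (?g y) = id" using h gS(1)[OF y] by auto
      show "continuous (at y) ?g" using cg op y by (metis continuous_on_eq_continuous_at)
    qed (use gS op y in auto)
  next
    fix v
    show "continuous_on (f ` S) (\<lambda>y. h (?g y) v)"
    proof (rule continuous_at_imp_continuous_on, rule ballI)
      fix y0 assume y0: "y0 \<in> f ` S"
      let ?w = "\<lambda>y. h (?g y) v" and ?\<delta> = "\<lambda>y. norm (f' (?g y) - f' (?g y0))"
      obtain c where c: "0 < c" "\<And>x. c * norm x \<le> norm (D (?g y0) x)"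
        using linear_inj_bounded_below_pos[OF lin[OF gS(1)[OF y0]]] by blast
      have "continuous_on (f ` S) (\<lambda>y. f' (?g y))"
        using gS by (intro continuous_on_compose2[OF f'(2) cg]) auto
      then have "((\<lambda>y. f' (?g y)) \<longlongrightarrow> f' (?g y0)) (at y0)"
        using op y0 by (metis continuous_on_eq_continuous_at isCont_def)
      then have \<delta>0: "(?\<delta> \<longlongrightarrow> 0) (at y0)"
        using LIM_zero tendsto_norm_zero by blast
      have ev: "\<forall>\<^sub>F y in at y0. ?\<delta> y < c / 2 \<and> y \<in> f ` S"
        using order_tendstoD(2)[OF \<delta>0, of "c / 2"] c(1) eventually_at_in_open'[OF op y0]
        by (auto intro: eventually_conj)
      have "\<forall>\<^sub>F y in at y0. norm (?w y - ?w y0) \<le> ?\<delta> y * (2 * norm (?w y0) / c)"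
        using ev
      proof eventually_elim
        case (elim y)
        then have y: "y \<in> f ` S" and \<delta>: "?\<delta> y < c / 2" by auto
        have D0: "D (?g y0) (?w y) - v = - (blinfun_apply (f' (?g y) - f' (?g y0)) (?w y))"
          using h[OF gS(1)[OF y]] f'D[OF gS(1)[OF y]] f'D[OF gS(1)[OF y0]]
          by (simp add: blinfun.diff_left)
        have "c * norm (?w y - ?w y0) \<le> norm (D (?g y0) (?w y - ?w y0))" by (rule c)
        also have "\<dots> = norm (D (?g y0) (?w y) - v)"
          using h[OF gS(1)[OF y0]] linear_diff[OF lin(1)[OF gS(1)[OF y0]]] by simp
        also have "\<dots> \<le> ?\<delta> y * norm (?w y)" unfolding D0 by (simp add: norm_blinfun)
        also have "\<dots> \<le> ?\<delta> y * (norm (?w y - ?w y0) + norm (?w y0))"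
          using norm_triangle_sub[of "?w y" "?w y0"] by (intro mult_left_mono) (auto simp: add.commute)
        also have "\<dots> \<le> c / 2 * norm (?w y - ?w y0) + ?\<delta> y * norm (?w y0)"
          using mult_right_mono[OF less_imp_le[OF \<delta>], of "norm (?w y - ?w y0)"]
          by (simp add: distrib_left)
        finally have "c / 2 * norm (?w y - ?w y0) \<le> ?\<delta> y * norm (?w y0)" by (simp add: field_simps)
        then show ?case using c(1) by (simp add: field_simps)
      qed
      moreover have "((\<lambda>y. ?\<delta> y * (2 * norm (?w y0) / c)) \<longlongrightarrow> 0) (at y0)"
        using \<delta>0 by (rule tendsto_mult_left_zero)
      ultimately have "((\<lambda>y. ?w y - ?w y0) \<longlongrightarrow> 0) (at y0)" by (rule Lim_null_comparison)
      then show "isCont ?w y0" unfolding isCont_def by (rule LIM_zero_cancel)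
    qed
  qed
qed

text \<open>
  At an interior point a small move along \<open>v\<close> or \<open>- v\<close> decreases a nonconstant affine functional, so it
  cannot be zero there.
\<close>

lemma interior_linear_pos:
  fixes h :: "'a::real_normed_vector \<Rightarrow> real"
  assumes "linear h" "h v \<noteq> 0" "\<And>x. x \<in> S \<Longrightarrow> 0 \<le> \<kappa> + h x" "y \<in> interior S"
  shows "0 < \<kappa> + h y"
proof (rule ccontr)
  assume neg: "\<not> 0 < \<kappa> + h y"
  obtain r where r: "0 < r" "cball y r \<subseteq> S" using assms(4) by (auto simp: mem_interior_cball)
  define \<epsilon> where "\<epsilon> = (if 0 < h v then - 1 else 1) * r / norm v"
  have v: "v \<noteq> 0" using assms(1,2) linear_0 by blast
  have "norm (\<epsilon> *\<^sub>R v) = r" using v r(1) by (simp add: \<epsilon>_def)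
  then have "y + \<epsilon> *\<^sub>R v \<in> S" using r(2) by (auto simp: dist_norm)
  then have "0 \<le> \<kappa> + h y + \<epsilon> * h v"
    using assms(3)[of "y + \<epsilon> *\<^sub>R v"] assms(1) by (simp add: linear_add linear_scale add.assoc)
  moreover have "\<epsilon> * h v < 0"
  proof -
    have "\<epsilon> * h v = - (\<bar>h v\<bar> * (r / norm v))" by (simp add: \<epsilon>_def abs_if)
    moreover have "0 < \<bar>h v\<bar> * (r / norm v)" using assms(2) r(1) v by simp
    ultimately show ?thesis by simp
  qed
  ultimately show False using neg by simp
qed

lemma consecutive_less:
  fixes x :: "nat \<Rightarrow> real"
  assumes "\<And>j. j \<in> {1..<q} \<Longrightarrow> x j < x (j + 1)" "1 \<le> i" "i < j" "j \<le> q"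
  shows "x i < x j"
  using assms(3,4)
proof (induction j)
  case (Suc j)
  have "x j < x (Suc j)" using assms(1)[of j] Suc.prems assms(2) by simp
  then show ?case using Suc by (cases "i = j") auto
qed simp

section \<open>Convex hulls and coordinates\<close>

lemma convex_hull_image_rep:
  assumes "Y \<in> convex hull (g ` S)"
  shows "\<exists>T w. finite T \<and> T \<subseteq> S \<and> (\<forall>t\<in>T. 0 < w t) \<and> sum w T = 1 \<and> (\<Sum>t\<in>T. w t *\<^sub>R g t) = Y"
proof -
  obtain V u where V: "finite V" "V \<subseteq> g ` S" "\<forall>v\<in>V. 0 \<le> u v" "sum u V = 1" "(\<Sum>v\<in>V. u v *\<^sub>R v) = Y"
    using assms unfolding convex_hull_explicit by auto
  define V' where "V' = {v\<in>V. 0 < u v}"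
  have V': "finite V'" "V' \<subseteq> g ` S" using V by (auto simp: V'_def)
  have s: "sum u V' = 1" "(\<Sum>v\<in>V'. u v *\<^sub>R v) = Y"
  proof -
    have sub: "V' \<subseteq> V" by (auto simp: V'_def)
    have z: "u v = 0" if "v \<in> V" "v \<notin> V'" for v
      using that V(3) unfolding V'_def by force
    have "sum u V' = sum u V" "(\<Sum>v\<in>V'. u v *\<^sub>R v) = (\<Sum>v\<in>V. u v *\<^sub>R v)"
      by (rule sum.mono_neutral_left[OF V(1) sub], simp add: z)+
    then show "sum u V' = 1" "(\<Sum>v\<in>V'. u v *\<^sub>R v) = Y" using V(4,5) by simp_all
  qed
  let ?i = "inv_into S g"
  have inj: "inj_on ?i V'" using V'(2) by (rule inj_on_inv_into)
  have gi: "g (?i v) = v" if "v \<in> V'" for v using that V'(2) by (auto intro: f_inv_into_f)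
  show ?thesis
  proof (intro exI[of _ "?i ` V'"] exI[of _ "\<lambda>t. u (g t)"] conjI)
    show "finite (?i ` V')" "?i ` V' \<subseteq> S" using V' by (auto intro!: inv_into_into)
    show "\<forall>t\<in>?i ` V'. 0 < u (g t)" using gi by (auto simp: V'_def)
    show "(\<Sum>t\<in>?i ` V'. u (g t)) = 1" "(\<Sum>t\<in>?i ` V'. u (g t) *\<^sub>R g t) = Y"
      unfolding sum.reindex[OF inj] using s gi by (simp_all cong: sum.cong)
  qed
qed

definition index :: "nat \<Rightarrow> 'n::{finite,linorder}" where
  "index i = sorted_list_of_set (UNIV :: 'n set) ! (i - 1)"

lemma coord_index: "coord v i = vec_nth v (index i)"
  by (simp add: coord_def index_def)

lemma bij_betw_index: "bij_betw (index :: nat \<Rightarrow> 'n::{finite,linorder}) {1..CARD('n)} UNIV"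
proof -
  let ?xs = "sorted_list_of_set (UNIV :: 'n set)"
  have "bij_betw (nth ?xs) {..<length ?xs} (set ?xs)" by (rule bij_betw_nth) auto
  then have "bij_betw (nth ?xs) {..<CARD('n)} UNIV" by simp
  moreover have "bij_betw (\<lambda>i. i - 1) {1..CARD('n)} {..<CARD('n)}"
    by (rule bij_betw_byWitness[where f' = Suc]) auto
  ultimately have "bij_betw (nth ?xs \<circ> (\<lambda>i. i - 1)) {1..CARD('n)} UNIV"
    using bij_betw_trans by blast
  then show ?thesis by (simp add: index_def[abs_def] comp_def)
qed

lemma coord_eqI:
  fixes v w :: "real ^ 'n::{finite,linorder}"
  assumes "\<And>i. i \<in> {1..CARD('n)} \<Longrightarrow> coord v i = coord w i"
  shows "v = w"
proof (rule Finite_Cartesian_Product.vec_eq_iff[THEN iffD2], rule allI)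
  fix k :: 'n
  obtain i where "i \<in> {1..CARD('n)}" "index i = k"
    using bij_betw_index[where 'n='n] by (metis UNIV_I bij_betw_imp_surj_on imageE)
  then show "vec_nth v k = vec_nth w k" using assms[of i] by (simp add: coord_index)
qed

lemma coord_axis:
  assumes "i \<in> {1..CARD('n)}" "j \<in> {1..CARD('n)}"
  shows "coord (axis (index i) 1 :: real ^ 'n::{finite,linorder}) j = (if i = j then 1 else 0)"
proof -
  have "(index j :: 'n) = index i \<longleftrightarrow> j = i"
    by (rule inj_on_eq_iff[OF bij_betw_imp_inj_on[OF bij_betw_index] assms(2,1)])
  then show ?thesis by (auto simp: coord_index axis_def)
qed

lemma coord_linear [simp]:
  "coord (v + w) i = coord v i + coord w i" "coord (r *\<^sub>R v) i = r * coord v i" "coord 0 i = 0"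
  by (simp_all add: coord_def)

lemma linear_coord: "linear (\<lambda>v. coord v i)"
  by (rule bounded_linear.linear[OF bounded_linear_coord])

lemma continuous_on_coord [continuous_intros]:
  "continuous_on S f \<Longrightarrow> continuous_on S (\<lambda>x. coord (f x) i)"
  by (rule bounded_linear.continuous_on[OF bounded_linear_coord])

section \<open>Supporting functionals of the two convex hulls\<close>

context tp_curve
begin

abbreviation "gbar t \<equiv> fst (\<gamma> t)"
abbreviation "K \<equiv> convex hull (gbar ` {a..b})"
abbreviation "C \<equiv> convex hull (\<gamma> ` {a..b})"

lemma support_in_zeros:
  assumes "finite T" "T \<subseteq> {a..b}" "\<And>t. t \<in> T \<Longrightarrow> 0 \<le> w t" "sum w T = 1"
    and "\<And>t. t \<in> {a..b} \<Longrightarrow> 0 \<le> gpoly m c 0 t"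
    and "affine_form m c (\<Sum>t\<in>T. w t *\<^sub>R \<gamma> t) = 0" "t \<in> T" "0 < w t"
  shows "gpoly m c 0 t = 0"
proof -
  have "(\<Sum>t\<in>T. w t * gpoly m c 0 t) = 0"
    using assms(6) unfolding affine_form_convex_sum[OF assms(4)] gpoly_eq_affine_form .
  then have "w t * gpoly m c 0 t = 0"
    using assms(1-3,5,7) by (subst (asm) sum_nonneg_eq_0_iff) (auto intro!: mult_nonneg_nonneg)
  then show ?thesis using assms(8) by simp
qed

lemma K_eq: "K = fst ` C"
proof -
  have "fst ` C = convex hull (fst ` \<gamma> ` {a..b})"
    by (rule convex_hull_linear_image) (rule linear_fst)
  then show ?thesis by (simp add: image_image)
qed

lemma fst_hull: "Y \<in> C \<Longrightarrow> fst Y \<in> K"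
  unfolding K_eq by (rule imageI)

lemma compact_C: "compact C"
  by (intro compact_convex_hull compact_continuous_image continuous_curve) auto

lemma compact_K: "compact K"
  by (intro compact_convex_hull compact_continuous_image continuous_intros continuous_curve) auto

lemma affine_form_nonneg:
  assumes "\<And>t. t \<in> {a..b} \<Longrightarrow> 0 \<le> gpoly m c 0 t" "Y \<in> C"
  shows "0 \<le> affine_form m c Y"
proof -
  obtain T w where T: "finite T" "T \<subseteq> {a..b}" "\<forall>t\<in>T. 0 < w t" "sum w T = 1" "(\<Sum>t\<in>T. w t *\<^sub>R \<gamma> t) = Y"
    using convex_hull_image_rep[OF assms(2)] by blast
  have "0 \<le> w t * gpoly m c 0 t" if "t \<in> T" for t
    using that T assms(1) by (intro mult_nonneg_nonneg) (auto intro: less_imp_le)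
  then show ?thesis
    using affine_form_convex_sum[OF T(4), of m c \<gamma>] T(5) by (simp add: gpoly_eq_affine_form sum_nonneg)
qed

text \<open>
  For \<open>m \<le> n\<close> the form does not see the last coordinate. It is therefore a nonconstant affine
  functional on the space of \<open>K\<close>, nonnegative on \<open>K\<close> and zero at the point.
\<close>

theorem supporting_zero_imp_frontier:
  assumes m: "1 \<le> m" "m \<le> CARD('n)" and c: "c m \<noteq> 0"
    and nonneg: "\<And>t. t \<in> {a..b} \<Longrightarrow> 0 \<le> gpoly m c 0 t" and Y: "Y \<in> C" "affine_form m c Y = 0"
  shows "fst Y \<in> frontier K"
proof -
  define h where "h = (\<lambda>x :: real ^ 'n::{finite,linorder}. \<Sum>i=1..m. c i * coord x i)"
  have aff: "affine_form m c Z = c 0 + h (fst Z)" for Z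
    using m by (simp add: affine_form_def h_def coord_ext_fst)
  have h: "linear h" unfolding h_def
    by (intro linear_compose_sum ballI) (auto intro!: linearI simp: algebra_simps)
  have pos: "0 \<le> c 0 + h x" if "x \<in> K" for x
  proof -
    obtain Z where "Z \<in> C" "x = fst Z" using \<open>x \<in> K\<close> unfolding K_eq by blast
    then show ?thesis using affine_form_nonneg[OF nonneg] aff by metis
  qed
  have "h (axis (index m) 1) = (\<Sum>i=1..m. if i = m then c m else 0)"
    unfolding h_def using m by (intro sum.cong refl) (auto simp: coord_axis)
  then have hm: "h (axis (index m) 1) \<noteq> 0" using m c by simp
  have "fst Y \<notin> interior K"
    using interior_linear_pos[OF h hm pos, where y = "fst Y"] Y(2) aff by auto
  then show ?thesis using fst_hull[OF Y(1)] closure_subset by (auto simp: frontier_def)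
qed

end

section \<open>Convex combinations with fixed end points and free nodes\<close>

text \<open>
  The four maps are instances of one construction: convex combinations of \<open>p + 1\<close> points of the curve,
  of which the first ones sit at the fixed end points listed in \<open>e\<close> and the other \<open>q\<close> are free and
  increasing. The list is \<open>[b]\<close> or \<open>[a, b]\<close> for the upper map with \<open>n\<close> even or odd, and \<open>[a]\<close> or \<open>[]\<close> for
  the lower one. In each case end points counted once and free nodes counted twice add up to \<open>n + 1\<close>,
  one more than the order of the generalised polynomials in the first \<open>n\<close> coordinates.
\<close>

locale principal_rep = tp_curve a b \<gamma>
  for a b :: real and \<gamma> :: "real \<Rightarrow> (real ^ 'n::{finite,linorder}) \<times> real" +
  fixes e :: "real list" and p q :: nat
  assumes ends: "set e \<subseteq> {a, b}" "distinct e"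
    and pq: "p + q = CARD('n)" "p + 1 = q + length e"
begin

definition node :: "real ^ 'n::{finite,linorder} \<Rightarrow> nat \<Rightarrow> real" where
  "node s i = (if i < length e then e ! i else coord s (p + (i - length e + 1)))"

definition weight :: "real ^ 'n::{finite,linorder} \<Rightarrow> nat \<Rightarrow> real" where
  "weight s i = (if i = 0 then 1 - (\<Sum>j=1..p. coord s j) else coord s i)"

definition rep :: "real ^ 'n::{finite,linorder} \<Rightarrow> (real ^ 'n::{finite,linorder}) \<times> real" where
  "rep s = (\<Sum>i\<le>p. weight s i *\<^sub>R \<gamma> (node s i))"

abbreviation "Dom \<equiv> (Delta_prod p q a b :: (real ^ 'n::{finite,linorder}) set)"

definition open_dom :: "(real ^ 'n::{finite,linorder}) set" where
  "open_dom = {s. (\<forall>i\<le>p. 0 < weight s i) \<and> (\<forall>j\<in>{1..q}. a < coord s (p + j) \<and> coord s (p + j) < b)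
     \<and> (\<forall>j\<in>{1..<q}. coord s (p + j) < coord s (p + (j + 1)))}"

lemma dom_iff:
  "s \<in> Dom \<longleftrightarrow> (\<forall>i\<le>p. 0 \<le> weight s i) \<and>
     (\<forall>j\<in>{1..q}. a \<le> coord s (p + j) \<and> coord s (p + j) \<le> b)
     \<and> (\<forall>j\<in>{1..<q}. coord s (p + j) \<le> coord s (p + (j + 1)))"
proof -
  have "(\<forall>i\<le>p. 0 \<le> weight s i) \<longleftrightarrow> (\<forall>j\<in>{1..p}. 0 \<le> coord s j) \<and> (\<Sum>j=1..p. coord s j) \<le> 1"
    by (fastforce simp: weight_def)
  then show ?thesis by (auto simp: Delta_prod_def Delta_c_def Delta_star_def)
qed

lemma domD:
  assumes "s \<in> Dom"
  shows "i \<le> p \<Longrightarrow> 0 \<le> weight s i" "j \<in> {1..q} \<Longrightarrow> a \<le> coord s (p + j)"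
    "j \<in> {1..q} \<Longrightarrow> coord s (p + j) \<le> b"
    "j \<in> {1..<q} \<Longrightarrow> coord s (p + j) \<le> coord s (p + (j + 1))"
  using assms by (simp_all add: dom_iff)

lemma open_domD:
  assumes "s \<in> open_dom"
  shows "i \<le> p \<Longrightarrow> 0 < weight s i" "j \<in> {1..q} \<Longrightarrow> a < coord s (p + j)"
    "j \<in> {1..q} \<Longrightarrow> coord s (p + j) < b"
    "j \<in> {1..<q} \<Longrightarrow> coord s (p + j) < coord s (p + (j + 1))"
  using assms by (simp_all add: open_dom_def)

lemma sum_weight: "(\<Sum>i\<le>p. weight s i) = 1"
proof -
  have "(\<Sum>i\<le>p. weight s i) = weight s 0 + (\<Sum>i=1..p. weight s i)"
    by (simp add: atMost_atLeast0 sum.atLeast_Suc_atMost)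
  also have "(\<Sum>i=1..p. weight s i) = (\<Sum>i=1..p. coord s i)"
    by (intro sum.cong) (auto simp: weight_def)
  finally show ?thesis by (simp add: weight_def)
qed

lemma q_eq: "length e \<le> p + 1" "q = p + 1 - length e" "length e + 2 * q = CARD('n) + 1"
  using pq by auto

lemma node_interior_index:
  assumes "length e \<le> i" "i \<le> p"
  shows "i - length e + 1 \<in> {1..q}" "node s i = coord s (p + (i - length e + 1))"
  using assms pq by (auto simp: node_def)

lemma node_of_coord:
  assumes "j \<in> {1..q}"
  shows "node s (length e + j - 1) = coord s (p + j)" "length e + j - 1 \<le> p" "length e \<le> length e + j - 1"
  using assms pq by (auto simp: node_def)

lemma node_in:
  assumes "s \<in> Dom" "i \<le> p"
  shows "node s i \<in> {a..b}"
proof (cases "i < length e")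
  case True
  then have "e ! i \<in> {a, b}" using ends(1) nth_mem by blast
  then show ?thesis using True a_less_b by (auto simp: node_def)
next
  case False
  then have "i - length e + 1 \<in> {1..q}" "node s i = coord s (p + (i - length e + 1))"
    using node_interior_index(1)[of i] node_interior_index(2)[of i s] assms(2) by auto
  then show ?thesis using domD(2,3)[OF assms(1), of "i - length e + 1"] by simp
qed

lemma rep_in_C: "s \<in> Dom \<Longrightarrow> rep s \<in> C"
  unfolding rep_def using node_in[of s] sum_weight[of s]
  by (intro convex_sum) (auto simp: dom_iff convex_convex_hull intro!: hull_inc)

lemma rep_in_K: "s \<in> Dom \<Longrightarrow> fst (rep s) \<in> K"
  by (intro fst_hull rep_in_C)

lemma linear_neg_sum_coord: "linear (\<lambda>s. - (\<Sum>j=1..p. coord s j))"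
  by (intro linear_compose_neg linear_compose_sum ballI linear_coord)

lemma open_open_dom: "open open_dom"
proof -
  have w: "continuous_on UNIV (\<lambda>s. weight s i)" for i
    unfolding weight_def by (cases "i = 0") (auto intro!: continuous_intros)
  have eq: "open_dom = (\<Inter>i\<in>{..p}. {s. 0 < weight s i}) \<inter> (\<Inter>j\<in>{1..q}. {s. a < coord s (p + j)})
      \<inter> (\<Inter>j\<in>{1..q}. {s. coord s (p + j) < b})
      \<inter> (\<Inter>j\<in>{1..<q}. {s. coord s (p + j) < coord s (p + (j + 1))})"
    by (auto simp: open_dom_def)
  show ?thesis unfolding eq
    by (intro open_Int open_INT ballI open_Collect_less w continuous_intros) auto
qed

lemma open_dom_subset: "open_dom \<subseteq> Dom"
  unfolding open_dom_def dom_iff subset_iff by (auto intro: less_imp_le)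

lemma interior_dom: "interior Dom = open_dom"
proof
  show "open_dom \<subseteq> interior Dom" by (rule interior_maximal[OF open_dom_subset open_open_dom])
  show "interior Dom \<subseteq> open_dom"
  proof
    fix s assume s: "s \<in> interior Dom"
    note pos = interior_linear_pos[OF _ _ _ s]
    have w: "0 < weight s i" if "i \<le> p" for i
    proof (cases "i = 0")
      case True
      show ?thesis
      proof (cases "p = 0")
        case False
        have "(\<Sum>j=1..p. coord (axis (index 1) 1 :: real ^ 'n::{finite,linorder}) j) = (\<Sum>j=1..p. if 1 = j then 1 else 0)"
          using pq by (intro sum.cong coord_axis refl) auto
        then have "- (\<Sum>j=1..p. coord (axis (index 1) 1 :: real ^ 'n::{finite,linorder}) j) \<noteq> 0" using False by simp
        moreover have "0 \<le> 1 + - (\<Sum>j=1..p. coord x j)" if "x \<in> Dom" for x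
          using domD(1)[OF that, of 0] by (simp add: weight_def)
        ultimately have "0 < 1 + - (\<Sum>j=1..p. coord s j)" by (rule pos[OF linear_neg_sum_coord])
        then show ?thesis using True by (simp add: weight_def)
      next
        case p0: True
        then show ?thesis unfolding weight_def using True by simp
      qed
    next
      case False
      have "coord (axis (index i) 1 :: real ^ 'n::{finite,linorder}) i \<noteq> 0" using coord_axis[of i i, where 'n='n] False that pq by auto
      moreover have "0 \<le> 0 + coord x i" if "x \<in> Dom" for x
        using domD(1)[OF that \<open>i \<le> p\<close>] False by (simp add: weight_def)
      ultimately have "0 < 0 + coord s i" by (rule pos[OF linear_coord])
      then show ?thesis using False by (simp add: weight_def)
    qed
    have ab: "a < coord s (p + j) \<and> coord s (p + j) < b" if j: "j \<in> {1..q}" for j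
    proof -
      have ax: "coord (axis (index (p + j)) 1 :: real ^ 'n::{finite,linorder}) (p + j) = 1"
        using coord_axis[of "p + j" "p + j", where 'n='n] j pq by auto
      then have ne: "coord (axis (index (p + j)) 1 :: real ^ 'n::{finite,linorder}) (p + j) \<noteq> 0"
        "- coord (axis (index (p + j)) 1 :: real ^ 'n::{finite,linorder}) (p + j) \<noteq> 0" by simp_all
      have "0 < - a + coord s (p + j)"
        using j by (intro pos[OF linear_coord ne(1)]) (simp add: domD)
      moreover have "0 < b + - coord s (p + j)"
        using j by (intro pos[OF linear_compose_neg[OF linear_coord] ne(2)]) (simp add: domD)
      ultimately show ?thesis by simp
    qed
    have lt: "coord s (p + j) < coord s (p + (j + 1))" if j: "j \<in> {1..<q}" for j
    proof -
      have ax: "coord (axis (index (p + j)) 1 :: real ^ 'n::{finite,linorder}) (p + j) = 1"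
         "coord (axis (index (p + j)) 1 :: real ^ 'n::{finite,linorder}) (p + (j + 1)) = 0"
        using coord_axis[of "p + j" "p + j", where 'n='n] coord_axis[of "p + j" "p + (j + 1)", where 'n='n] j pq by auto
      then have ne: "coord (axis (index (p + j)) 1 :: real ^ 'n::{finite,linorder}) (p + (j + 1)) - coord (axis (index (p + j)) 1 :: real ^ 'n::{finite,linorder}) (p + j) \<noteq> 0"
        by simp
      have "0 < 0 + (coord s (p + (j + 1)) - coord s (p + j))"
        using domD(4)[OF _ j] by (intro pos[OF linear_compose_sub[OF linear_coord linear_coord] ne]) simp
      then show ?thesis by simp
    qed
    show "s \<in> open_dom" using w ab lt by (simp add: open_dom_def)
  qed
qed

lemma compact_dom: "compact Dom"
proof -
  have w: "continuous_on UNIV (\<lambda>s. weight s i)" for i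
    unfolding weight_def by (cases "i = 0") (auto intro!: continuous_intros)
  have eq: "Dom = (\<Inter>i\<in>{..p}. {s. 0 \<le> weight s i}) \<inter> (\<Inter>j\<in>{1..q}. {s. a \<le> coord s (p + j)})
      \<inter> (\<Inter>j\<in>{1..q}. {s. coord s (p + j) \<le> b})
      \<inter> (\<Inter>j\<in>{1..<q}. {s. coord s (p + j) \<le> coord s (p + (j + 1))})"
    by (auto simp: dom_iff)
  have "closed Dom" unfolding eq
    by (intro closed_Int closed_INT ballI closed_Collect_le w continuous_intros)
  moreover have "Dom \<subseteq> cbox (\<chi> i. min 0 a) (\<chi> i. max 1 b)"
  proof
    fix s assume s: "s \<in> Dom"
    have "min 0 a \<le> coord s i \<and> coord s i \<le> max 1 b" if i: "i \<in> {1..CARD('n)}" for i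
    proof (cases "i \<le> p")
      case True
      have "weight s i \<le> (\<Sum>i\<le>p. weight s i)"
        using True s by (intro member_le_sum) (auto simp: dom_iff)
      moreover have "weight s i = coord s i" using i by (simp add: weight_def)
      ultimately show ?thesis using domD(1)[OF s True] by (simp add: sum_weight min_le_iff_disj le_max_iff_disj)
    next
      case False
      then have "i - p \<in> {1..q}" "i = p + (i - p)" using i pq by auto
      then have "min 0 a \<le> coord s (p + (i - p)) \<and> coord s (p + (i - p)) \<le> max 1 b"
        using domD(2,3)[OF s, of "i - p"] by (simp add: min_le_iff_disj le_max_iff_disj)
      then show ?thesis using \<open>i = p + (i - p)\<close> by simp
    qed
    then have "min 0 a \<le> vec_nth s k \<and> vec_nth s k \<le> max 1 b" for k
      using bij_betw_index[where 'n='n] unfolding coord_index by (metis UNIV_I bij_betw_imp_surj_on imageE)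
    then show "s \<in> cbox (\<chi> i. min 0 a) (\<chi> i. max 1 b)" by (simp add: mem_box_cart)
  qed
  ultimately show ?thesis using bounded_subset[OF bounded_cbox] compact_eq_bounded_closed by blast
qed

lemma frontier_dom: "frontier Dom = Dom - open_dom"
  using compact_dom by (simp add: frontier_def interior_dom closure_closed compact_imp_closed)

lemma open_dom_nonempty: "open_dom \<noteq> {}"
proof -
  \<comment> \<open>equal weights and equidistant nodes\<close>
  define f where "f = (\<lambda>i. if i \<le> p then 1 / (p + 1) else a + (b - a) * ((i - p) / (q + 1)) :: real)"
  define s :: "real ^ 'n::{finite,linorder}" where "s = (\<Sum>i=1..CARD('n). f i *\<^sub>R axis (index i) 1)"
  have s: "coord s j = f j" if "j \<in> {1..CARD('n)}" for j
  proof -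
    have "coord s j = (\<Sum>i=1..CARD('n). f i * coord (axis (index i) 1 :: real ^ 'n::{finite,linorder}) j)"
      unfolding s_def by (simp add: linear_sum[OF linear_coord])
    also have "\<dots> = (\<Sum>i=1..CARD('n). if j = i then f i else 0)"
      using that by (intro sum.cong refl) (simp add: coord_axis)
    finally show ?thesis using that by simp
  qed
  have c1: "coord s j = 1 / (p + 1)" if "j \<in> {1..p}" for j using s[of j] that pq by (auto simp: f_def)
  have c2: "coord s (p + j) = a + (b - a) * (j / (q + 1))" if "j \<in> {1..q}" for j
    using s[of "p + j"] that pq by (auto simp: f_def)
  have "(\<Sum>j=1..p. coord s j) = (\<Sum>j=1..p. 1 / (p + 1))" using c1 by (intro sum.cong) auto
  then have sum: "(\<Sum>j=1..p. coord s j) = p / (p + 1)" by simp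
  have "s \<in> open_dom" unfolding open_dom_def
  proof (intro CollectI conjI allI impI ballI)
    fix i assume "i \<le> p"
    then have "weight s i = 1 / (p + 1)"
      using sum c1[of i] by (cases "i = 0") (auto simp: weight_def field_simps)
    then show "0 < weight s i" by simp
  next
    fix j assume j: "j \<in> {1..q}"
    have "0 < (b - a) * (j / (q + 1))" using j a_less_b by simp
    then show "a < coord s (p + j)" using c2[OF j] by simp
    have "(b - a) * (j / (q + 1)) < (b - a) * 1"
      using j a_less_b by (intro mult_strict_left_mono) auto
    then show "coord s (p + j) < b" using c2[OF j] by simp
  next
    fix j assume j: "j \<in> {1..<q}"
    have "(b - a) * (j / (q + 1)) < (b - a) * ((j + 1) / (q + 1))"
      using a_less_b by (intro mult_strict_left_mono divide_strict_right_mono) auto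
    then show "coord s (p + j) < coord s (p + (j + 1))" using c2[of j] c2[of "j + 1"] j by simp
  qed
  then show ?thesis by blast
qed

text \<open>
  Different parameters may repeat a node or give it weight zero. The distribution of mass on the
  interval is what a point of the image determines.
\<close>

definition mass :: "real ^ 'n::{finite,linorder} \<Rightarrow> real \<Rightarrow> real" where
  "mass s t = (\<Sum>i | i \<le> p \<and> node s i = t. weight s i)"

abbreviation "nodes s \<equiv> node s ` {..p}"

lemma sum_mass:
  fixes f :: "real \<Rightarrow> 'x::real_vector"
  assumes "finite T" "nodes s \<subseteq> T"
  shows "(\<Sum>t\<in>T. mass s t *\<^sub>R f t) = (\<Sum>i\<le>p. weight s i *\<^sub>R f (node s i))"
proof -
  have "(\<Sum>t\<in>T. mass s t *\<^sub>R f t) = (\<Sum>t\<in>T. \<Sum>i | i \<in> {..p} \<and> node s i = t. weight s i *\<^sub>R f (node s i))"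
    unfolding mass_def scaleR_sum_left by (intro sum.cong) auto
  also have "\<dots> = (\<Sum>i\<le>p. weight s i *\<^sub>R f (node s i))"
    using assms by (intro sum.group) auto
  finally show ?thesis .
qed

lemma sum_mass_one: "finite T \<Longrightarrow> nodes s \<subseteq> T \<Longrightarrow> sum (mass s) T = 1"
  using sum_mass[of T s "\<lambda>_. 1 :: real"] sum_weight[of s] by simp

lemma card_nodes: "card (nodes s) \<le> CARD('n) + 1"
  using card_image_le[of "{..p}" "node s"] pq by simp

text \<open>
  Two parameters share their fixed end points, so their nodes form a set of at most
  \<open>length e + 2 q = n + 1\<close> points of the projected curve, and these are affinely independent.
\<close>

lemma same_mass:
  assumes "s1 \<in> Dom" "s2 \<in> Dom" "fst (rep s1) = fst (rep s2)"
  shows "\<And>t. t \<in> nodes s1 \<union> nodes s2 \<Longrightarrow> mass s1 t = mass s2 t" "rep s1 = rep s2"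
proof -
  let ?T = "nodes s1 \<union> nodes s2"
  have fin: "finite ?T" by simp
  have sub: "?T \<subseteq> set e \<union> node s1 ` {length e..p} \<union> node s2 ` {length e..p}"
  proof -
    have "node s i \<in> set e \<union> node s ` {length e..p}" if "i \<le> p" for i s
      using that by (cases "i < length e") (auto simp: node_def[of s i] intro!: image_eqI[of _ _ i])
    then show ?thesis by blast
  qed
  have "card ?T \<le> card (set e \<union> node s1 ` {length e..p} \<union> node s2 ` {length e..p})"
    by (rule card_mono[OF _ sub]) auto
  also have "\<dots> \<le> card (set e) + card (node s1 ` {length e..p}) + card (node s2 ` {length e..p})"
    by (meson add_right_mono card_Un_le order_trans)
  also have "\<dots> \<le> length e + card {length e..p} + card {length e..p}"
    by (intro add_mono card_length card_image_le) auto
  finally have card: "card ?T \<le> CARD('n) + 1" using q_eq by simp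
  have T: "?T \<subseteq> {a..b}" using assms node_in by auto
  have "mass s1 t - mass s2 t = 0" if t: "t \<in> ?T" for t
  proof (rule nodes_independent[OF fin T card _ _ t])
    show "(\<Sum>t\<in>?T. mass s1 t - mass s2 t) = 0"
      using sum_mass_one[OF fin, of s1] sum_mass_one[OF fin, of s2] by (simp add: sum_subtractf)
    show "(\<Sum>t\<in>?T. (mass s1 t - mass s2 t) *\<^sub>R gbar t) = 0"
      using sum_mass[OF fin, of s1 gbar] sum_mass[OF fin, of s2 gbar] assms(3)
      by (simp add: sum_subtractf scaleR_diff_left rep_def fst_sum)
  qed
  then show eq: "\<And>t. t \<in> ?T \<Longrightarrow> mass s1 t = mass s2 t" by simp
  then have "(\<Sum>t\<in>?T. mass s1 t *\<^sub>R \<gamma> t) = (\<Sum>t\<in>?T. mass s2 t *\<^sub>R \<gamma> t)"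
    by (intro sum.cong) auto
  then show "rep s1 = rep s2"
    using sum_mass[OF fin, of s1 \<gamma>] sum_mass[OF fin, of s2 \<gamma>] by (simp add: rep_def)
qed

lemma open_dom_nodes:
  assumes s: "s \<in> open_dom"
  shows "inj_on (node s) {..p}"
    and "node s ` {length e..p} = nodes s \<inter> {a<..<b}"
    and "node s ` {length e..p} = (\<lambda>j. coord s (p + j)) ` {1..q}"
    and "nodes s = node s ` {length e..p} \<union> set e"
proof -
  have int: "node s i \<in> {a<..<b}" if "length e \<le> i" "i \<le> p" for i
    using node_interior_index(1)[OF that] node_interior_index(2)[OF that, of s] open_domD(2,3)[OF s, of "i - length e + 1"] by simp
  have end_: "node s i \<in> set e" "node s i \<notin> {a<..<b}" if "i < length e" for i
  proof -
    have "e ! i \<in> {a, b}" using ends(1) nth_mem[OF that] by blast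
    then show "node s i \<in> set e" "node s i \<notin> {a<..<b}" using that by (auto simp: node_def)
  qed
  have lt: "node s i < node s j" if "length e \<le> i" "i < j" "j \<le> p" for i j
  proof -
    have "coord s (p + (i - length e + 1)) < coord s (p + (j - length e + 1))"
    proof (rule consecutive_less[of q "\<lambda>j. coord s (p + j)"])
      show "coord s (p + j) < coord s (p + (j + 1))" if "j \<in> {1..<q}" for j
        using open_domD(4)[OF s that] .
    qed (use that pq in auto)
    then show ?thesis using that by (simp add: node_def)
  qed
  have ne: "node s i \<noteq> node s j" if "i < j" "i \<le> p" "j \<le> p" for i j
  proof (cases "j < length e")
    case True
    then show ?thesis using that ends(2) by (simp add: node_def nth_eq_iff_index_eq)
  next
    case False
    show ?thesis
    proof (cases "i < length e")
      case True
      then show ?thesis using end_(2)[of i] int[of j] False that by auto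
    next
      case False
      then show ?thesis using lt[of i j] that by simp
    qed
  qed
  show "inj_on (node s) {..p}"
    using ne by (intro inj_onI) (metis atMost_iff linorder_neqE_nat)
  show "node s ` {length e..p} = nodes s \<inter> {a<..<b}"
  proof
    show "node s ` {length e..p} \<subseteq> nodes s \<inter> {a<..<b}" using int by auto
    show "nodes s \<inter> {a<..<b} \<subseteq> node s ` {length e..p}"
    proof
      fix x assume "x \<in> nodes s \<inter> {a<..<b}"
      then obtain i where i: "i \<le> p" "x = node s i" "x \<in> {a<..<b}" by auto
      then have "length e \<le> i" using end_(2)[of i] by force
      then show "x \<in> node s ` {length e..p}" using i by auto
    qed
  qed
  show "node s ` {length e..p} = (\<lambda>j. coord s (p + j)) ` {1..q}"
  proof
    show "node s ` {length e..p} \<subseteq> (\<lambda>j. coord s (p + j)) ` {1..q}"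
    proof
      fix x assume "x \<in> node s ` {length e..p}"
      then obtain i where "length e \<le> i" "i \<le> p" "x = node s i" by auto
      then show "x \<in> (\<lambda>j. coord s (p + j)) ` {1..q}"
        using node_interior_index(1)[of i] node_interior_index(2)[of i s]
        by (intro image_eqI[of _ _ "i - length e + 1"]) simp_all
    qed
    show "(\<lambda>j. coord s (p + j)) ` {1..q} \<subseteq> node s ` {length e..p}"
    proof
      fix x assume "x \<in> (\<lambda>j. coord s (p + j)) ` {1..q}"
      then obtain j where "j \<in> {1..q}" "x = coord s (p + j)" by blast
      then show "x \<in> node s ` {length e..p}"
        using node_of_coord[of j] by (intro image_eqI[of _ _ "length e + j - 1"]) auto
    qed
  qed
  show "nodes s = node s ` {length e..p} \<union> set e"
  proof
    show "nodes s \<subseteq> node s ` {length e..p} \<union> set e"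
    proof
      fix x assume "x \<in> nodes s"
      then obtain i where "i \<le> p" "x = node s i" by auto
      then show "x \<in> node s ` {length e..p} \<union> set e" using end_(1)[of i] by (cases "i < length e") auto
    qed
    have "set e \<subseteq> nodes s"
    proof
      fix x assume "x \<in> set e"
      then obtain i where "i < length e" "e ! i = x" by (auto simp: in_set_conv_nth)
      then show "x \<in> nodes s" using q_eq(1) by (intro image_eqI[of _ _ i]) (auto simp: node_def)
    qed
    then show "node s ` {length e..p} \<union> set e \<subseteq> nodes s" by auto
  qed
qed

lemma mass_node:
  assumes "s \<in> open_dom" "i \<le> p"
  shows "mass s (node s i) = weight s i"
proof -
  have "{j. j \<le> p \<and> node s j = node s i} = {i}"
    using open_dom_nodes(1)[OF assms(1)] assms(2) by (auto simp: inj_on_def)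
  then show ?thesis by (simp add: mass_def)
qed

text \<open>
  For parameters in the open domain the masses recover the set of nodes, its increasing enumeration
  recovers the free nodes, and the masses at the nodes are the weights.
\<close>

lemma inj_on_rep: "inj_on (\<lambda>s. fst (rep s)) open_dom"
proof (rule inj_onI)
  fix s1 s2 assume s: "s1 \<in> open_dom" "s2 \<in> open_dom" and eq: "fst (rep s1) = fst (rep s2)"
  note mass = same_mass(1)[of s1 s2]
  have d: "s1 \<in> Dom" "s2 \<in> Dom" using s open_dom_subset by auto
  have pos: "0 < mass s t \<longleftrightarrow> t \<in> nodes s" if "s \<in> open_dom" for s t
  proof
    show "t \<in> nodes s" if "0 < mass s t"
    proof (rule ccontr)
      assume "t \<notin> nodes s"
      then have "{i. i \<le> p \<and> node s i = t} = {}" by auto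
      then have "mass s t = 0" by (simp only: mass_def sum.empty)
      then show False using that by simp
    qed
    show "0 < mass s t" if "t \<in> nodes s"
      using that mass_node[OF \<open>s \<in> open_dom\<close>] \<open>s \<in> open_dom\<close> by (auto simp: open_dom_def)
  qed
  have nodes: "nodes s1 = nodes s2"
  proof -
    have "t \<in> nodes s1 \<longleftrightarrow> t \<in> nodes s2" for t
      using mass[OF d eq, of t] pos[OF s(1), of t] pos[OF s(2), of t] by (metis UnI1 UnI2)
    then show ?thesis by (rule Set.set_eqI)
  qed
  have list: "sorted_wrt (<) (map (\<lambda>j. coord s (p + j)) [1..<q + 1])" if "s \<in> open_dom" for s
  proof (rule sorted_wrt_map_mono[OF sorted_wrt_upt])
    fix i j assume ij: "i \<in> set [1..<q + 1]" "j \<in> set [1..<q + 1]" "i < j"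
    show "coord s (p + i) < coord s (p + j)"
    proof (rule consecutive_less[of q "\<lambda>j. coord s (p + j)"])
      show "coord s (p + j) < coord s (p + (j + 1))" if "j \<in> {1..<q}" for j
        using open_domD(4)[OF \<open>s \<in> open_dom\<close> that] .
    qed (use ij in auto)
  qed
  have "(\<lambda>j. coord s1 (p + j)) ` {1..q} = (\<lambda>j. coord s2 (p + j)) ` {1..q}"
    using open_dom_nodes(2,3)[OF s(1)] open_dom_nodes(2,3)[OF s(2)] nodes by simp
  then have "set (map (\<lambda>j. coord s1 (p + j)) [1..<q + 1]) = set (map (\<lambda>j. coord s2 (p + j)) [1..<q + 1])"
    by (simp add: atLeastLessThanSuc_atLeastAtMost del: upt_Suc)
  then have "map (\<lambda>j. coord s1 (p + j)) [1..<q + 1] = map (\<lambda>j. coord s2 (p + j)) [1..<q + 1]"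
    by (intro strict_sorted_equal list s) auto
  then have nodes_eq: "coord s1 (p + j) = coord s2 (p + j)" if "j \<in> {1..q}" for j
    using that by (simp del: upt_Suc)
  have "node s1 i = node s2 i" if "i \<le> p" for i
    using nodes_eq[OF node_interior_index(1)[of i]] that by (auto simp: node_def)
  then have "weight s1 i = weight s2 i" if "i \<le> p" for i
    using that mass[OF d eq, of "node s1 i"] mass_node[OF s(1) that] mass_node[OF s(2) that] by auto
  then have w: "coord s1 i = coord s2 i" if "i \<in> {1..p}" for i
    using that by (force simp: weight_def)
  show "s1 = s2"
  proof (rule coord_eqI)
    fix i assume i: "i \<in> {1..CARD('n)}"
    show "coord s1 i = coord s2 i"
    proof (cases "i \<le> p")
      case False
      then have "i - p \<in> {1..q}" "i = p + (i - p)" using i pq by auto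
      then show ?thesis using nodes_eq by metis
    qed (use w i in auto)
  qed
qed

lemma sum_index_cost: "(\<Sum>i\<le>p. if i < length e then 1 else 2) = CARD('n) + 1"
proof -
  have "{..p} = {..<length e} \<union> {length e..p}" using q_eq(1) by auto
  then have "(\<Sum>i\<le>p. if i < length e then 1 else 2 :: nat) =
      (\<Sum>i<length e. if i < length e then 1 else 2) + (\<Sum>i=length e..p. if i < length e then 1 else 2)"
    by (simp only:) (rule sum.union_disjoint, auto)
  also have "\<dots> = length e + 2 * q" using q_eq by simp
  finally show ?thesis using q_eq by simp
qed

definition support :: "real ^ 'n::{finite,linorder} \<Rightarrow> real set" where
  "support s = node s ` {i\<in>{..p}. 0 < weight s i}"

text \<open>
  Counting interior points twice and end points once, the nodes of a parameter count at most \<open>n + 1\<close>.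
  On the boundary of the domain a weight vanishes, a free node reaches an end point, or two nodes merge,
  and each of these events lowers the count.
\<close>

lemma boundary_index:
  assumes s: "s \<in> Dom - open_dom"
  shows "2 * card (support s \<inter> {a<..<b}) + card (support s \<inter> {a, b}) \<in> {1..CARD('n)}"
proof -
  let ?X = "support s \<inter> {a<..<b}" and ?E = "support s \<inter> {a, b}"
  let ?le = "2 * card ?X + card ?E \<le> CARD('n)"
  \<comment> \<open>\<open>cost\<close> counts a point where it lies, \<open>icost\<close> counts a node as if it were in general position.\<close>
  define cost :: "real \<Rightarrow> nat" where "cost = (\<lambda>t. if t \<in> {a<..<b} then 2 else 1)"
  define icost :: "nat \<Rightarrow> nat" where "icost = (\<lambda>i. if i < length e then 1 else 2)"
  have fin: "finite (support s)" by (simp add: support_def)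
  have ab: "support s \<subseteq> {a..b}" using s node_in by (auto simp: support_def)
  have split: "support s = ?X \<union> ?E" using ab by auto
  have "sum cost (support s) = sum cost ?X + sum cost ?E"
    by (subst split, rule sum.union_disjoint) (use fin in auto)
  also have "sum cost ?X = 2 * card ?X" by (simp add: cost_def)
  also have "sum cost ?E = (\<Sum>t\<in>?E. 1)" by (intro sum.cong) (auto simp: cost_def)
  finally have sum_cost: "sum cost (support s) = 2 * card ?X + card ?E" by simp
  have "\<exists>i\<le>p. 0 < weight s i"
  proof (rule ccontr)
    assume "\<not> ?thesis"
    then have "(\<Sum>i\<le>p. weight s i) \<le> 0" by (intro sum_nonpos) (auto simp: not_less)
    then show False by (simp add: sum_weight)
  qed
  then have "support s \<noteq> {}" by (auto simp: support_def)
  then have "0 < card (support s)" using fin card_gt_0_iff by blast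
  moreover have "card (support s) \<le> card ?X + card ?E" by (subst split) (rule card_Un_le)
  ultimately have one: "1 \<le> 2 * card ?X + card ?E" by simp
  have node_cost: "cost (node s i) \<le> icost i" if "i \<le> p" for i
  proof (cases "i < length e")
    case True
    then have "e ! i \<in> {a, b}" using ends(1) nth_mem[of i e] by blast
    then show ?thesis using True by (auto simp: cost_def icost_def node_def)
  qed (simp add: cost_def icost_def)
  have bound: "sum cost (support s) \<le> (\<Sum>i\<in>J. cost (node s i))"
    if "J \<subseteq> {..p}" "support s \<subseteq> node s ` J" for J
  proof -
    have fJ: "finite J" using that(1) finite_subset by blast
    have "sum cost (support s) \<le> sum cost (node s ` J)"
      using that fJ by (intro sum_mono2) auto
    also have "\<dots> \<le> sum (cost \<circ> node s) J"
      using fJ by (intro sum_image_le) auto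
    finally show ?thesis by simp
  qed
  have drop: "sum cost (support s) \<le> CARD('n)"
    if i0: "i0 \<le> p" "support s \<subseteq> node s ` ({..p} - {i0})" for i0
  proof -
    have "sum cost (support s) \<le> (\<Sum>i\<in>{..p} - {i0}. cost (node s i))" using i0 by (intro bound) auto
    also have "\<dots> \<le> (\<Sum>i\<in>{..p} - {i0}. icost i)" by (intro sum_mono node_cost) auto
    also have "\<dots> < (\<Sum>i\<le>p. icost i)"
      using i0(1) by (subst sum.remove[of "{..p}" i0 icost]) (auto simp: icost_def)
    finally show ?thesis using sum_index_cost by (simp add: icost_def)
  qed
  have w: "\<And>i. i \<le> p \<Longrightarrow> 0 \<le> weight s i"
    and x: "\<And>j. j \<in> {1..q} \<Longrightarrow> a \<le> coord s (p + j) \<and> coord s (p + j) \<le> b"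
    and le: "\<And>j. j \<in> {1..<q} \<Longrightarrow> coord s (p + j) \<le> coord s (p + (j + 1))"
    using s by (auto simp: dom_iff)
  have zero_weight: ?le if "i \<le> p" "weight s i = 0" for i
    unfolding sum_cost[symmetric] using that by (intro drop[of i]) (auto simp: support_def)
  have end_node: ?le if j: "j \<in> {1..q}" "coord s (p + j) \<in> {a, b}" for j
  proof -
    let ?i = "length e + j - 1"
    have i: "?i \<le> p" "length e \<le> ?i" "node s ?i \<in> {a, b}" using node_of_coord[OF j(1)] j(2) by auto
    have "sum cost (support s) \<le> (\<Sum>i\<le>p. cost (node s i))" by (intro bound) (auto simp: support_def)
    also have "\<dots> < (\<Sum>i\<le>p. icost i)"
    proof (rule sum_strict_mono_ex1)
      have "cost (node s ?i) < icost ?i" using i by (auto simp: cost_def icost_def)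
      then show "\<exists>i\<in>{..p}. cost (node s i) < icost i" using i(1) by blast
    qed (use node_cost in auto)
    finally show ?thesis using sum_index_cost sum_cost by (simp add: icost_def)
  qed
  have equal_nodes: ?le if j: "j \<in> {1..<q}" "coord s (p + j) = coord s (p + (j + 1))" for j
  proof -
    have j': "j \<in> {1..q}" "j + 1 \<in> {1..q}" using j(1) by auto
    have eq: "node s (length e + j - 1) = node s (length e + j)"
      using node_of_coord(1)[OF j'(1), of s] node_of_coord(1)[OF j'(2), of s] j(2) by simp
    have le: "length e + j \<le> p" using node_of_coord(2)[OF j'(2)] by simp
    have "support s \<subseteq> node s ` ({..p} - {length e + j})"
    proof
      fix t assume "t \<in> support s"
      then obtain i where i: "i \<le> p" "t = node s i" by (auto simp: support_def)
      show "t \<in> node s ` ({..p} - {length e + j})"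
      proof (cases "i = length e + j")
        case True
        then show ?thesis using i eq le j' by (intro image_eqI[of _ _ "length e + j - 1"]) auto
      qed (use i in auto)
    qed
    then show ?thesis using drop[OF le] sum_cost by simp
  qed
  have ?le
  proof (rule ccontr)
    assume neg: "\<not> ?le"
    have "0 < weight s i" if "i \<le> p" for i
      using neg zero_weight[OF that] w[OF that] by (auto simp: less_le)
    moreover have "a < coord s (p + j) \<and> coord s (p + j) < b" if "j \<in> {1..q}" for j
      using neg end_node[OF that] x[OF that] by (auto simp: less_le)
    moreover have "coord s (p + j) < coord s (p + (j + 1))" if "j \<in> {1..<q}" for j
      using neg equal_nodes[OF that] le[OF that] by (auto simp: less_le)
    ultimately have "s \<in> open_dom" by (simp add: open_dom_def)
    then show False using s by simp
  qed
  then show ?thesis using one by simp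
qed

lemma affine_form_rep_zero:
  assumes "s \<in> Dom" "\<And>t. t \<in> support s \<Longrightarrow> gpoly m c 0 t = 0"
  shows "affine_form m c (rep s) = 0"
proof -
  have "affine_form m c (rep s) = (\<Sum>i\<le>p. weight s i * gpoly m c 0 (node s i))"
    unfolding rep_def by (simp add: affine_form_convex_sum sum_weight gpoly_eq_affine_form)
  also have "\<dots> = 0"
  proof (rule sum.neutral, rule ballI)
    fix i assume "i \<in> {..p}"
    then have "weight s i = 0 \<or> node s i \<in> support s"
      using domD(1)[OF assms(1), of i] by (auto simp: support_def less_le)
    then show "weight s i * gpoly m c 0 (node s i) = 0" using assms(2) by auto
  qed
  finally show ?thesis .
qed

text \<open>
  The support has count at most \<open>n\<close>, so a nonnegative generalised polynomial in the first \<open>n\<close>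
  coordinates has exactly the support as its zero set. It shows that the projected point is on the
  frontier, and it confines every representation of a point above it to the support, where independence
  of the nodes leaves only the given one.
\<close>

theorem boundary_unique:
  assumes s: "s \<in> Dom - open_dom"
  shows "fst (rep s) \<in> frontier K" "\<And>Y. Y \<in> C \<Longrightarrow> fst Y = fst (rep s) \<Longrightarrow> Y = rep s"
proof -
  define m where "m = 2 * card (support s \<inter> {a<..<b}) + card (support s \<inter> {a, b})"
  have m: "1 \<le> m" "m \<le> CARD('n)" using boundary_index[OF s] by (auto simp: m_def)
  have ab: "support s \<subseteq> {a..b}" using s node_in by (auto simp: support_def)
  have split: "support s \<inter> {a<..<b} \<union> support s \<inter> {a, b} = support s" using ab by auto
  obtain c where c: "c m \<noteq> 0" "\<And>t. t \<in> {a..b} \<Longrightarrow> 0 \<le> gpoly m c 0 t"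
    "\<And>t. t \<in> {a..b} \<Longrightarrow> gpoly m c 0 t = 0 \<longleftrightarrow> t \<in> support s"
  proof -
    have "finite (support s)" by (simp add: support_def)
    then have "\<exists>c. c m \<noteq> 0 \<and> (0 < c m \<longleftrightarrow> b \<notin> support s \<inter> {a, b}) \<and>
      (\<forall>t\<in>{a..b}. 0 \<le> gpoly m c 0 t \<and> (gpoly m c 0 t = 0 \<longleftrightarrow> t \<in> support s))"
      using nonneg_gpoly[of "support s \<inter> {a<..<b}" "support s \<inter> {a, b}" m] m
      unfolding split m_def by simp
    then show ?thesis using that by blast
  qed
  have zero: "affine_form m c (rep s) = 0" using s c(3) ab by (intro affine_form_rep_zero) auto
  show "fst (rep s) \<in> frontier K"
    using s by (intro supporting_zero_imp_frontier[OF m c(1,2) rep_in_C zero]) auto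
  fix Y assume Y: "Y \<in> C" "fst Y = fst (rep s)"
  obtain T w where T: "finite T" "T \<subseteq> {a..b}" "\<forall>t\<in>T. 0 < w t" "sum w T = 1" "(\<Sum>t\<in>T. w t *\<^sub>R \<gamma> t) = Y"
    using convex_hull_image_rep[OF Y(1)] by blast
  have "affine_form m c Y = 0" using zero Y(2) m(2) by (simp add: affine_form_def coord_ext_fst)
  then have "gpoly m c 0 t = 0" if "t \<in> T" for t
    using support_in_zeros[of T w m c t] T c(2) that by (auto intro: less_imp_le)
  then have "T \<subseteq> support s" using c(3) T(2) by blast
  then have Tn: "T \<subseteq> nodes s" by (auto simp: support_def)
  define w' where "w' = (\<lambda>t. if t \<in> T then w t else 0)"
  have w'sum: "(\<Sum>t\<in>nodes s. w' t *\<^sub>R f t) = (\<Sum>t\<in>T. w t *\<^sub>R f t)" for f :: "real \<Rightarrow> 'x::real_vector"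
    using Tn by (intro sum.mono_neutral_cong_right) (auto simp: w'_def)
  have fin: "finite (nodes s)" by simp
  have "w' t - mass s t = 0" if t: "t \<in> nodes s" for t
  proof (rule nodes_independent[OF fin _ card_nodes _ _ t])
    show "nodes s \<subseteq> {a..b}" using s node_in by auto
    show "(\<Sum>t\<in>nodes s. w' t - mass s t) = 0"
      using w'sum[of "\<lambda>_. 1 :: real"] T(4) sum_mass_one[OF fin, of s] by (simp add: sum_subtractf)
    have "(\<Sum>t\<in>T. w t *\<^sub>R gbar t) = fst Y" unfolding T(5)[symmetric] by (simp add: fst_sum)
    then show "(\<Sum>t\<in>nodes s. (w' t - mass s t) *\<^sub>R gbar t) = 0"
      using w'sum[of gbar] sum_mass[OF fin, of s gbar] Y(2)
      by (simp add: sum_subtractf scaleR_diff_left rep_def fst_sum)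
  qed
  then have "(\<Sum>t\<in>nodes s. w' t *\<^sub>R \<gamma> t) = (\<Sum>t\<in>nodes s. mass s t *\<^sub>R \<gamma> t)"
    by (intro sum.cong) auto
  then show "Y = rep s" using w'sum[of \<gamma>] T(5) sum_mass[OF fin, of s \<gamma>] by (simp add: rep_def)
qed

text \<open>
  In the open domain the nodes count exactly \<open>n + 1\<close>: the nonnegative generalised polynomial that
  vanishes at them involves the last coordinate, with a sign decided by the presence of \<open>b\<close>.
\<close>

lemma interior_certificate:
  assumes s: "s \<in> open_dom"
  shows "\<exists>c. (0 < c (CARD('n) + 1) \<longleftrightarrow> b \<notin> set e) \<and> c (CARD('n) + 1) \<noteq> 0 \<and>
    (\<forall>t\<in>{a..b}. 0 \<le> gpoly (CARD('n) + 1) c 0 t \<and> (gpoly (CARD('n) + 1) c 0 t = 0 \<longleftrightarrow> t \<in> nodes s))"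
proof -
  note N = open_dom_nodes[OF s]
  have "card (node s ` {length e..p}) = q"
    using N(1) q_eq by (subst card_image) (auto intro: inj_on_subset)
  moreover have "card (set e) = length e" using ends(2) by (rule distinct_card)
  moreover have "node s ` {length e..p} \<subseteq> {a<..<b}" using N(2) by blast
  ultimately have "\<exists>c. c (CARD('n) + 1) \<noteq> 0 \<and> (0 < c (CARD('n) + 1) \<longleftrightarrow> b \<notin> set e) \<and>
    (\<forall>t\<in>{a..b}. 0 \<le> gpoly (CARD('n) + 1) c 0 t \<and>
      (gpoly (CARD('n) + 1) c 0 t = 0 \<longleftrightarrow> t \<in> node s ` {length e..p} \<union> set e))"
    using ends(1) q_eq by (intro nonneg_gpoly) auto
  then show ?thesis unfolding N(4)[symmetric] by blast
qed

text \<open>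
  The polynomial of \<open>interior_certificate\<close> is a nonvertical hyperplane that supports \<open>C\<close> at the point,
  from above if \<open>b\<close> is a node and from below otherwise.
\<close>

theorem interior_extremal:
  assumes s: "s \<in> open_dom" and Y: "Y \<in> C" "fst Y = fst (rep s)"
  shows "b \<in> set e \<Longrightarrow> snd Y \<le> snd (rep s)" "b \<notin> set e \<Longrightarrow> snd (rep s) \<le> snd Y"
proof -
  let ?m = "CARD('n) + 1"
  obtain c where c: "0 < c ?m \<longleftrightarrow> b \<notin> set e" "c ?m \<noteq> 0" "\<And>t. t \<in> {a..b} \<Longrightarrow> 0 \<le> gpoly ?m c 0 t"
    "\<And>t. t \<in> {a..b} \<Longrightarrow> gpoly ?m c 0 t = 0 \<longleftrightarrow> t \<in> nodes s"
    using interior_certificate[OF s] by blast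
  have d: "s \<in> Dom" using s open_dom_subset by blast
  have aff: "affine_form ?m c Z = c 0 + (\<Sum>i=1..CARD('n). c i * coord (fst Z) i) + c ?m * snd Z"
    for Z :: "(real ^ 'n::{finite,linorder}) \<times> real"
    by (simp add: affine_form_def coord_ext_def)
  have "affine_form ?m c (rep s) = 0"
    using d node_in[OF d] c(4) by (intro affine_form_rep_zero) (auto simp: support_def)
  moreover have "0 \<le> affine_form ?m c Y" using affine_form_nonneg[OF c(3) Y(1)] .
  ultimately have "0 \<le> c ?m * (snd Y - snd (rep s))"
    using Y(2) unfolding aff by (simp add: right_diff_distrib)
  then show "b \<in> set e \<Longrightarrow> snd Y \<le> snd (rep s)" "b \<notin> set e \<Longrightarrow> snd (rep s) \<le> snd Y"
    using c(1,2) by (auto simp: zero_le_mult_iff)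
qed

text \<open>
  The supporting hyperplane meets the curve only at the nodes.
\<close>

lemma interior_touch:
  assumes s: "s \<in> open_dom" and T: "finite T" "T \<subseteq> {a..b}" "\<And>t. t \<in> T \<Longrightarrow> 0 \<le> w t" "sum w T = 1"
    and eq: "(\<Sum>t\<in>T. w t *\<^sub>R \<gamma> t) = rep s" and t: "t \<in> T" "0 < w t"
  shows "t \<in> nodes s"
proof -
  let ?m = "CARD('n) + 1"
  obtain c where c: "\<And>t. t \<in> {a..b} \<Longrightarrow> 0 \<le> gpoly ?m c 0 t"
    "\<And>t. t \<in> {a..b} \<Longrightarrow> gpoly ?m c 0 t = 0 \<longleftrightarrow> t \<in> nodes s"
    using interior_certificate[OF s] by blast
  have d: "s \<in> Dom" using s open_dom_subset by blast
  have "affine_form ?m c (rep s) = 0"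
    using d node_in[OF d] c(2) by (intro affine_form_rep_zero) (auto simp: support_def)
  then have "gpoly ?m c 0 t = 0" using support_in_zeros[OF T c(1) _ t] eq by simp
  then show ?thesis using c(2) T(2) t(1) by blast
qed

subsection \<open>The derivative and the diffeomorphism\<close>

definition dweight :: "real ^ 'n::{finite,linorder} \<Rightarrow> nat \<Rightarrow> real" where
  "dweight v i = (if i = 0 then - (\<Sum>j=1..p. coord v j) else coord v i)"

definition dnode :: "real ^ 'n::{finite,linorder} \<Rightarrow> nat \<Rightarrow> real" where
  "dnode v i = (if i < length e then 0 else coord v (p + (i - length e + 1)))"

text \<open>
  At the fixed end points the curve need not be differentiable; there \<open>dnode\<close> is \<open>0\<close>, so the value of
  \<open>nth_vderiv 1 \<gamma>\<close> has no effect.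
\<close>

definition Drep :: "real ^ 'n::{finite,linorder} \<Rightarrow> real ^ 'n::{finite,linorder} \<Rightarrow> (real ^ 'n::{finite,linorder}) \<times> real" where
  "Drep s v = (\<Sum>i\<le>p. (weight s i * dnode v i) *\<^sub>R nth_vderiv 1 \<gamma> (node s i) + dweight v i *\<^sub>R \<gamma> (node s i))"

lemma has_derivative_coord: "((\<lambda>s. coord s i) has_derivative (\<lambda>v. coord v i)) F"
  by (rule bounded_linear_imp_has_derivative[OF bounded_linear_coord])

lemma weight_has_derivative: "((\<lambda>s. weight s i) has_derivative (\<lambda>v. dweight v i)) (at s)"
proof (cases "i = 0")
  case True
  have "((\<lambda>s :: real ^ 'n::{finite,linorder}. 1 - (\<Sum>j=1..p. coord s j)) has_derivative (\<lambda>v. 0 - (\<Sum>j=1..p. coord v j))) (at s)"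
    by (intro has_derivative_diff has_derivative_sum has_derivative_const has_derivative_coord)
  then show ?thesis using True by (simp add: weight_def dweight_def)
qed (simp add: weight_def dweight_def has_derivative_coord)

lemma open_dom_node:
  assumes "s \<in> open_dom" "length e \<le> i" "i \<le> p"
  shows "node s i \<in> {a<..<b}"
  using open_dom_nodes(2)[OF assms(1)] assms(2,3) by auto

lemma curve_node_has_derivative:
  assumes "s \<in> open_dom" "i \<le> p"
  shows "((\<lambda>s. \<gamma> (node s i)) has_derivative (\<lambda>v. dnode v i *\<^sub>R nth_vderiv 1 \<gamma> (node s i))) (at s)"
proof (cases "i < length e")
  case True
  then show ?thesis by (simp add: node_def dnode_def)
next
  case False
  have "(\<gamma> has_derivative (\<lambda>h. h *\<^sub>R nth_vderiv 1 \<gamma> (node s i))) (at (node s i))"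
    using curve_deriv[OF open_dom_node[OF assms(1) _ assms(2)], of 0] False
    by (simp add: has_vector_derivative_def nth_vderiv_def)
  moreover have "((\<lambda>s. node s i) has_derivative (\<lambda>v. dnode v i)) (at s)"
    using False by (simp add: node_def dnode_def has_derivative_coord)
  ultimately show ?thesis using has_derivative_compose by blast
qed

lemma rep_has_derivative:
  assumes "s \<in> open_dom"
  shows "(rep has_derivative Drep s) (at s)"
proof -
  have "((\<lambda>s. \<Sum>i\<le>p. weight s i *\<^sub>R \<gamma> (node s i)) has_derivative
     (\<lambda>v. \<Sum>i\<le>p. weight s i *\<^sub>R (dnode v i *\<^sub>R nth_vderiv 1 \<gamma> (node s i)) + dweight v i *\<^sub>R \<gamma> (node s i))) (at s)"
    using assms by (intro has_derivative_sum has_derivative_scaleR weight_has_derivative curve_node_has_derivative) auto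
  then show ?thesis by (simp add: rep_def[abs_def] Drep_def[abs_def])
qed

lemma continuous_weight: "continuous_on S (\<lambda>s. weight s i)"
  unfolding weight_def by (cases "i = 0") (auto intro!: continuous_intros)

lemma Drep_continuous: "continuous_on open_dom (\<lambda>s. Drep s v)"
  unfolding Drep_def
proof (intro continuous_on_sum continuous_on_add)
  fix i assume i: "i \<in> {..p}"
  have "continuous_on open_dom (\<lambda>s. \<gamma> (node s i))"
    using i by (intro continuous_at_imp_continuous_on ballI
        has_derivative_continuous[OF curve_node_has_derivative]) auto
  then show "continuous_on open_dom (\<lambda>s. dweight v i *\<^sub>R \<gamma> (node s i))" by (intro continuous_intros)
  show "continuous_on open_dom (\<lambda>s. (weight s i * dnode v i) *\<^sub>R nth_vderiv 1 \<gamma> (node s i))"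
  proof (cases "i < length e")
    case True
    then show ?thesis by (simp add: dnode_def)
  next
    case False
    have "continuous_on {a<..<b} (nth_vderiv 1 \<gamma>)" using smooth by (simp add: Ck_curve_on_def)
    moreover have "continuous_on open_dom (\<lambda>s. node s i)"
      using False by (simp add: node_def continuous_intros)
    moreover have "(\<lambda>s. node s i) ` open_dom \<subseteq> {a<..<b}"
      using False i open_dom_node[of _ i] by auto
    ultimately have "continuous_on open_dom (\<lambda>s. nth_vderiv 1 \<gamma> (node s i))"
      by (rule continuous_on_compose2)
    then show ?thesis by (intro continuous_intros continuous_weight)
  qed
qed

lemma sum_dweight: "(\<Sum>i\<le>p. dweight v i) = 0"
proof -
  have "(\<Sum>i\<le>p. dweight v i) = dweight v 0 + (\<Sum>i=1..p. dweight v i)"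
    by (simp add: atMost_atLeast0 sum.atLeast_Suc_atMost)
  also have "(\<Sum>i=1..p. dweight v i) = (\<Sum>i=1..p. coord v i)"
    by (intro sum.cong) (auto simp: dweight_def)
  finally show ?thesis by (simp add: dweight_def)
qed

text \<open>
  The derivative of the map acts on generalised polynomials like a functional that combines values and
  first derivatives at the nodes.
\<close>

lemma gpoly_Drep:
  assumes "fst (Drep s v) = 0"
  shows "(\<Sum>i\<le>p. weight s i * dnode v i * gpoly CARD('n) c 1 (node s i)) +
     (\<Sum>i\<le>p. dweight v i * gpoly CARD('n) c 0 (node s i)) = 0"
proof -
  let ?n = "CARD('n)"
  let ?A = "\<Sum>i\<le>p. (weight s i * dnode v i) *\<^sub>R nth_vderiv 1 \<gamma> (node s i)"
  let ?B = "\<Sum>i\<le>p. dweight v i *\<^sub>R \<gamma> (node s i)"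
  have B: "(\<Sum>i\<le>p. dweight v i * gpoly ?n c 0 (node s i)) = (\<Sum>k=1..?n. c k * coord_ext ?B k)"
    unfolding gpoly_eq_affine_form affine_form_sum sum_dweight by simp
  have g1: "gpoly ?n c 1 t = affine_form ?n (c(0 := 0)) (nth_vderiv 1 \<gamma> t)" for t
  proof -
    have "(\<Sum>i\<le>?n. c i * basis_deriv i 1 t) = (\<Sum>i=1..?n. c i * basis_deriv i 1 t)"
      by (simp add: atMost_atLeast0 sum.atLeast_Suc_atMost basis_deriv_def)
    then show ?thesis by (simp add: gpoly_def affine_form_def basis_deriv_def)
  qed
  have A: "(\<Sum>i\<le>p. weight s i * dnode v i * gpoly ?n c 1 (node s i)) = (\<Sum>k=1..?n. c k * coord_ext ?A k)"
    unfolding g1 affine_form_sum by simp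
  have "(\<Sum>k=1..?n. c k * coord_ext ?A k) + (\<Sum>k=1..?n. c k * coord_ext ?B k) = (\<Sum>k=1..?n. c k * coord_ext (?A + ?B) k)"
    by (simp add: coord_ext_fst sum.distrib distrib_left)
  also have "?A + ?B = Drep s v" by (simp add: Drep_def sum.distrib)
  also have "(\<Sum>k=1..?n. c k * coord_ext (Drep s v) k) = 0" using assms by (simp add: coord_ext_fst)
  finally show ?thesis unfolding A B .
qed

text \<open>
  A kernel vector gives a relation between the values at all nodes and the first derivatives at the free
  nodes, \<open>n + 1\<close> functionals in total. Testing it with a polynomial of order \<open>n\<close> on which all of them
  vanish except the derivative at one free node removes the velocity of this node; what is left is a
  relation between values, excluded by independence of the nodes.
\<close>

lemma Drep_injective:
  assumes s: "s \<in> open_dom" and zero: "fst (Drep s v) = 0"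
  shows "v = 0"
proof -
  let ?n = "CARD('n)" and ?X = "node s ` {length e..p}"
  note N = open_dom_nodes[OF s]
  have d: "s \<in> Dom" using s open_dom_subset by blast
  have nab: "nodes s \<subseteq> {a..b}" using node_in[OF d] by auto
  have X: "?X \<subseteq> nodes s" "?X \<subseteq> {a<..<b}" "card ?X = q"
  proof -
    show "?X \<subseteq> nodes s" "?X \<subseteq> {a<..<b}" using N(2) by blast+
    have "inj_on (node s) {length e..p}" using N(1) by (rule inj_on_subset) auto
    then show "card ?X = q" using q_eq by (simp add: card_image)
  qed
  have cn: "card (nodes s) = p + 1" using N(1) by (simp add: card_image)
  have dn: "dnode v j = 0" if j: "j \<le> p" for j
  proof (cases "j < length e")
    case False
    then have jX: "node s j \<in> ?X" using j by auto
    \<comment> \<open>All nodes simple and all other free nodes double make \<open>n\<close> zeros, so the last derivative is nonzero.\<close>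
    define S where "S = nodes s \<times> {0} \<union> (?X - {node s j}) \<times> {1::nat}"
    have "finite S" by (simp add: S_def)
    have "card S \<le> card (nodes s \<times> {0::nat}) + card ((?X - {node s j}) \<times> {1::nat})"
      unfolding S_def by (rule card_Un_le)
    also have "\<dots> = p + 1 + (q - 1)" using cn X(3) jX by (simp add: card_cartesian_product)
    also have "\<dots> = ?n" using pq False j by simp
    finally obtain c where c: "\<exists>i\<le>?n. c i \<noteq> 0" and "\<forall>(z, j)\<in>S. gpoly ?n c j z = 0"
      using gpoly_interpolation[OF \<open>finite S\<close>] by blast
    then have S: "gpoly ?n c i z = 0" if "(z, i) \<in> S" for z i using that by blast
    have c0: "gpoly ?n c 0 (node s i) = 0" if "i \<le> p" for i
      using that by (intro S) (simp add: S_def)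
    have c1: "gpoly ?n c 1 (node s i) = 0" if "i \<le> p" "length e \<le> i" "i \<noteq> j" for i
    proof -
      have "node s i \<noteq> node s j" using inj_on_eq_iff[OF N(1)] that j by simp
      then show ?thesis using that by (intro S) (simp add: S_def)
    qed
    have c1j: "gpoly ?n c 1 (node s j) \<noteq> 0"
    proof
      assume 0: "gpoly ?n c 1 (node s j) = 0"
      define k where "k = (\<lambda>z. if z \<in> ?X then 2 else 1 :: nat)"
      have "sum k (nodes s) = sum k ?X + sum k (nodes s - ?X)"
        using sum.subset_diff[OF X(1), of k] by simp
      also have "sum k ?X = 2 * q" using X(3) by (simp add: k_def)
      also have "sum k (nodes s - ?X) = card (nodes s - ?X)" by (simp add: k_def)
      also have "card (nodes s - ?X) = p + 1 - q" using X cn by (simp add: card_Diff_subset)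
      finally have sumk: "sum k (nodes s) = ?n + 1" using pq q_eq by simp
      have van: "gpoly ?n c i z = 0" if z: "z \<in> nodes s" "i < k z" for z i
      proof -
        obtain l where l: "l \<le> p" "z = node s l" using z(1) by auto
        show ?thesis
        proof (cases "i = 0")
          case False
          then have i: "i = 1" "z \<in> ?X" using z(2) by (auto simp: k_def split: if_splits)
          then obtain l' where "length e \<le> l'" "l' \<le> p" "z = node s l'" by auto
          then show ?thesis using 0 c1[of l'] i by (cases "l' = j") auto
        qed (use c0 l in auto)
      qed
      have "sum k (nodes s) = ?n"
        using X(2) sumk by (intro gpoly_zero_count(1)[OF _ _ nab _ _ van _ c]) (auto simp: k_def)
      then show False using sumk by simp
    qed
    have "(\<Sum>i\<le>p. weight s i * dnode v i * gpoly ?n c 1 (node s i)) = 0"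
      using gpoly_Drep[OF zero, of c] c0 by simp
    moreover have "(\<Sum>i\<le>p. weight s i * dnode v i * gpoly ?n c 1 (node s i))
        = weight s j * dnode v j * gpoly ?n c 1 (node s j)"
    proof -
      have "weight s i * dnode v i * gpoly ?n c 1 (node s i) = 0" if "i \<in> {..p} - {j}" for i
        using that c1[of i] by (cases "i < length e") (auto simp: dnode_def)
      then have "(\<Sum>i\<in>{..p} - {j}. weight s i * dnode v i * gpoly ?n c 1 (node s i)) = 0"
        by (intro sum.neutral) blast
      then show ?thesis using j by (subst sum.remove[of _ j]) auto
    qed
    ultimately show ?thesis using c1j open_domD(1)[OF s j] by simp
  qed (simp add: dnode_def)
  define ii where "ii = inv_into {..p} (node s)"
  have ii: "ii (node s i) = i" if "i \<le> p" for i unfolding ii_def using N(1) that by simp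
  have red: "(\<Sum>t\<in>nodes s. dweight v (ii t) *\<^sub>R f t) = (\<Sum>i\<le>p. dweight v i *\<^sub>R f (node s i))"
    for f :: "real \<Rightarrow> 'x::real_vector"
    unfolding sum.reindex[OF N(1)] using ii by (intro sum.cong) auto
  have "dweight v (ii t) = 0" if t: "t \<in> nodes s" for t
  proof (rule nodes_independent[OF _ nab _ _ _ t])
    show "(\<Sum>t\<in>nodes s. dweight v (ii t)) = 0" using red[of "\<lambda>_. 1 :: real"] by (simp add: sum_dweight)
    have "fst (Drep s v) = (\<Sum>i\<le>p. dweight v i *\<^sub>R gbar (node s i))"
      using dn by (simp add: Drep_def fst_sum)
    then show "(\<Sum>t\<in>nodes s. dweight v (ii t) *\<^sub>R gbar t) = 0" using red[of gbar] zero by simp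
  qed (use card_nodes in auto)
  then have dw: "dweight v i = 0" if "i \<le> p" for i using ii[OF that] that by force
  show "v = 0"
  proof (rule coord_eqI)
    fix i assume i: "i \<in> {1..CARD('n)}"
    show "coord v i = coord 0 i"
    proof (cases "i \<le> p")
      case True
      then show ?thesis using dw[of i] i by (simp add: dweight_def)
    next
      case False
      let ?l = "length e + (i - p) - 1"
      have "?l \<le> p" "\<not> ?l < length e" "p + (?l - length e + 1) = i" using False i pq by auto
      then show ?thesis using dn[of ?l] by (simp add: dnode_def)
    qed
  qed
qed

abbreviation "repbar s \<equiv> fst (rep s)"

lemma C1_rep: "C1_on rep open_dom"
  using rep_has_derivative Drep_continuous by (rule C1_onI)

lemma repbar_has_derivative:
  "s \<in> open_dom \<Longrightarrow> ((\<lambda>s. repbar s) has_derivative (\<lambda>v. fst (Drep s v))) (at s)"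
  by (rule has_derivative_fst[OF rep_has_derivative])

lemma
  shows open_image: "open (repbar ` open_dom)"
    and C1_inverse: "C1_on (inv_into open_dom (\<lambda>s. repbar s)) (repbar ` open_dom)"
  using C1_on_inverse[OF open_open_dom inj_on_rep repbar_has_derivative _ Drep_injective]
    continuous_on_fst[OF Drep_continuous] by auto

lemma rep_continuous: "continuous_on Dom rep"
proof -
  have node: "continuous_on Dom (\<lambda>s. node s i)" for i
    unfolding node_def by (cases "i < length e") (auto intro!: continuous_intros)
  have "continuous_on Dom (\<lambda>s. \<gamma> (node s i))" if "i \<le> p" for i
    using node_in that by (intro continuous_on_compose2[OF continuous_curve node]) auto
  then show ?thesis unfolding rep_def[abs_def] by (intro continuous_intros continuous_weight) auto
qed

text \<open>
  The image of the open domain is open in the interior of \<open>K\<close>. It is also relatively closed there,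
  being the trace of the compact image of the whole domain, since the rest of the domain goes to the
  frontier. The interior of \<open>K\<close> is connected.
\<close>

theorem image_open_dom: "repbar ` open_dom = interior K"
proof -
  let ?A = "repbar ` open_dom" and ?D = "repbar ` Dom"
  have sub: "?A \<subseteq> interior K"
    using rep_in_K open_dom_subset by (intro interior_maximal open_image) auto
  have inter: "interior K \<inter> ?D \<subseteq> ?A"
  proof
    fix y assume y: "y \<in> interior K \<inter> ?D"
    then obtain s where s: "s \<in> Dom" "y = repbar s" by auto
    have "s \<in> open_dom"
    proof (rule ccontr)
      assume "s \<notin> open_dom"
      then have "y \<in> frontier K" using boundary_unique(1)[of s] s by auto
      then show False using y by (simp add: frontier_def)
    qed
    then show "y \<in> ?A" using s by blast
  qed
  have "compact ?D" using compact_dom rep_continuous by (intro compact_continuous_image continuous_on_fst)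
  then have "open (- ?D)" by (simp add: compact_imp_closed open_Compl)
  moreover have "connected (interior K)" by (intro convex_connected convex_interior convex_convex_hull)
  moreover have "interior K \<subseteq> ?A \<union> (- ?D)" using inter by auto
  moreover have "?A \<inter> (- ?D) \<inter> interior K = {}" using open_dom_subset by auto
  ultimately have "?A \<inter> interior K = {} \<or> (- ?D) \<inter> interior K = {}"
    using connectedD[of "interior K" ?A "- ?D"] open_image by blast
  moreover have "?A \<inter> interior K \<noteq> {}" using sub open_dom_nonempty by auto
  ultimately have "(- ?D) \<inter> interior K = {}" by blast
  then show ?thesis using sub inter by blast
qed

theorem image_dom: "repbar ` Dom = K"
proof
  show "repbar ` Dom \<subseteq> K" using rep_in_K by auto
  have "interior K \<noteq> {}" using image_open_dom open_dom_nonempty by auto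
  then have "closure (interior K) = closure K" by (intro convex_closure_interior convex_convex_hull)
  then have "K \<subseteq> closure (interior K)" using closure_subset by metis
  also have "closure (interior K) \<subseteq> repbar ` Dom"
  proof (rule closure_minimal)
    show "interior K \<subseteq> repbar ` Dom" using image_open_dom open_dom_subset by auto
    show "closed (repbar ` Dom)"
      using compact_dom rep_continuous by (intro compact_imp_closed compact_continuous_image continuous_on_fst)
  qed
  finally show "K \<subseteq> repbar ` Dom" .
qed

theorem image_frontier: "repbar ` frontier Dom = frontier K"
proof
  show "repbar ` frontier Dom \<subseteq> frontier K" unfolding frontier_dom using boundary_unique(1) by auto
  show "frontier K \<subseteq> repbar ` frontier Dom"
  proof
    fix y assume y: "y \<in> frontier K"
    then have "y \<in> K" using compact_K frontier_subset_closed compact_imp_closed by blast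
    then obtain s where s: "s \<in> Dom" "y = repbar s" using image_dom by auto
    have "s \<notin> open_dom"
    proof
      assume "s \<in> open_dom"
      then have "y \<in> interior K" using s image_open_dom by auto
      then show False using y by (simp add: frontier_def)
    qed
    then show "y \<in> repbar ` frontier Dom" using s by (simp add: frontier_dom)
  qed
qed

theorem diffeo: "C1_diffeo (\<lambda>s. repbar s) (interior Dom) (interior K)"
  unfolding C1_diffeo_def interior_dom
proof (intro conjI)
  show "bij_betw (\<lambda>s. repbar s) open_dom (interior K)"
    using inj_on_rep image_open_dom by (simp add: bij_betw_def)
  show "C1_on (\<lambda>s. repbar s) open_dom"
    by (rule C1_on_compose[OF C1_rep C1_on_bounded_linear[OF bounded_linear_fst] subset_UNIV])
  show "C1_on (inv_into open_dom (\<lambda>s. repbar s)) (interior K)"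
    using C1_inverse image_open_dom by simp
qed

subsection \<open>The boundary function\<close>

definition B :: "real ^ 'n::{finite,linorder} \<Rightarrow> real" where
  "B = graph_fun rep Dom"

lemma well_defined: "well_defined_graph rep Dom"
  unfolding well_defined_graph_def using same_mass(2) by metis

lemma B_rep: "s \<in> Dom \<Longrightarrow> B (repbar s) = snd (rep s)"
  unfolding B_def graph_fun_def
  using same_mass(2) by (intro the_equality) (blast, metis)

lemma graph_B: "(\<lambda>x. (x, B x)) ` K = rep ` Dom"
proof -
  have "(\<lambda>x. (x, B x)) ` K = (\<lambda>s. (repbar s, B (repbar s))) ` Dom"
    unfolding image_dom[symmetric] by (simp add: image_image)
  also have "\<dots> = rep ` Dom" by (intro image_cong) (auto simp: B_rep)
  finally show ?thesis .
qed

lemma B_in_C: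
  assumes "x \<in> K"
  shows "(x, B x) \<in> C"
proof -
  have "(x, B x) \<in> rep ` Dom" unfolding graph_B[symmetric] using assms by (rule imageI)
  then show ?thesis using rep_in_C by auto
qed

text \<open>
  The graph is the image of the compact parameter domain, hence closed, and \<open>B\<close> is bounded.
\<close>

theorem continuous_B: "continuous_on K B"
proof (rule continuous_from_closed_graph)
  have c: "compact (rep ` Dom)" using compact_dom rep_continuous by (intro compact_continuous_image)
  show "compact (snd ` rep ` Dom)" using c by (rule compact_continuous_image[OF continuous_on_snd[OF continuous_on_id]])
  show "closed ((\<lambda>x. (x, B x)) ` K)" unfolding graph_B using c by (rule compact_imp_closed)
  show "B \<in> K \<rightarrow> snd ` rep ` Dom" unfolding graph_B[symmetric] by (auto simp: image_image)
qed

theorem C1_B: "C1_on B (interior K)"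
proof (rule C1_on_cong_open[OF _ open_interior])
  let ?g = "inv_into open_dom (\<lambda>s. repbar s)"
  have g: "?g y \<in> open_dom" "repbar (?g y) = y" if "y \<in> interior K" for y
    using that unfolding image_open_dom[symmetric]
    by (rule inv_into_into, rule f_inv_into_f[of y "\<lambda>s. repbar s"])
  have "C1_on (\<lambda>y. rep (?g y)) (interior K)"
    using g C1_inverse image_open_dom by (intro C1_on_compose[OF _ C1_rep]) auto
  then show "C1_on (\<lambda>y. snd (rep (?g y))) (interior K)"
    by (rule C1_on_compose[OF _ C1_on_bounded_linear[OF bounded_linear_snd] subset_UNIV])
  show "snd (rep (?g y)) = B y" if "y \<in> interior K" for y
    using B_rep[of "?g y"] g[OF that] open_dom_subset by auto
qed

theorem B_boundary:
  assumes "Y \<in> C" "fst Y \<in> frontier K"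
  shows "snd Y = B (fst Y)"
proof -
  obtain s where s: "s \<in> frontier Dom" "fst Y = repbar s" using assms(2) image_frontier by auto
  then have "Y = rep s" using boundary_unique(2)[of s Y] assms(1) by (simp add: frontier_dom)
  then show ?thesis using B_rep[of s] s by (simp add: frontier_dom)
qed

text \<open>
  So \<open>B\<close> is the upper or the lower boundary function of \<open>C\<close>: over the interior by the supporting
  hyperplanes, over the frontier because \<open>C\<close> has a single point there.
\<close>

theorem B_extremal:
  assumes "Y \<in> C"
  shows "b \<in> set e \<Longrightarrow> snd Y \<le> B (fst Y)" "b \<notin> set e \<Longrightarrow> B (fst Y) \<le> snd Y"
proof -
  have "(b \<in> set e \<longrightarrow> snd Y \<le> B (fst Y)) \<and> (b \<notin> set e \<longrightarrow> B (fst Y) \<le> snd Y)"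
  proof (cases "fst Y \<in> frontier K")
    case True
    then show ?thesis using B_boundary[OF assms] by simp
  next
    case False
    then have "fst Y \<in> interior K" using fst_hull[OF assms] compact_K by (simp add: frontier_def compact_imp_closed)
    then obtain s where s: "s \<in> open_dom" "fst Y = repbar s" using image_open_dom by auto
    then show ?thesis
      using interior_extremal[OF s(1) assms s(2)] B_rep[of s] open_dom_subset by auto
  qed
  then show "b \<in> set e \<Longrightarrow> snd Y \<le> B (fst Y)" "b \<notin> set e \<Longrightarrow> B (fst Y) \<le> snd Y" by auto
qed

subsection \<open>The four maps\<close>

lemma rep_one_endpoint:
  assumes "e = [x]"
  shows "rep s = (1 - (\<Sum>j=1..p. coord s j)) *\<^sub>R \<gamma> x + (\<Sum>i=1..p. coord s i *\<^sub>R \<gamma> (coord s (p + i)))"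
proof -
  have "rep s = weight s 0 *\<^sub>R \<gamma> (node s 0) + (\<Sum>i=1..p. weight s i *\<^sub>R \<gamma> (node s i))"
    by (simp add: rep_def atMost_atLeast0 sum.atLeast_Suc_atMost)
  also have "(\<Sum>i=1..p. weight s i *\<^sub>R \<gamma> (node s i)) = (\<Sum>i=1..p. coord s i *\<^sub>R \<gamma> (coord s (p + i)))"
  proof (intro sum.cong refl)
    fix i assume "i \<in> {1..p}"
    then have "i \<noteq> 0" "\<not> i < length e" "i - length e + 1 = i" using assms by auto
    then show "weight s i *\<^sub>R \<gamma> (node s i) = coord s i *\<^sub>R \<gamma> (coord s (p + i))"
      unfolding weight_def node_def by simp
  qed
  also have "weight s 0 *\<^sub>R \<gamma> (node s 0) = (1 - (\<Sum>j=1..p. coord s j)) *\<^sub>R \<gamma> x"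
    unfolding weight_def node_def using assms by simp
  finally show ?thesis .
qed

lemma U_even_rep:
  assumes "e = [b]"
  shows "rep = U_map a b \<gamma>" "Dom = U_dom a b"
proof -
  have q: "q = p" "CARD('n) = 2 * p" using assms pq by auto
  show "Dom = U_dom a b" by (simp add: U_dom_def q)
  show "rep = U_map a b \<gamma>"
    unfolding U_map_def using q rep_one_endpoint[OF assms] by (simp add: fun_eq_iff U_even_def Let_def)
qed

lemma L_even_rep:
  assumes "e = [a]"
  shows "rep = L_map a b \<gamma>" "Dom = L_dom a b"
proof -
  have q: "q = p" "CARD('n) = 2 * p" using assms pq by auto
  show "Dom = L_dom a b" by (simp add: L_dom_def q)
  show "rep = L_map a b \<gamma>"
    unfolding L_map_def using q rep_one_endpoint[OF assms] by (simp add: fun_eq_iff L_even_def Let_def)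
qed

lemma U_odd_rep:
  assumes "e = [a, b]"
  shows "rep = U_map a b \<gamma>" "Dom = U_dom a b"
proof -
  have q: "p = Suc q" "CARD('n) = Suc (2 * q)" using assms pq by auto
  have l: "(CARD('n) + 1) div 2 = p" "odd CARD('n)" using q by auto
  show "Dom = U_dom a b" unfolding U_dom_def using q(1) l by simp
  show "rep = U_map a b \<gamma>"
  proof
    fix s
    have "rep s = weight s 0 *\<^sub>R \<gamma> (node s 0) + (weight s 1 *\<^sub>R \<gamma> (node s 1) + (\<Sum>i=2..p. weight s i *\<^sub>R \<gamma> (node s i)))"
    proof -
      have "{..p} = insert 0 (insert 1 {2..p})" using q(1) by auto
      then show ?thesis unfolding rep_def by (simp del: One_nat_def)
    qed
    also have "(\<Sum>i=2..p. weight s i *\<^sub>R \<gamma> (node s i)) = (\<Sum>i=2..p. coord s i *\<^sub>R \<gamma> (coord s (p + (i - 1))))"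
    proof (intro sum.cong refl)
      fix i assume "i \<in> {2..p}"
      then have "i \<noteq> 0" "\<not> i < length e" "i - length e + 1 = i - 1" using assms by auto
      then show "weight s i *\<^sub>R \<gamma> (node s i) = coord s i *\<^sub>R \<gamma> (coord s (p + (i - 1)))"
        unfolding weight_def node_def by simp
    qed
    also have "weight s 0 *\<^sub>R \<gamma> (node s 0) = (1 - (\<Sum>j=1..p. coord s j)) *\<^sub>R \<gamma> a"
      unfolding weight_def node_def using assms by simp
    also have "weight s 1 *\<^sub>R \<gamma> (node s 1) = coord s 1 *\<^sub>R \<gamma> b"
      unfolding weight_def node_def using assms by simp
    finally show "rep s = U_map a b \<gamma> s"
      unfolding U_map_def using l by (simp add: U_odd_def Let_def)
  qed
qed

lemma L_odd_rep:
  assumes "e = []"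
  shows "rep = L_map a b \<gamma>" "Dom = L_dom a b"
proof -
  have q: "q = Suc p" "CARD('n) = Suc (2 * p)" using assms pq by auto
  have l: "(CARD('n) + 1) div 2 = Suc p" "odd CARD('n)" using q by auto
  show "Dom = L_dom a b" unfolding L_dom_def using l q(1) by simp
  show "rep = L_map a b \<gamma>"
  proof
    fix s
    have sh: "(\<Sum>j=2..Suc p. f (j - 1)) = (\<Sum>i=1..p. f i)" for f :: "nat \<Rightarrow> 'x::comm_monoid_add"
      using sum.shift_bounds_cl_Suc_ivl[of "\<lambda>j. f (j - 1)" 1 p] by (simp add: numeral_2_eq_2)
    have "rep s = weight s 0 *\<^sub>R \<gamma> (node s 0) + (\<Sum>i=1..p. weight s i *\<^sub>R \<gamma> (node s i))"
      by (simp add: rep_def atMost_atLeast0 sum.atLeast_Suc_atMost)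
    also have "(\<Sum>i=1..p. weight s i *\<^sub>R \<gamma> (node s i)) = (\<Sum>j=2..Suc p. weight s (j - 1) *\<^sub>R \<gamma> (node s (j - 1)))"
      by (rule sh[symmetric])
    also have "\<dots> = (\<Sum>j=2..Suc p. coord s (j - 1) *\<^sub>R \<gamma> (coord s (p + j)))"
    proof (intro sum.cong refl)
      fix i assume "i \<in> {2..Suc p}"
      then have "i - 1 \<noteq> 0" "\<not> i - 1 < length e" "i - 1 - length e + 1 = i" using assms by auto
      then show "weight s (i - 1) *\<^sub>R \<gamma> (node s (i - 1)) = coord s (i - 1) *\<^sub>R \<gamma> (coord s (p + i))"
        unfolding weight_def node_def by simp
    qed
    also have "weight s 0 *\<^sub>R \<gamma> (node s 0) = (1 - (\<Sum>j=2..Suc p. coord s (j - 1))) *\<^sub>R \<gamma> (coord s (p + 1))"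
      unfolding sh weight_def node_def using assms by simp
    finally show "rep s = L_map a b \<gamma> s"
      unfolding L_map_def using l by (simp add: L_odd_def Let_def)
  qed
qed

subsection \<open>Values on the curve\<close>

text \<open>
  A single point of the interval has count \<open>1\<close> or \<open>2\<close>, so for \<open>n \<ge> 2\<close> some nonnegative generalised
  polynomial in the first \<open>n\<close> coordinates vanishes there. The curve thus projects into the frontier.
\<close>

lemma B_at_curve:
  assumes t: "t \<in> {a..b}" and n: "2 \<le> CARD('n)"
  shows "B (gbar t) = snd (\<gamma> t)"
proof -
  have C: "\<gamma> t \<in> C" using t by (intro hull_inc) auto
  define X where "X = {t} \<inter> {a<..<b}"
  define E where "E = {t} \<inter> {a, b}"
  define m where "m = 2 * card X + card E"
  have "(X = {t} \<and> E = {}) \<or> (X = {} \<and> E = {t})" using t unfolding X_def E_def by auto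
  then have m: "m \<in> {1, 2}" and tXE: "t \<in> X \<union> E" by (auto simp: m_def)
  have "finite X" "X \<subseteq> {a<..<b}" "E \<subseteq> {a, b}" by (auto simp: X_def E_def)
  moreover have "1 \<le> m" "m \<le> CARD('n) + 1" using m n by auto
  ultimately have "\<exists>c. c m \<noteq> 0 \<and> (0 < c m \<longleftrightarrow> b \<notin> E) \<and>
    (\<forall>t\<in>{a..b}. 0 \<le> gpoly m c 0 t \<and> (gpoly m c 0 t = 0 \<longleftrightarrow> t \<in> X \<union> E))"
    by (intro nonneg_gpoly) (auto simp: m_def)
  then obtain c where c: "c m \<noteq> 0" "\<And>s. s \<in> {a..b} \<Longrightarrow> 0 \<le> gpoly m c 0 s" "gpoly m c 0 t = 0"
    using t tXE by blast
  have "gbar t \<in> frontier K"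
    using supporting_zero_imp_frontier[of m c, OF _ _ c(1,2) C] m n c(3) by (auto simp: gpoly_eq_affine_form)
  then show ?thesis using B_boundary[OF C] by simp
qed

text \<open>
  Writing the point of the graph as a convex combination of curve points lets a convex function on \<open>K\<close> be
  compared with \<open>B\<close> through the values on the curve.
\<close>

lemma B_jensen:
  assumes "convex_on K g" "y \<in> K"
  shows "\<exists>w T. finite T \<and> T \<subseteq> {a..b} \<and> (\<forall>t\<in>T. 0 \<le> w t) \<and>
    B y = (\<Sum>t\<in>T. w t * snd (\<gamma> t)) \<and> g y \<le> (\<Sum>t\<in>T. w t * g (gbar t))"
proof -
  obtain T w where T: "finite T" "T \<subseteq> {a..b}" "\<forall>t\<in>T. 0 < w t" "sum w T = 1" "(\<Sum>t\<in>T. w t *\<^sub>R \<gamma> t) = (y, B y)"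
    using convex_hull_image_rep[OF B_in_C[OF assms(2)]] by blast
  have y: "y = (\<Sum>t\<in>T. w t *\<^sub>R gbar t)" using arg_cong[OF T(5), of fst] by (simp add: fst_sum)
  have By: "B y = (\<Sum>t\<in>T. w t * snd (\<gamma> t))" using arg_cong[OF T(5), of snd] by (simp add: snd_sum)
  have "g y \<le> (\<Sum>t\<in>T. w t * g (gbar t))" unfolding y
    using T by (intro convex_on_sum[OF _ _ assms(1)]) (auto intro: less_imp_le hull_inc)
  then show ?thesis using T By by (intro exI[of _ w] exI[of _ T]) (auto intro: less_imp_le)
qed

end

section \<open>Upper and lower boundary together\<close>

text \<open>
  An upper and a lower representation of the same curve; only the membership of \<open>b\<close> distinguishes them.
\<close>

locale upper_lower = U: principal_rep a b \<gamma> eU pU qU + L: principal_rep a b \<gamma> eL pL qL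
  for a b :: real and \<gamma> :: "real \<Rightarrow> (real ^ 'n::{finite,linorder}) \<times> real"
    and eU :: "real list" and pU qU :: nat and eL :: "real list" and pL qL :: nat +
  assumes bU: "b \<in> set eU" and bL: "b \<notin> set eL"
begin

lemma between: "Y \<in> U.C \<longleftrightarrow> fst Y \<in> U.K \<and> L.B (fst Y) \<le> snd Y \<and> snd Y \<le> U.B (fst Y)"
proof
  assume "Y \<in> U.C"
  then show "fst Y \<in> U.K \<and> L.B (fst Y) \<le> snd Y \<and> snd Y \<le> U.B (fst Y)"
    using U.fst_hull L.B_extremal(2)[OF _ bL] U.B_extremal(1)[OF _ bU] by blast
next
  assume Y: "fst Y \<in> U.K \<and> L.B (fst Y) \<le> snd Y \<and> snd Y \<le> U.B (fst Y)"
  let ?l = "L.B (fst Y)" and ?u = "U.B (fst Y)"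
  have "snd Y \<in> closed_segment ?l ?u" using Y by (simp add: closed_segment_eq_real_ivl)
  then obtain r where r: "0 \<le> r" "r \<le> 1" "snd Y = (1 - r) * ?l + r * ?u"
    by (auto simp: closed_segment_def)
  have "(1 - r) *\<^sub>R (fst Y, ?l) + r *\<^sub>R (fst Y, ?u) \<in> U.C"
    using Y r L.B_in_C U.B_in_C by (intro convexD[OF convex_convex_hull]) auto
  also have "(1 - r) *\<^sub>R (fst Y, ?l) + r *\<^sub>R (fst Y, ?u) = Y"
    using r(3) by (simp add: prod_eq_iff scaleR_left.add[symmetric])
  finally show "Y \<in> U.C" .
qed

text \<open>
  The upper boundary function of a convex set is concave.
\<close>

lemma concave_BU: "concave_on U.K U.B"
  unfolding concave_on_iff
proof (intro conjI ballI allI impI)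
  show "convex U.K" by (rule convex_convex_hull)
  fix x y and u v :: real
  assume "x \<in> U.K" "y \<in> U.K" and uv: "0 \<le> u" "0 \<le> v" "u + v = 1"
  then have "u *\<^sub>R (x, U.B x) + v *\<^sub>R (y, U.B y) \<in> U.C"
    using U.B_in_C by (intro convexD[OF convex_convex_hull]) auto
  then show "u * U.B x + v * U.B y \<le> U.B (u *\<^sub>R x + v *\<^sub>R y)"
    using U.B_extremal(1)[OF _ bU] by fastforce
qed

lemma convex_BL: "convex_on U.K L.B"
proof (rule convex_onI)
  show "convex U.K" by (rule convex_convex_hull)
  fix r :: real and x y assume "0 < r" "r < 1" "x \<in> U.K" "y \<in> U.K"
  then have "(1 - r) *\<^sub>R (x, L.B x) + r *\<^sub>R (y, L.B y) \<in> U.C"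
    using L.B_in_C by (intro convexD[OF convex_convex_hull]) auto
  then show "L.B ((1 - r) *\<^sub>R x + r *\<^sub>R y) \<le> (1 - r) * L.B x + r * L.B y"
    using L.B_extremal(2)[OF _ bL] by fastforce
qed

lemma curve_in_C: "t \<in> {a..b} \<Longrightarrow> \<gamma> t \<in> U.C"
  by (intro hull_inc) auto

theorem minimal_BU:
  "minimal_concave U.K (\<lambda>g. \<forall>t\<in>{a..b}. if CARD('n) = 1 then g (fst (\<gamma> t)) \<ge> snd (\<gamma> t)
     else g (fst (\<gamma> t)) = snd (\<gamma> t)) U.B"
  unfolding minimal_concave_def
proof (intro conjI concave_BU allI impI ballI)
  fix t assume t: "t \<in> {a..b}"
  have "2 \<le> CARD('n)" if "CARD('n) \<noteq> 1" using that zero_less_card_finite[where 'a='n] by linarith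
  then show "if CARD('n) = 1 then snd (\<gamma> t) \<le> U.B (fst (\<gamma> t)) else U.B (fst (\<gamma> t)) = snd (\<gamma> t)"
    using U.B_at_curve[OF t] U.B_extremal(1)[OF curve_in_C[OF t] bU] by auto
next
  fix g y
  assume g: "concave_on U.K g \<and> (\<forall>t\<in>{a..b}. if CARD('n) = 1 then snd (\<gamma> t) \<le> g (fst (\<gamma> t))
     else g (fst (\<gamma> t)) = snd (\<gamma> t))" and y: "y \<in> U.K"
  have conv: "convex_on U.K (\<lambda>x. - g x)" using g by (simp add: concave_on_def)
  have gt: "snd (\<gamma> t) \<le> g (fst (\<gamma> t))" if "t \<in> {a..b}" for t using g that by (auto split: if_splits)
  obtain w T where T: "finite T" "T \<subseteq> {a..b}" "\<forall>t\<in>T. 0 \<le> w t"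
    "U.B y = (\<Sum>t\<in>T. w t * snd (\<gamma> t))" "- g y \<le> (\<Sum>t\<in>T. w t * - g (fst (\<gamma> t)))"
    using U.B_jensen[OF conv y] by blast
  have "U.B y \<le> (\<Sum>t\<in>T. w t * g (fst (\<gamma> t)))"
    unfolding T(4) using T gt by (intro sum_mono mult_left_mono) auto
  then show "U.B y \<le> g y" using T(5) by (simp add: sum_negf)
qed

lemma BL_at_curve:
  assumes t: "t \<in> {a..b}"
  shows "L.B (fst (\<gamma> t)) = snd (\<gamma> t)"
proof (cases "CARD('n) = 1")
  case False
  then have "2 \<le> CARD('n)" using zero_less_card_finite[where 'a='n] by linarith
  then show ?thesis using L.B_at_curve[OF t] by simp
next
  case True
  \<comment> \<open>For \<open>n = 1\<close> the lower map is the curve itself: no end point, one free node, no free weight.\<close>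
  have p: "pL = 0" "eL = []" "qL = 1"
  proof -
    have "set eL \<subseteq> {a}" using L.ends(1) bL by blast
    then have "card (set eL) \<le> 1" using card_mono[of "{a}"] by fastforce
    then have "length eL \<le> 1" using distinct_card[OF L.ends(2)] by simp
    then have "length eL = 0" "pL = 0" "qL = 1" using L.pq True by arith+
    then show "pL = 0" "eL = []" "qL = 1" by simp_all
  qed
  define s :: "real ^ 'n::{finite,linorder}" where "s = (\<chi> k. t)"
  have s: "coord s i = t" for i by (simp add: s_def coord_def)
  have w: "L.weight s 0 = 1" unfolding L.weight_def using p by simp
  have nd: "L.node s 0 = t" unfolding L.node_def s by (simp add: p)
  have "s \<in> L.Dom" unfolding L.dom_iff s using t p w by simp
  moreover have "L.rep s = \<gamma> t" unfolding L.rep_def using p w nd by simp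
  ultimately show ?thesis using L.B_rep by metis
qed

theorem maximal_BL:
  "maximal_convex U.K (\<lambda>g. \<forall>t\<in>{a..b}. g (fst (\<gamma> t)) = snd (\<gamma> t)) L.B"
  unfolding maximal_convex_def
proof (intro conjI convex_BL allI impI ballI BL_at_curve)
  fix g y
  assume g: "convex_on U.K g \<and> (\<forall>t\<in>{a..b}. g (fst (\<gamma> t)) = snd (\<gamma> t))" and y: "y \<in> U.K"
  then obtain w T where T: "T \<subseteq> {a..b}"
    "L.B y = (\<Sum>t\<in>T. w t * snd (\<gamma> t))" "g y \<le> (\<Sum>t\<in>T. w t * g (fst (\<gamma> t)))"
    using L.B_jensen[of g y] by blast
  have "(\<Sum>t\<in>T. w t * g (fst (\<gamma> t))) = L.B y"
    unfolding T(2) using T(1) g by (intro sum.cong) auto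
  then show "g y \<le> L.B y" using T(3) by simp
qed

text \<open>
  Each node of the upper representation would be a node of the lower one, as the lower supporting
  hyperplane meets the curve only there. But \<open>b\<close> is a node of the upper representation only.
\<close>

lemma upper_lower_disjoint:
  assumes s1: "s1 \<in> U.open_dom" and s2: "s2 \<in> L.open_dom" and eq: "U.rep s1 = L.rep s2"
  shows False
proof -
  have d: "s1 \<in> U.Dom" "s2 \<in> L.Dom" using s1 s2 U.open_dom_subset L.open_dom_subset by auto
  have "t \<in> L.nodes s2" if t: "t \<in> U.nodes s1" for t
  proof (rule L.interior_touch[OF s2, of "U.nodes s1" "U.mass s1" t])
    have mass: "0 < U.mass s1 r" if "r \<in> U.nodes s1" for r
      using that U.mass_node[OF s1] U.open_domD(1)[OF s1] by auto
    show "U.nodes s1 \<subseteq> {a..b}" using U.node_in[OF d(1)] by auto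
    show "sum (U.mass s1) (U.nodes s1) = 1" by (intro U.sum_mass_one) auto
    show "(\<Sum>t\<in>U.nodes s1. U.mass s1 t *\<^sub>R \<gamma> t) = L.rep s2"
      using U.sum_mass[of "U.nodes s1" s1 \<gamma>] eq by (simp add: U.rep_def)
    show "0 < U.mass s1 t" using mass t .
    show "0 \<le> U.mass s1 r" if "r \<in> U.nodes s1" for r using mass[OF that] by simp
  qed (use t in auto)
  moreover have "b \<in> U.nodes s1" using bU U.open_dom_nodes(4)[OF s1] by auto
  ultimately have "b \<in> L.nodes s2" by blast
  then have "b \<in> L.node s2 ` {length eL..pL}"
    unfolding L.open_dom_nodes(4)[OF s2] using bL by blast
  then have "b \<in> {a<..<b}" unfolding L.open_dom_nodes(2)[OF s2] by blast
  then show False by simp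
qed

theorem B_equal_iff:
  assumes y: "y \<in> U.K"
  shows "L.B y = U.B y \<longleftrightarrow> y \<in> frontier U.K"
proof
  assume "y \<in> frontier U.K"
  then show "L.B y = U.B y" using U.B_boundary[of "(y, L.B y)"] L.B_in_C[OF y] by simp
next
  assume eq: "L.B y = U.B y"
  show "y \<in> frontier U.K"
  proof (rule ccontr)
    assume "y \<notin> frontier U.K"
    then have "y \<in> interior U.K" using y closure_subset by (auto simp: frontier_def)
    then obtain s1 s2 where s: "s1 \<in> U.open_dom" "y = fst (U.rep s1)" "s2 \<in> L.open_dom" "y = fst (L.rep s2)"
      using U.image_open_dom L.image_open_dom by (metis (no_types, lifting) imageE)
    have "U.B y = snd (U.rep s1)" "L.B y = snd (L.rep s2)"
      using s U.B_rep[of s1] L.B_rep[of s2] U.open_dom_subset L.open_dom_subset by auto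
    then have "U.rep s1 = L.rep s2" using s eq by (simp add: prod_eq_iff)
    then show False using upper_lower_disjoint s by blast
  qed
qed

theorem frontier_C: "frontier U.C = {(x, U.B x) | x. x \<in> U.K} \<union> {(x, L.B x) | x. x \<in> U.K}"
proof
  have closed: "closed U.C" using U.compact_C by (rule compact_imp_closed)
  have closedK: "closed U.K" using U.compact_K by (rule compact_imp_closed)
  show "frontier U.C \<subseteq> {(x, U.B x) | x. x \<in> U.K} \<union> {(x, L.B x) | x. x \<in> U.K}"
  proof
    fix Y assume Y: "Y \<in> frontier U.C"
    then have YC: "Y \<in> U.C" "Y \<notin> interior U.C" using closed by (auto simp: frontier_def)
    have b: "fst Y \<in> U.K" "L.B (fst Y) \<le> snd Y" "snd Y \<le> U.B (fst Y)" using between YC(1) by auto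
    have "snd Y = L.B (fst Y) \<or> snd Y = U.B (fst Y)"
    proof (rule ccontr)
      assume ne: "\<not> ?thesis"
      \<comment> \<open>Strictly between the two graphs over the interior of \<open>K\<close> lies an open subset of \<open>C\<close>.\<close>
      let ?S = "interior U.K \<times> (UNIV :: real set)"
      let ?O = "(?S \<inter> (\<lambda>Y. snd Y - L.B (fst Y)) -` {0<..}) \<inter> (?S \<inter> (\<lambda>Y. U.B (fst Y) - snd Y) -` {0<..})"
      have cont: "continuous_on ?S (\<lambda>Y. L.B (fst Y))" "continuous_on ?S (\<lambda>Y. U.B (fst Y))"
      proof -
        have "fst ` ?S \<subseteq> interior U.K" by auto
        also have "\<dots> \<subseteq> U.K" by (rule interior_subset)
        finally have sub: "fst ` ?S \<subseteq> U.K" .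
        show "continuous_on ?S (\<lambda>Y. L.B (fst Y))"
          by (rule continuous_on_compose2[OF L.continuous_B continuous_on_fst[OF continuous_on_id] sub])
        show "continuous_on ?S (\<lambda>Y. U.B (fst Y))"
          by (rule continuous_on_compose2[OF U.continuous_B continuous_on_fst[OF continuous_on_id] sub])
      qed
      have op: "open ?S" by (simp add: open_Times)
      have "open ?O"
        by (intro open_Int continuous_open_preimage[OF _ op] continuous_on_diff cont continuous_on_snd continuous_on_id) auto
      moreover have "?O \<subseteq> U.C"
      proof
        fix Z assume Z: "Z \<in> ?O"
        then have "fst Z \<in> U.K" using interior_subset by (auto simp: mem_Times_iff)
        then show "Z \<in> U.C" using Z between by auto
      qed
      ultimately have O: "?O \<subseteq> interior U.C" by (rule interior_maximal[rotated])
      have "fst Y \<notin> frontier U.K"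
        using B_equal_iff[OF b(1)] b(2,3) ne by auto
      then have "fst Y \<in> interior U.K" using b(1) closedK by (simp add: frontier_def)
      then have "Y \<in> ?O" using ne b by (auto simp: mem_Times_iff)
      then show False using O YC(2) by blast
    qed
    then have "Y = (fst Y, L.B (fst Y)) \<or> Y = (fst Y, U.B (fst Y))" by (simp add: prod_eq_iff)
    then show "Y \<in> {(x, U.B x) | x. x \<in> U.K} \<union> {(x, L.B x) | x. x \<in> U.K}"
      using b(1) by blast
  qed
  have not_interior: "Y \<notin> interior U.C" if ex: "snd Y = U.B (fst Y) \<or> snd Y = L.B (fst Y)" for Y
  proof
    assume "Y \<in> interior U.C"
    then obtain r where r: "0 < r" "cball Y r \<subseteq> U.C" using mem_interior_cball[of Y U.C] by blast
    have "(fst Y, snd Y + r) \<in> cball Y r" "(fst Y, snd Y - r) \<in> cball Y r"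
      using r(1) by (simp_all add: dist_prod_def dist_real_def)
    then have "(fst Y, snd Y + r) \<in> U.C" "(fst Y, snd Y - r) \<in> U.C" using r(2) by auto
    then have "snd Y + r \<le> U.B (fst Y)" "L.B (fst Y) \<le> snd Y - r" using between by auto
    then show False using ex r(1) by auto
  qed
  show "{(x, U.B x) | x. x \<in> U.K} \<union> {(x, L.B x) | x. x \<in> U.K} \<subseteq> frontier U.C"
  proof
    fix Y assume "Y \<in> {(x, U.B x) | x. x \<in> U.K} \<union> {(x, L.B x) | x. x \<in> U.K}"
    then obtain x where x: "x \<in> U.K" "Y = (x, U.B x) \<or> Y = (x, L.B x)" by blast
    then have "Y \<in> U.C" "snd Y = U.B (fst Y) \<or> snd Y = L.B (fst Y)"
      using U.B_in_C[OF x(1)] L.B_in_C[OF x(1)] by auto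
    then show "Y \<in> frontier U.C" using not_interior closed by (simp add: frontier_def)
  qed
qed

end

theorem theorem2p1:
  fixes a b :: real
    and \<gamma> :: "real \<Rightarrow> (real ^ 'n::{finite,linorder}) \<times> real"
  defines "K \<equiv> convex hull ((\<lambda>t. fst (\<gamma> t)) ` {a..b})"
    and "Ubar \<equiv> (\<lambda>s. fst (U_map a b \<gamma> s))"
    and "Lbar \<equiv> (\<lambda>s. fst (L_map a b \<gamma> s))"
    and "Bsup \<equiv> B_sup a b \<gamma>"
    and "Binf \<equiv> B_inf a b \<gamma>"
  assumes "a < b"
    and "continuous_on {a..b} \<gamma>"
    and "Ck_curve_on (CARD('n) + 1) \<gamma> {a<..<b}"
    and "totally_positive_torsion a b \<gamma>"
  shows
    "(\<forall>l\<ge>1. CARD('n) = 2 * l \<longrightarrow>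
        Ubar ` frontier (Delta_prod l l a b) = frontier K \<and>
        Lbar ` frontier (Delta_prod l l a b) = frontier K \<and>
        C1_diffeo Ubar (interior (Delta_prod l l a b)) (interior K) \<and>
        C1_diffeo Lbar (interior (Delta_prod l l a b)) (interior K))
     \<and>
     (\<forall>l\<ge>1. CARD('n) = 2 * l - 1 \<longrightarrow>
        Ubar ` frontier (Delta_prod l (l - 1) a b) = frontier K \<and>
        Lbar ` frontier (Delta_prod (l - 1) l a b) = frontier K \<and>
        C1_diffeo Ubar (interior (Delta_prod l (l - 1) a b)) (interior K) \<and>
        C1_diffeo Lbar (interior (Delta_prod (l - 1) l a b)) (interior K))
     \<and>
     (well_defined_graph (U_map a b \<gamma>) (U_dom a b) \<and>
      well_defined_graph (L_map a b \<gamma>) (L_dom a b) \<and>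
      Ubar ` U_dom a b = K \<and> Lbar ` L_dom a b = K \<and>
      continuous_on K Bsup \<and> C1_on Bsup (interior K) \<and>
      continuous_on K Binf \<and> C1_on Binf (interior K))
     \<and>
     (minimal_concave K
        (\<lambda>g. \<forall>t\<in>{a..b}. if CARD('n) = 1 then g (fst (\<gamma> t)) \<ge> snd (\<gamma> t)
                         else g (fst (\<gamma> t)) = snd (\<gamma> t)) Bsup \<and>
      maximal_convex K (\<lambda>g. \<forall>t\<in>{a..b}. g (fst (\<gamma> t)) = snd (\<gamma> t)) Binf)
     \<and>
     (\<forall>y\<in>K. Binf y = Bsup y \<longleftrightarrow> y \<in> frontier K)
     \<and>
     frontier (convex hull (\<gamma> ` {a..b})) =
       {(x, Bsup x) | x. x \<in> K} \<union> {(x, Binf x) | x. x \<in> K}"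
proof -
  define N where "N = CARD('n)"
  define eU where "eU = (if even N then [b] else [a, b])"
  define eL where "eL = (if even N then [a] else [])"
  define pU where "pU = (N + 1) div 2"
  define pL where "pL = N div 2"
  have N: "CARD('n) = N" by (simp add: N_def)
  interpret upper_lower a b \<gamma> eU pU "N - pU" eL pL "N - pL"
  proof (unfold_locales; (fact assms)?)
    show "set eU \<subseteq> {a, b}" "distinct eU" "set eL \<subseteq> {a, b}" "distinct eL" "b \<in> set eU" "b \<notin> set eL"
      using \<open>a < b\<close> by (auto simp: eU_def eL_def)
    show "pU + (N - pU) = CARD('n)" "pL + (N - pL) = CARD('n)" by (simp_all add: N_def pU_def pL_def)
    show "pU + 1 = N - pU + length eU" "pL + 1 = N - pL + length eL"
      by (cases "even N"; auto simp: eU_def eL_def pU_def pL_def elim!: evenE oddE)+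
  qed
  have U: "U.rep = U_map a b \<gamma> \<and> U.Dom = U_dom a b"
  proof (cases "even N")
    case True
    then have "eU = [b]" by (simp add: eU_def)
    then show ?thesis using U.U_even_rep by blast
  next
    case False
    then have "eU = [a, b]" by (simp add: eU_def)
    then show ?thesis using U.U_odd_rep by blast
  qed
  have L: "L.rep = L_map a b \<gamma> \<and> L.Dom = L_dom a b"
  proof (cases "even N")
    case True
    then have "eL = [a]" by (simp add: eL_def)
    then show ?thesis using L.L_even_rep by blast
  next
    case False
    then have "eL = []" by (simp add: eL_def)
    then show ?thesis using L.L_odd_rep by blast
  qed
  have B: "U.B = Bsup" "L.B = Binf"
    using U L unfolding U.B_def L.B_def Bsup_def Binf_def B_sup_def B_inf_def by simp_all
  have maps: "(\<lambda>s. fst (U.rep s)) = Ubar" "(\<lambda>s. fst (L.rep s)) = Lbar"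
    using U L unfolding Ubar_def Lbar_def by simp_all
  have onto: "Ubar ` U_dom a b = K" "Lbar ` L_dom a b = K"
    using U.image_dom L.image_dom U L unfolding maps K_def[symmetric] by simp_all
  have wd: "well_defined_graph (U_map a b \<gamma>) (U_dom a b)" "well_defined_graph (L_map a b \<gamma>) (L_dom a b)"
    using U.well_defined L.well_defined U L by simp_all
  note regular = U.continuous_B U.C1_B L.continuous_B L.C1_B
  note boundary = U.image_frontier[unfolded maps, folded K_def] L.image_frontier[unfolded maps, folded K_def]
  note diffeo = U.diffeo[unfolded maps, folded K_def] L.diffeo[unfolded maps, folded K_def]
  have even_case: "pU = l" "pL = l" "N - l = l" if "CARD('n) = 2 * l" for l
    using that by (simp_all add: N pU_def pL_def)
  have odd_case: "pU = l" "N - l = l - 1" "pL = l - 1" "N - (l - 1) = l" if "1 \<le> l" "CARD('n) = 2 * l - 1" for l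
    using that by (auto simp: N pU_def pL_def)
  show ?thesis
  proof (intro conjI allI impI)
    fix l assume "CARD('n) = 2 * l"
    note l = even_case[OF this]
    show "Ubar ` frontier (Delta_prod l l a b) = frontier K"
      "Lbar ` frontier (Delta_prod l l a b) = frontier K"
      "C1_diffeo Ubar (interior (Delta_prod l l a b)) (interior K)"
      "C1_diffeo Lbar (interior (Delta_prod l l a b)) (interior K)"
      by (fact boundary[unfolded l] diffeo[unfolded l])+
  next
    fix l :: nat assume "1 \<le> l" "CARD('n) = 2 * l - 1"
    note l = odd_case[OF this]
    show "Ubar ` frontier (Delta_prod l (l - 1) a b) = frontier K"
      "Lbar ` frontier (Delta_prod (l - 1) l a b) = frontier K"
      "C1_diffeo Ubar (interior (Delta_prod l (l - 1) a b)) (interior K)"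
      "C1_diffeo Lbar (interior (Delta_prod (l - 1) l a b)) (interior K)"
      by (fact boundary[unfolded l] diffeo[unfolded l])+
  next
    show "continuous_on K Bsup" "C1_on Bsup (interior K)" "continuous_on K Binf" "C1_on Binf (interior K)"
      by (fact regular[unfolded B, folded K_def])+
  next
    show "\<forall>y\<in>K. Binf y = Bsup y \<longleftrightarrow> y \<in> frontier K"
      by (intro ballI B_equal_iff[unfolded B, folded K_def])
  next
    show "frontier (convex hull (\<gamma> ` {a..b})) = {(x, Bsup x) | x. x \<in> K} \<union> {(x, Binf x) | x. x \<in> K}"
      by (fact frontier_C[unfolded B, folded K_def])
  qed (fact wd onto minimal_BU[unfolded B, folded K_def] maximal_BL[unfolded B, folded K_def])+
qed

end
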